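(* If $G$ is a countable graph and $ETOP(G)$ has a topological Euler tour, then $MTOP(L(G))$ has a Hamilton circle.
   Context: Graphs are viewed as 1-complexes (each edge is a copy of $[0,1]$). A ray is a 1-way infinite path. $ETOP$: Two rays of $G$ are edge-equivalent if no finite set of edges separates them; the equivalence classes are the edge-ends, and $\Omega'(G)$ denotes the set of edge-ends. $ETOP'(G)$ is the space $G\cup\Omega'(G)$ with the topology generated by the open subsets of the interiors of edges together with all sets $C\cup\Omega'(C)\cup E'(C)$, where $S\subset E(G)$ is finite, $C$ is a component of $G-S$, $\Omega'(C)$ is the set of edge-ends having a ray in $C$, and $E'(C)$ is any union of half-edges $(z,y]$, one for every edge $e=xy\in S$ with $y$ lying in $C$ ($z$ an inner point of $e$). $ETOP(G)$ is the space obtained from $ETOP'(G)$ by identifying any two points having the same open neighbourhoods. A topological Euler tour of $ETOP(G)$ is a continuous map $\sigma:S^1\to ETOP(G)$ that traverses each edge of $G$ precisely once. $L(G)$ is the line graph of $G$: its vertex set is $E(G)$, and two vertices are adjacent if they are incident as edges of $G$. $MTOP$: For a graph $H$, two rays are vertex-equivalent if no finite set of vertices separates them; the classes are the vertex-ends, and $\Omega(H)$ denotes the set of vertex-ends. $MTOP(H)$ is the space $H\cup\Omega(H)$ with the following topology: each edge is a copy of $[0,1]$ bearing the corresponding metric and topology (so open subsets of edge interiors are open); the basic open neighbourhoods of a vertex $v$ are the open stars of radius $\varepsilon$ centred at $v$, for $0<\varepsilon<1$; for a vertex-end $\omega$ the sets $C(S,\omega)\cup\Omega(S,\omega)\cup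 \mathring{E}_\varepsilon(S,\omega)$ are open, where $S\subseteq V(H)$ is finite, $C(S,\omega)$ is the unique component of $H-S$ containing a ray in $\omega$, $\Omega(S,\omega)$ is the set of vertex-ends having a ray in $C(S,\omega)$, and $\mathring{E}_\varepsilon(S,\omega)$ is the set of all inner points of $S$--$C(S,\omega)$ edges at distance less than $\varepsilon$ from their endpoint in $C(S,\omega)$. A Hamilton circle of $MTOP(H)$ is a homeomorphic image of $S^1$ in $MTOP(H)$ containing all vertices of $H$. *)

theory Defs
  imports "HOL-Analysis.Analysis"
begin

section \<open>Graphs\<close>

type_synonym 'v graph = "'v set \<times> 'v set set"

abbreviation verts :: "'v graph \<Rightarrow> 'v set" where "verts \<equiv> fst"
abbreviation edges :: "'v graph \<Rightarrow> 'v set set" where "edges \<equiv> snd"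

definition simple_graph :: "'v graph \<Rightarrow> bool" where
  "simple_graph G \<longleftrightarrow>
     (\<forall>e\<in>edges G. \<exists>x\<in>verts G. \<exists>y\<in>verts G. x \<noteq> y \<and> e = {x, y})"

definition line_graph :: "'v graph \<Rightarrow> 'v set graph" where
  "line_graph G =
     (edges G, {{e, f} | e f. e \<in> edges G \<and> f \<in> edges G \<and> e \<noteq> f \<and> e \<inter> f \<noteq> {}})"

definition del_edges :: "'v graph \<Rightarrow> 'v set set \<Rightarrow> 'v graph" where
  "del_edges G S = (verts G, edges G - S)"

definition del_verts :: "'v graph \<Rightarrow> 'v set \<Rightarrow> 'v graph" where
  "del_verts G S = (verts G - S, {e \<in> edges G. e \<inter> S = {}})"

definition linked :: "'v graph \<Rightarrow> ('v \<times> 'v) set" where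
  "linked G = {(x, y). x \<in> verts G \<and> y \<in> verts G \<and> (x, y) \<in> {(u, v). {u, v} \<in> edges G}\<^sup>*}"

definition components :: "'v graph \<Rightarrow> 'v graph set" where
  "components G = (\<lambda>U. (U, {e \<in> edges G. e \<subseteq> U})) ` (verts G // linked G)"

text \<open>A ray is given by its vertices in their order along the path, starting at its
  endvertex; this order is determined by the ray as a subgraph.\<close>

definition ray :: "'v graph \<Rightarrow> (nat \<Rightarrow> 'v) \<Rightarrow> bool" where
  "ray G r \<longleftrightarrow> inj r \<and> range r \<subseteq> verts G \<and> (\<forall>n. {r n, r (Suc n)} \<in> edges G)"

definition tail_in :: "'v graph \<Rightarrow> (nat \<Rightarrow> 'v) \<Rightarrow> bool" where
  "tail_in C r \<longleftrightarrow> (\<exists>n. ray C (\<lambda>i. r (i + n)))"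

text \<open>A finite set of edges or vertices separates two rays if their tails lie in
  different components of the graph that remains after its deletion.\<close>

definition edge_equivalent :: "'v graph \<Rightarrow> (nat \<Rightarrow> 'v) \<Rightarrow> (nat \<Rightarrow> 'v) \<Rightarrow> bool" where
  "edge_equivalent G r s \<longleftrightarrow>
     (\<forall>S. finite S \<and> S \<subseteq> edges G \<longrightarrow>
        (\<exists>C \<in> components (del_edges G S). tail_in C r \<and> tail_in C s))"

definition vertex_equivalent :: "'v graph \<Rightarrow> (nat \<Rightarrow> 'v) \<Rightarrow> (nat \<Rightarrow> 'v) \<Rightarrow> bool" where
  "vertex_equivalent G r s \<longleftrightarrow>
     (\<forall>S. finite S \<and> S \<subseteq> verts G \<longrightarrow>
        (\<exists>C \<in> components (del_verts G S). tail_in C r \<and> tail_in C s))"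

definition edge_ends :: "'v graph \<Rightarrow> (nat \<Rightarrow> 'v) set set" where
  "edge_ends G = {r. ray G r} // {(r, s). ray G r \<and> ray G s \<and> edge_equivalent G r s}"

definition vertex_ends :: "'v graph \<Rightarrow> (nat \<Rightarrow> 'v) set set" where
  "vertex_ends G = {r. ray G r} // {(r, s). ray G r \<and> ray G s \<and> vertex_equivalent G r s}"


section \<open>Graphs as 1-complexes\<close>

text \<open>A point of the 1-complex is represented by its barycentric coordinates, a function
  \<open>p\<close> from vertices to reals. On an edge \<open>e = {x, y}\<close> we have \<open>p x + p y = 1\<close>, and
  \<open>p \<mapsto> p y\<close> identifies \<open>e\<close> with the unit interval, \<open>x\<close> corresponding to 0 and \<open>y\<close> to 1; in
  particular \<open>p\<close> has distance \<open>1 - p y\<close> from \<open>y\<close>.\<close>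

definition vertex_pt :: "'v \<Rightarrow> 'v \<Rightarrow> real" where
  "vertex_pt v = (\<lambda>u. if u = v then 1 else 0)"

definition inner_pts :: "'v set \<Rightarrow> ('v \<Rightarrow> real) set" where
  "inner_pts e = {p. (\<forall>v\<in>e. p v > 0) \<and> (\<forall>v. v \<notin> e \<longrightarrow> p v = 0) \<and> (\<Sum>v\<in>e. p v) = 1}"

definition complex_pts :: "'v graph \<Rightarrow> ('v \<Rightarrow> real) set" where
  "complex_pts G = vertex_pt ` verts G \<union> (\<Union>e\<in>edges G. inner_pts e)"

definition open_in_edge :: "'v set \<Rightarrow> ('v \<Rightarrow> real) set \<Rightarrow> bool" where
  "open_in_edge e W \<longleftrightarrow> (\<exists>x\<in>e. \<exists>U. open U \<and> W = {p \<in> inner_pts e. p x \<in> U})"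

text \<open>The half-edge \<open>(z, y]\<close> of \<open>e\<close>, for an inner point \<open>z\<close> of \<open>e\<close> and an endvertex \<open>y\<close>.\<close>

definition half_edge :: "'v set \<Rightarrow> ('v \<Rightarrow> real) \<Rightarrow> 'v \<Rightarrow> ('v \<Rightarrow> real) set" where
  "half_edge e z y = {p \<in> inner_pts e. z y < p y} \<union> {vertex_pt y}"

datatype 'v space_pt = Pt "'v \<Rightarrow> real" | End "(nat \<Rightarrow> 'v) set"


section \<open>ETOP and topological Euler tours\<close>

text \<open>If both endvertices of a deleted edge \<open>e\<close> lie in \<open>C\<close>, then \<open>e\<close> contributes a half-edge at
  each of them; hence the chosen inner point \<open>z e y\<close> depends on the endvertex \<open>y\<close> as well.\<close>

definition ETOP'_basic :: "'v graph \<Rightarrow> 'v space_pt set set" where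
  "ETOP'_basic G =
     {Pt ` complex_pts C
      \<union> End ` {\<omega> \<in> edge_ends G. \<exists>r\<in>\<omega>. ray C r}
      \<union> Pt ` (\<Union>e\<in>S. \<Union>y \<in> e \<inter> verts C. half_edge e (z e y) y)
      | S C z. finite S \<and> S \<subseteq> edges G \<and> C \<in> components (del_edges G S) \<and>
               (\<forall>e\<in>S. \<forall>y \<in> e \<inter> verts C. z e y \<in> inner_pts e)}"

definition ETOP' :: "'v graph \<Rightarrow> 'v space_pt topology" where
  "ETOP' G = topology_generated_by
     ({Pt ` W | e W. e \<in> edges G \<and> open_in_edge e W} \<union> ETOP'_basic G)"

text \<open>\<^const>\<open>Kolmogorov_quotient\<close> sends each point to a representative of its class of
  topologically indistinguishable points. By \<open>quotient_map_Kolmogorov_quotient\<close>, the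
  subspace of representatives is the quotient space.\<close>

definition ETOP :: "'v graph \<Rightarrow> 'v space_pt topology" where
  "ETOP G = subtopology (ETOP' G) (Kolmogorov_quotient (ETOP' G) ` topspace (ETOP' G))"

abbreviation circle :: "complex topology" where
  "circle \<equiv> top_of_set (sphere 0 1)"

text \<open>An edge is traversed precisely once if each of its inner points is the image of
  exactly one point of the circle.\<close>

definition euler_tour :: "'v graph \<Rightarrow> (complex \<Rightarrow> 'v space_pt) \<Rightarrow> bool" where
  "euler_tour G \<sigma> \<longleftrightarrow>
     continuous_map circle (ETOP G) \<sigma> \<and>
     (\<forall>e\<in>edges G. \<forall>p\<in>inner_pts e.
        \<exists>!s. s \<in> sphere 0 1 \<and> \<sigma> s = Kolmogorov_quotient (ETOP' G) (Pt p))"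


section \<open>MTOP and Hamilton circles\<close>

definition open_star :: "'v graph \<Rightarrow> 'v \<Rightarrow> real \<Rightarrow> ('v \<Rightarrow> real) set" where
  "open_star H v \<epsilon> =
     {vertex_pt v} \<union> (\<Union>e \<in> {e \<in> edges H. v \<in> e}. {p \<in> inner_pts e. 1 - p v < \<epsilon>})"

definition edge_nbhd :: "'v graph \<Rightarrow> 'v set \<Rightarrow> 'v graph \<Rightarrow> real \<Rightarrow> ('v \<Rightarrow> real) set" where
  "edge_nbhd H S C \<epsilon> =
     {p. \<exists>x\<in>S. \<exists>y\<in>verts C. {x, y} \<in> edges H \<and> p \<in> inner_pts {x, y} \<and> 1 - p y < \<epsilon>}"

definition MTOP_end_nbhds :: "'v graph \<Rightarrow> 'v space_pt set set" where
  "MTOP_end_nbhds H =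
     {Pt ` complex_pts C
      \<union> End ` {\<omega>' \<in> vertex_ends H. \<exists>r\<in>\<omega>'. ray C r}
      \<union> Pt ` edge_nbhd H S C \<epsilon>
      | S C \<omega> \<epsilon>. finite S \<and> S \<subseteq> verts H \<and> \<omega> \<in> vertex_ends H \<and>
                 C \<in> components (del_verts H S) \<and> (\<exists>r\<in>\<omega>. ray C r) \<and> 0 < \<epsilon>}"

definition MTOP :: "'v graph \<Rightarrow> 'v space_pt topology" where
  "MTOP H = topology_generated_by
     ({Pt ` W | e W. e \<in> edges H \<and> open_in_edge e W}
      \<union> {Pt ` open_star H v \<epsilon> | v \<epsilon>. v \<in> verts H \<and> 0 < \<epsilon> \<and> \<epsilon> < 1}
      \<union> MTOP_end_nbhds H)"

definition hamilton_circle :: "'v graph \<Rightarrow> 'v space_pt set \<Rightarrow> bool" where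
  "hamilton_circle H K \<longleftrightarrow>
     K \<subseteq> topspace (MTOP H) \<and>
     circle homeomorphic_space subtopology (MTOP H) K \<and>
     (\<forall>v\<in>verts H. Pt (vertex_pt v) \<in> K)"

end

theory Submission
  imports Defs
begin

text \<open>
  The proof passes through the parity of finite cuts. Let \<open>\<sigma>\<close> be a topological Euler tour of
  ETOP(G). Every finite cut of \<open>G\<close> splits ETOP(G), apart from the midpoints of the cut edges, into
  two disjoint open sides, and \<open>\<sigma>\<close> passes each of these midpoints once. Near a midpoint the tour is
  injective, hence monotone along the edge, so it changes sides there; as it returns to where it
  started, the number of cut edges is even (\<open>even_finite_cut\<close>). An empty cut cannot separate two
  edges for the same reason, so the line graph is connected.

  What remains is combinatorics of \<open>G\<close> and topology of MTOP(L(G)). Parity is inherited when the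
  edges of a finite closed trail are deleted, and it excludes bridges, so every edge lies on a
  finite closed trail (\<open>closed_trail_containing\<close>). Starting from one closed trail \<open>D\<^sub>0\<close>, one
  repeatedly inserts a closed trail \<open>T\<close> of unused edges into the current closed trail, between two
  consecutive edges at a vertex of \<open>T\<close>. The following rule makes the limit pass every end only
  once. The components that are left when the edges of the current trail are deleted from L(G) are
  assigned, injectively, to gaps between consecutive edges, and all later edges of a component are
  inserted into its gap. When \<open>T\<close> is inserted, the components into which its own component breaks up
  receive new gaps strictly inside \<open>T\<close> (\<open>closed_trail_with_inner_contacts\<close>). The gaps before and
  after \<open>T\<close> are thus closed for good, so in the limit every edge of \<open>G\<close> has an immediate
  predecessor and an immediate successor, and these are its neighbours in L(G). The outcome is the
  structure \<open>circular_layout\<close>: a linear order of the vertices of \<open>H\<close> = L(G) together with finite sets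
  \<open>F\<^sub>0 \<subseteq> F\<^sub>1 \<subseteq> \<dots>\<close> exhausting them, such that two vertices outside \<open>F\<^sub>n\<close> lie in the same component of
  \<open>H - F\<^sub>n\<close> if and only if no element of \<open>F\<^sub>n\<close> lies between them.

  Such an order is drawn on an interval by giving the vertices positive summable weights and placing
  \<open>x\<close> at the total weight of its predecessors. Between \<open>x\<close> and its successor the curve runs along the
  edge joining them. Any other point \<open>s\<close> of the interval is a cut of the order without adjacent
  elements; for every \<open>n\<close> it singles out one component of \<open>H - F\<^sub>n\<close>, these components are nested, and
  they determine a vertex-end, which is the value of the curve at \<open>s\<close>. Different cuts are separated
  by some \<open>F\<^sub>n\<close> and hence give different ends; and near \<open>s\<close> the curve stays in the component singled
  out by \<open>s\<close>, which is continuity. So the curve is continuous and injective up to its coinciding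
  endpoints, and since MTOP(H) is Hausdorff its image is a circle through all vertices.
\<close>

section \<open>Components, rays and ends\<close>

lemma equiv_linked: "equiv (verts G) (linked G)"
proof -
  have "sym {(u, v). {u, v} \<in> edges G}" by (auto simp: sym_def insert_commute)
  then have "sym ({(u, v). {u, v} \<in> edges G}\<^sup>*)" by (rule sym_rtrancl)
  then show ?thesis
    by (intro equivI refl_onI symI transI) (auto simp: linked_def dest: symD)
qed

lemma componentE:
  assumes "C \<in> components G"
  obtains x where "x \<in> verts G" "verts C = linked G `` {x}"
    "edges C = {e \<in> edges G. e \<subseteq> verts C}"
  using assms by (auto simp: components_def elim!: quotientE)

lemma component_linked:
  assumes "C \<in> components G" "x \<in> verts C"
  shows "y \<in> verts C \<longleftrightarrow> (x, y) \<in> linked G"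
proof -
  obtain z where z: "verts C = linked G `` {z}" using componentE[OF assms(1)] .
  then have "(z, x) \<in> linked G" using assms(2) by simp
  then have "linked G `` {z} = linked G `` {x}" by (rule equiv_class_eq[OF equiv_linked])
  then show ?thesis using z by simp
qed

lemma component_verts: "C \<in> components G \<Longrightarrow> verts C \<subseteq> verts G"
  by (auto simp: linked_def elim: componentE)

lemma component_edges: "C \<in> components G \<Longrightarrow> edges C = {e \<in> edges G. e \<subseteq> verts C}"
  by (auto elim: componentE)

lemma in_component:
  assumes "x \<in> verts G"
  obtains C where "C \<in> components G" "x \<in> verts C"
proof -
  let ?U = "linked G `` {x}"
  have "?U \<in> verts G // linked G" using assms by (rule quotientI)
  then have "(?U, {e \<in> edges G. e \<subseteq> ?U}) \<in> components G" unfolding components_def by (rule imageI)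
  moreover have "x \<in> ?U" using equiv_class_self[OF equiv_linked assms] .
  ultimately show ?thesis using that[of "(?U, {e \<in> edges G. e \<subseteq> ?U})"] by simp
qed

lemma component_eqI:
  assumes "C \<in> components G" "C' \<in> components G" "x \<in> verts C" "x \<in> verts C'"
  shows "C = C'"
proof -
  have v: "verts C = verts C'"
    using component_linked[OF assms(1,3)] component_linked[OF assms(2,4)] by blast
  then have "edges C = edges C'" using component_edges assms(1,2) by metis
  with v show ?thesis by (rule prod_eqI)
qed

lemma component_closed:
  assumes "C \<in> components G" "x \<in> verts C" "{x, y} \<in> edges G" "y \<in> verts G"
  shows "y \<in> verts C"
proof -
  have "x \<in> verts G" using component_verts assms(1,2) by blast
  then have "(x, y) \<in> linked G" using assms by (auto simp: linked_def)
  then show ?thesis using component_linked[OF assms(1,2)] by blast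
qed

lemma tail_in_eventually:
  assumes "tail_in C r"
  shows "\<exists>i. \<forall>j\<ge>i. r j \<in> verts C"
proof -
  obtain n where n: "ray C (\<lambda>i. r (i + n))" using assms by (auto simp: tail_in_def)
  have "r j \<in> verts C" if "n \<le> j" for j
  proof -
    have "r ((j - n) + n) \<in> verts C" using n unfolding ray_def by blast
    then show ?thesis using that by simp
  qed
  then show ?thesis by blast
qed

lemma inj_shift: "inj r \<Longrightarrow> inj (\<lambda>k::nat. r (k + i))"
  by (rule injI) (simp add: inj_eq)

lemma ray_tail: "ray G r \<Longrightarrow> ray G (\<lambda>k. r (k + i))"
  unfolding ray_def by (auto simp: inj_shift)

lemma ray_tail_in_component:
  assumes C: "C \<in> components G" and r: "inj r"
    and "\<And>j. i \<le> j \<Longrightarrow> r j \<in> verts C" "\<And>j. i \<le> j \<Longrightarrow> {r j, r (Suc j)} \<in> edges G"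
  shows "ray C (\<lambda>k. r (k + i))"
  unfolding ray_def component_edges[OF C]
  using assms by (auto simp: inj_shift)

text \<open>From some index on the ray lies in the smaller graph and hence in one component of it.\<close>

lemma ray_eventually_linked:
  assumes "ray G r" and "\<And>j. i \<le> j \<Longrightarrow> r j \<in> verts G'" "\<And>j. i \<le> j \<Longrightarrow> {r j, r (Suc j)} \<in> edges G'"
  shows "\<exists>C\<in>components G'. tail_in C r"
proof -
  obtain C where C: "C \<in> components G'" "r i \<in> verts C"
    using in_component[OF assms(2)[OF order_refl]] .
  have "r j \<in> verts C" if "i \<le> j" for j
    using that
  proof (induction j rule: dec_induct)
    case (step j)
    then show ?case using component_closed[OF C(1), of "r j" "r (Suc j)"] assms(2,3) by simp
  qed (rule C(2))
  then have "ray C (\<lambda>k. r (k + i))"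
    using ray_tail_in_component[OF C(1)] assms by (simp add: ray_def)
  then show ?thesis using C(1) by (auto simp: tail_in_def)
qed

text \<open>Both kinds of ends are classes of rays that no graph of a given family tells apart, the family
  consisting of the graphs left after a finite deletion. Transitivity holds because a ray has
  tails in only one component of each of these graphs.\<close>

lemma equiv_tails:
  assumes "\<And>r G. r \<in> A \<Longrightarrow> G \<in> \<D> \<Longrightarrow> \<exists>C\<in>components G. tail_in C r"
  shows "equiv A {(r, s). r \<in> A \<and> s \<in> A \<and> (\<forall>G\<in>\<D>. \<exists>C\<in>components G. tail_in C r \<and> tail_in C s)}"
proof -
  have "\<exists>C\<in>components G. tail_in C r \<and> tail_in C t"
    if rst: "\<exists>C\<in>components G. tail_in C r \<and> tail_in C s" "\<exists>C\<in>components G. tail_in C s \<and> tail_in C t" for G r s t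
  proof -
    obtain C C' where C: "C \<in> components G" "tail_in C r" "tail_in C s"
      "C' \<in> components G" "tail_in C' s" "tail_in C' t" using rst by (elim bexE conjE)
    obtain i where i: "\<forall>j\<ge>i. s j \<in> verts C" using tail_in_eventually[OF C(3)] by (elim exE)
    obtain k where k: "\<forall>j\<ge>k. s j \<in> verts C'" using tail_in_eventually[OF C(5)] by (elim exE)
    have "C = C'" using component_eqI[OF C(1,4), of "s (max i k)"] i k by simp
    then show ?thesis using C by blast
  qed
  note tr = this
  show ?thesis
  proof (intro equivI refl_onI symI transI)
    fix r s t
    assume "(r, s) \<in> {(r, s). r \<in> A \<and> s \<in> A \<and> (\<forall>G\<in>\<D>. \<exists>C\<in>components G. tail_in C r \<and> tail_in C s)}"
      "(s, t) \<in> {(r, s). r \<in> A \<and> s \<in> A \<and> (\<forall>G\<in>\<D>. \<exists>C\<in>components G. tail_in C r \<and> tail_in C s)}"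
    then show "(r, t) \<in> {(r, s). r \<in> A \<and> s \<in> A \<and> (\<forall>G\<in>\<D>. \<exists>C\<in>components G. tail_in C r \<and> tail_in C s)}"
      using tr[of _ r s t] by simp
  qed (use assms in auto)
qed

lemma tail_in_tail:
  assumes "C \<in> components G" "tail_in C r"
  shows "tail_in C (\<lambda>k. r (k + i))"
proof -
  obtain n where n: "ray C (\<lambda>k. r (k + n))" using assms(2) by (auto simp: tail_in_def)
  have "ray C (\<lambda>k. r ((k + n) + i))" using ray_tail[OF n, of i] by (simp add: ac_simps)
  then show ?thesis unfolding tail_in_def by blast
qed

lemma component_unique_tail:
  assumes "C \<in> components G" "C' \<in> components G" "tail_in C r" "tail_in C' r"
  shows "C = C'"
proof -
  obtain i where i: "\<forall>j\<ge>i. r j \<in> verts C" using tail_in_eventually[OF assms(3)] by (elim exE)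
  obtain k where k: "\<forall>j\<ge>k. r j \<in> verts C'" using tail_in_eventually[OF assms(4)] by (elim exE)
  show ?thesis using component_eqI[OF assms(1,2), of "r (max i k)"] i k by simp
qed

lemma ray_tail_in: "ray C r \<Longrightarrow> tail_in C r"
  unfolding tail_in_def by (rule exI[of _ 0]) simp


subsection \<open>Vertex-ends\<close>

lemma ray_tail_avoiding_vertices:
  assumes r: "ray H r" and S: "finite S"
  shows "\<exists>C\<in>components (del_verts H S). tail_in C r"
proof -
  have inj: "inj r" using r by (simp add: ray_def)
  have "finite (r -` S)" using finite_vimageI[OF S inj] .
  from finite_nat_bounded[OF this] obtain i where sub: "r -` S \<subseteq> {..<i}" by (elim exE)
  have i: "r j \<notin> S" if "i \<le> j" for j
  proof
    assume "r j \<in> S"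
    then have "j \<in> {..<i}" using sub by (intro subsetD[OF sub]) simp
    then show False using that by simp
  qed
  show ?thesis
    by (rule ray_eventually_linked[OF r, of i]) (use r i in \<open>auto simp: ray_def del_verts_def\<close>)
qed

lemma equiv_vertex_equivalent:
  "equiv {r. ray H r} {(r, s). ray H r \<and> ray H s \<and> vertex_equivalent H r s}"
proof -
  let ?D = "del_verts H ` {S. finite S \<and> S \<subseteq> verts H}"
  have eq: "{(r, s). ray H r \<and> ray H s \<and> vertex_equivalent H r s} = {(r, s). r \<in> {r. ray H r} \<and>
      s \<in> {r. ray H r} \<and> (\<forall>G\<in>?D. \<exists>C\<in>components G. tail_in C r \<and> tail_in C s)}"
    by (simp add: vertex_equivalent_def)
  show ?thesis unfolding eq
  proof (rule equiv_tails)
    fix r G assume "r \<in> {r. ray H r}" "G \<in> ?D"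
    then show "\<exists>C\<in>components G. tail_in C r" using ray_tail_avoiding_vertices[of H r] by auto
  qed
qed

lemma vertex_end_of_ray:
  assumes "ray H r"
  obtains \<omega> where "\<omega> \<in> vertex_ends H" "r \<in> \<omega>"
proof (rule that)
  let ?R = "{(r, s). ray H r \<and> ray H s \<and> vertex_equivalent H r s}"
  have r: "r \<in> {r. ray H r}" using assms by simp
  show "?R `` {r} \<in> vertex_ends H" unfolding vertex_ends_def using r by (rule quotientI)
  show "r \<in> ?R `` {r}" by (rule equiv_class_self[OF equiv_vertex_equivalent r])
qed

lemma vertex_end_ray:
  assumes "\<omega> \<in> vertex_ends H" "r \<in> \<omega>"
  shows "ray H r"
proof -
  have "\<omega> \<subseteq> {r. ray H r}"
    by (rule in_quotient_imp_subset[OF equiv_vertex_equivalent assms(1)[unfolded vertex_ends_def]])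
  from subsetD[OF this assms(2)] show ?thesis by simp
qed

lemma vertex_end_nonempty:
  assumes "\<omega> \<in> vertex_ends H"
  shows "\<exists>r. r \<in> \<omega>"
proof -
  have "\<omega> \<noteq> {}"
    by (rule in_quotient_imp_non_empty[OF equiv_vertex_equivalent assms(1)[unfolded vertex_ends_def]])
  then show ?thesis by (simp add: ex_in_conv)
qed

lemma vertex_ends_eq_iff:
  assumes "\<omega> \<in> vertex_ends H" "\<omega>' \<in> vertex_ends H" "r \<in> \<omega>" "r' \<in> \<omega>'"
  shows "\<omega> = \<omega>' \<longleftrightarrow> vertex_equivalent H r r'"
  using quotient_eq_iff[OF equiv_vertex_equivalent assms[unfolded vertex_ends_def]]
    vertex_end_ray[OF assms(1,3)] vertex_end_ray[OF assms(2,4)] by simp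

lemma vertex_end_tail:
  assumes "\<omega> \<in> vertex_ends H" "r \<in> \<omega>"
  shows "(\<lambda>k. r (k + i)) \<in> \<omega>"
proof -
  have r: "ray H r" using vertex_end_ray[OF assms] .
  obtain \<omega>' where \<omega>': "\<omega>' \<in> vertex_ends H" "(\<lambda>k. r (k + i)) \<in> \<omega>'"
    using vertex_end_of_ray[OF ray_tail[OF r]] .
  have "vertex_equivalent H r (\<lambda>k. r (k + i))"
    unfolding vertex_equivalent_def using ray_tail_avoiding_vertices[OF r] tail_in_tail by blast
  then have "\<omega> = \<omega>'" using vertex_ends_eq_iff[OF assms(1) \<omega>'(1) assms(2) \<omega>'(2)] by simp
  then show ?thesis using \<omega>'(2) by simp
qed

lemma vertex_end_component:
  assumes "\<omega> \<in> vertex_ends H" "finite S" "S \<subseteq> verts H"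
  obtains C where "C \<in> components (del_verts H S)" "\<exists>r\<in>\<omega>. ray C r"
proof -
  obtain r where r: "r \<in> \<omega>" using vertex_end_nonempty[OF assms(1)] by blast
  obtain C where C: "C \<in> components (del_verts H S)" "tail_in C r"
    using ray_tail_avoiding_vertices[OF vertex_end_ray[OF assms(1) r] assms(2)] by blast
  then obtain i where "ray C (\<lambda>k. r (k + i))" by (auto simp: tail_in_def)
  then show ?thesis using that C(1) vertex_end_tail[OF assms(1) r] by blast
qed

text \<open>Membership of an end in a basic open set may be witnessed by any ray of the end; this makes the
  choice of the ray irrelevant.\<close>

lemma vertex_end_component_unique:
  assumes "\<omega> \<in> vertex_ends H" "finite S" "S \<subseteq> verts H"
    and C: "C \<in> components (del_verts H S)" "C' \<in> components (del_verts H S)"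
    and "r \<in> \<omega>" "tail_in C r" "r' \<in> \<omega>" "tail_in C' r'"
  shows "C = C'"
proof -
  have "vertex_equivalent H r r'" using vertex_ends_eq_iff[OF assms(1,1,6,8)] by simp
  then obtain C'' where "C'' \<in> components (del_verts H S)" "tail_in C'' r" "tail_in C'' r'"
    using assms(2,3) by (auto simp: vertex_equivalent_def)
  then show ?thesis using component_unique_tail C assms(7,9) by metis
qed


subsection \<open>Rays through nested connected sets\<close>

text \<open>The vertices of \<open>K 0\<close> are ranked by the last set \<open>K (l x)\<close> that contains them and, within one
  rank, by their distance \<open>d x\<close> to the next set, measured inside \<open>K (l x)\<close>. The first step of a
  shortest path to the next set either raises the rank or keeps it and decreases the distance. A
  sequence of such steps never repeats a vertex and its rank grows without bound.\<close>

lemma ray_through_nested_sets: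
  fixes K :: "nat \<Rightarrow> 'v set"
  assumes dec: "\<And>n. K (Suc n) \<subseteq> K n" and ne: "\<And>n. K n \<noteq> {}" and inter: "(\<Inter>n. K n) = {}"
    and sub: "K 0 \<subseteq> verts H"
    and conn: "\<And>n x y. x \<in> K n \<Longrightarrow> y \<in> K n \<Longrightarrow> (x, y) \<in> {(x, y). x \<in> K n \<and> y \<in> K n \<and> {x, y} \<in> edges H}\<^sup>*"
  shows "\<exists>r. ray H r \<and> (\<forall>n. \<exists>i. \<forall>j\<ge>i. r j \<in> K n)"
proof -
  define R where "R n = {(x, y). x \<in> K n \<and> y \<in> K n \<and> {x, y} \<in> edges H}" for n
  define l where "l x = (LEAST m. x \<notin> K (Suc m))" for x
  define d where "d x = (LEAST k. \<exists>y\<in>K (Suc (l x)). (x, y) \<in> R (l x) ^^ k)" for x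
  have antimono: "K n \<subseteq> K m" if "m \<le> n" for m n using dec lift_Suc_antimono_le that by blast
  have l: "x \<in> K (l x) \<and> x \<notin> K (Suc (l x))" if x: "x \<in> K 0" for x
  proof -
    obtain m where "x \<notin> K m" using inter by blast
    then have "x \<notin> K (Suc m)" using dec by blast
    then have "x \<notin> K (Suc (l x))" unfolding l_def by (rule LeastI)
    moreover have "x \<in> K (l x)"
    proof (cases "l x")
      case (Suc m)
      then have "m < l x" by simp
      then have "x \<in> K (Suc m)" using not_less_Least[of m "\<lambda>m. x \<notin> K (Suc m)"] unfolding l_def by blast
      then show ?thesis using Suc by simp
    qed (use x in simp)
    ultimately show ?thesis by simp
  qed
  define adv where "adv x z \<longleftrightarrow> l x < l z \<or> l x = l z \<and> d z < d x" for x z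
  have adv_trans: "adv x y \<Longrightarrow> adv y z \<Longrightarrow> adv x z" for x y z by (auto simp: adv_def)
  have step: "\<exists>z. z \<in> K 0 \<and> {x, z} \<in> edges H \<and> adv x z" if x: "x \<in> K 0" for x
  proof -
    obtain y where y: "y \<in> K (Suc (l x))" using ne by blast
    then have "y \<in> K (l x)" using dec by blast
    then have "(x, y) \<in> (R (l x))\<^sup>*" using conn[of x "l x" y] l[OF x] by (simp add: R_def)
    then have "\<exists>k. \<exists>y\<in>K (Suc (l x)). (x, y) \<in> R (l x) ^^ k" using y rtrancl_imp_relpow by blast
    then have "\<exists>y\<in>K (Suc (l x)). (x, y) \<in> R (l x) ^^ d x" unfolding d_def by (rule LeastI_ex)
    then obtain y where y: "y \<in> K (Suc (l x))" "(x, y) \<in> R (l x) ^^ d x" by blast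
    then obtain k where k: "d x = Suc k" using l[OF x] by (cases "d x") auto
    then obtain z where z: "(x, z) \<in> R (l x)" "(z, y) \<in> R (l x) ^^ k" using y(2) relpow_Suc_D2 by metis
    then have zK: "z \<in> K (l x)" "{x, z} \<in> edges H" by (auto simp: R_def)
    then have z0: "z \<in> K 0" using antimono[of 0 "l x"] by blast
    have "l x \<le> l z"
    proof (rule ccontr)
      assume "\<not> l x \<le> l z"
      then have "z \<in> K (Suc (l z))" using antimono[of "Suc (l z)" "l x"] zK by auto
      then show False using l[OF z0] by blast
    qed
    moreover have "d z \<le> k" if "l z = l x"
      unfolding d_def by (rule Least_le) (use y(1) z(2) that in auto)
    ultimately have "adv x z" using k by (fastforce simp: adv_def)
    then show ?thesis using z0 zK by blast
  qed
  obtain x0 where x0: "x0 \<in> K 0" using ne by blast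
  have "\<exists>r. \<forall>n. r n \<in> K 0 \<and> ({r n, r (Suc n)} \<in> edges H \<and> adv (r n) (r (Suc n)))"
    by (rule dependent_nat_choice) (use x0 step in auto)
  then obtain r where r: "\<And>n. r n \<in> K 0" "\<And>n. {r n, r (Suc n)} \<in> edges H" "\<And>n. adv (r n) (r (Suc n))"
    by blast
  have adv: "adv (r i) (r j)" if "i < j" for i j
    using that by (induction rule: strict_inc_induct[of i j, consumes 1]) (use r(3) adv_trans in blast)+
  have "inj r"
  proof (rule linorder_injI)
    fix i j :: nat assume "i < j"
    then show "r i \<noteq> r j" using adv[of i j] by (auto simp: adv_def)
  qed
  then have "ray H r" using r(1,2) sub by (auto simp: ray_def)
  moreover have up: "\<exists>j>i. l (r i) < l (r j)" for i
  proof (induction "d (r i)" arbitrary: i rule: less_induct)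
    case less
    show ?case
    proof (cases "l (r i) < l (r (Suc i))")
      case False
      then have eq: "l (r (Suc i)) = l (r i)" "d (r (Suc i)) < d (r i)" using r(3)[of i] by (auto simp: adv_def)
      then obtain j where "j > Suc i" "l (r (Suc i)) < l (r j)" using less by blast
      then show ?thesis using eq by (intro exI[of _ j]) simp
    qed auto
  qed
  have "\<exists>i. n \<le> l (r i)" for n
  proof (induction n)
    case (Suc n)
    then obtain i where "n \<le> l (r i)" by blast
    moreover obtain j where "l (r i) < l (r j)" using up by blast
    ultimately show ?case by (intro exI[of _ j]) simp
  qed simp
  then have "\<exists>i. \<forall>j\<ge>i. r j \<in> K n" for n
  proof -
    obtain i where i: "n \<le> l (r i)" using \<open>\<And>n. \<exists>i. n \<le> l (r i)\<close> by blast
    have "r j \<in> K n" if "i \<le> j" for j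
    proof -
      have "l (r i) \<le> l (r j)" using adv[of i j] that by (cases "i = j") (auto simp: adv_def)
      then show ?thesis using antimono[of n "l (r j)"] l[OF r(1)[of j]] i by auto
    qed
    then show ?thesis by blast
  qed
  ultimately show ?thesis by blast
qed

section \<open>Points and open sets of MTOP\<close>

definition edge_pt :: "'v \<Rightarrow> 'v \<Rightarrow> real \<Rightarrow> 'v \<Rightarrow> real" where
  "edge_pt x y \<tau> = (\<lambda>u. if u = x then 1 - \<tau> else if u = y then \<tau> else 0)"

lemma edge_pt_0: "edge_pt x y 0 = vertex_pt x"
  by (auto simp: edge_pt_def vertex_pt_def)

lemma edge_pt_1: "x \<noteq> y \<Longrightarrow> edge_pt x y 1 = vertex_pt y"
  by (auto simp: edge_pt_def vertex_pt_def)

lemma edge_pt_inner: "x \<noteq> y \<Longrightarrow> 0 < \<tau> \<Longrightarrow> \<tau> < 1 \<Longrightarrow> edge_pt x y \<tau> \<in> inner_pts {x, y}"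
  by (auto simp: edge_pt_def inner_pts_def)

lemma support_inner: "p \<in> inner_pts e \<Longrightarrow> {v. p v \<noteq> 0} = e"
  by (force simp: inner_pts_def)

lemma support_vertex: "{u. vertex_pt v u \<noteq> 0} = {v}"
  by (auto simp: vertex_pt_def)

lemma inner_unique: "p \<in> inner_pts e \<Longrightarrow> p \<in> inner_pts f \<Longrightarrow> e = f"
  using support_inner by metis

lemma vertex_pt_inj: "vertex_pt v = vertex_pt w \<Longrightarrow> v = w"
  using support_vertex by (metis singleton_inject)

lemma inner_sum: "p \<in> inner_pts {x, y} \<Longrightarrow> x \<noteq> y \<Longrightarrow> p x + p y = 1"
  by (simp add: inner_pts_def)

lemma inner_pos: "p \<in> inner_pts e \<Longrightarrow> x \<in> e \<Longrightarrow> 0 < p x"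
  by (simp add: inner_pts_def)

lemma edgeE:
  assumes "simple_graph H" "e \<in> edges H"
  obtains x y where "x \<in> verts H" "y \<in> verts H" "x \<noteq> y" "e = {x, y}"
proof -
  have "\<exists>x\<in>verts H. \<exists>y\<in>verts H. x \<noteq> y \<and> e = {x, y}"
    using assms unfolding simple_graph_def by (rule bspec)
  then show ?thesis using that by (elim bexE conjE)
qed

lemma edge_otherE:
  assumes "simple_graph H" "e \<in> edges H" "x \<in> e"
  obtains y where "x \<in> verts H" "y \<in> verts H" "x \<noteq> y" "e = {x, y}"
proof -
  obtain a b where ab: "a \<in> verts H" "b \<in> verts H" "a \<noteq> b" "e = {a, b}" using edgeE[OF assms(1,2)] .
  then have "x = a \<or> x = b" using assms(3) by simp
  then show ?thesis using that[of a] that[of b] ab by (auto simp: insert_commute)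
qed

lemma inner_not_vertex:
  assumes "simple_graph H" "e \<in> edges H" "p \<in> inner_pts e"
  shows "p \<noteq> vertex_pt v"
proof
  assume "p = vertex_pt v"
  then have "e = {v}" using support_inner[OF assms(3)] support_vertex[of v] by simp
  moreover obtain x y where "x \<noteq> y" "e = {x, y}" using edgeE[OF assms(1,2)] .
  ultimately show False by simp
qed

lemma openin_MTOP_edge:
  assumes "e \<in> edges H" "x \<in> e" "open U"
  shows "openin (MTOP H) (Pt ` {p \<in> inner_pts e. p x \<in> U})"
  unfolding MTOP_def
proof (intro topology_generated_by_Basis UnI1 CollectI exI conjI)
  show "open_in_edge e {p \<in> inner_pts e. p x \<in> U}"
    unfolding open_in_edge_def using assms(2,3) by (intro bexI[of _ x] exI[of _ U]) simp_all
qed (use assms(1) in simp_all)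

lemma openin_MTOP_star:
  assumes "v \<in> verts H" "0 < \<epsilon>" "\<epsilon> < 1"
  shows "openin (MTOP H) (Pt ` open_star H v \<epsilon>)"
  unfolding MTOP_def
  by (rule topology_generated_by_Basis) (use assms in auto)

definition end_nbhd :: "'v graph \<Rightarrow> 'v set \<Rightarrow> 'v graph \<Rightarrow> real \<Rightarrow> 'v space_pt set" where
  "end_nbhd H S C \<epsilon> = Pt ` complex_pts C \<union> End ` {\<omega>' \<in> vertex_ends H. \<exists>r\<in>\<omega>'. ray C r}
      \<union> Pt ` edge_nbhd H S C \<epsilon>"

lemma openin_MTOP_end:
  assumes "finite S" "S \<subseteq> verts H" "\<omega> \<in> vertex_ends H" "C \<in> components (del_verts H S)"
    "\<exists>r\<in>\<omega>. ray C r" "0 < \<epsilon>"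
  shows "openin (MTOP H) (end_nbhd H S C \<epsilon>)"
  unfolding MTOP_def
proof (rule topology_generated_by_Basis)
  show "end_nbhd H S C \<epsilon> \<in> {Pt ` W | e W. e \<in> edges H \<and> open_in_edge e W}
      \<union> {Pt ` open_star H v \<epsilon> | v \<epsilon>. v \<in> verts H \<and> 0 < \<epsilon> \<and> \<epsilon> < 1} \<union> MTOP_end_nbhds H"
    unfolding MTOP_end_nbhds_def end_nbhd_def using assms by (intro UnI2) blast
qed

lemma MTOP_subbasis_cases:
  assumes "U \<in> {Pt ` W | e W. e \<in> edges H \<and> open_in_edge e W}
      \<union> {Pt ` open_star H v \<epsilon> | v \<epsilon>. v \<in> verts H \<and> 0 < \<epsilon> \<and> \<epsilon> < 1} \<union> MTOP_end_nbhds H"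
  obtains (edge) e x V where "e \<in> edges H" "x \<in> e" "open V" "U = Pt ` {p \<in> inner_pts e. p x \<in> V}"
  | (star) v \<epsilon> where "v \<in> verts H" "0 < \<epsilon>" "\<epsilon> < 1" "U = Pt ` open_star H v \<epsilon>"
  | (nbhd) S C \<epsilon> where "finite S" "S \<subseteq> verts H" "C \<in> components (del_verts H S)" "0 < \<epsilon>"
      "U = end_nbhd H S C \<epsilon>"
proof -
  consider "\<exists>e W. U = Pt ` W \<and> e \<in> edges H \<and> open_in_edge e W"
    | "\<exists>v \<epsilon>. U = Pt ` open_star H v \<epsilon> \<and> v \<in> verts H \<and> 0 < \<epsilon> \<and> \<epsilon> < 1"
    | "\<exists>S C \<omega> \<epsilon>. U = end_nbhd H S C \<epsilon> \<and> finite S \<and> S \<subseteq> verts H \<and> \<omega> \<in> vertex_ends H \<and>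
         C \<in> components (del_verts H S) \<and> (\<exists>r\<in>\<omega>. ray C r) \<and> 0 < \<epsilon>"
    using assms unfolding MTOP_end_nbhds_def end_nbhd_def Un_iff mem_Collect_eq by (elim disjE)
  then show thesis
  proof cases
    case 1
    then show ?thesis using edge unfolding open_in_edge_def by (elim exE conjE bexE) simp
  next
    case 2
    then show ?thesis using star by (elim exE conjE)
  next
    case 3
    then show ?thesis using nbhd by (elim exE conjE)
  qed
qed

lemma complex_pts_subgraph:
  assumes "verts C \<subseteq> verts H" "edges C \<subseteq> edges H"
  shows "complex_pts C \<subseteq> complex_pts H"
  using assms unfolding complex_pts_def by blast

lemma edges_component_del_verts:
  assumes "C \<in> components (del_verts H S)"
  shows "edges C = {e \<in> edges H. e \<subseteq> verts C}" "verts C \<subseteq> verts H" "verts C \<inter> S = {}"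
proof -
  show v: "verts C \<subseteq> verts H" "verts C \<inter> S = {}"
    using component_verts[OF assms] by (auto simp: del_verts_def)
  show "edges C = {e \<in> edges H. e \<subseteq> verts C}"
    unfolding component_edges[OF assms] using v(2) by (auto simp: del_verts_def)
qed

lemma MTOP_pt_cases:
  assumes "simple_graph H" "a \<in> topspace (MTOP H)"
  obtains (inner) e p where "e \<in> edges H" "p \<in> inner_pts e" "a = Pt p"
  | (vertex) v where "v \<in> verts H" "a = Pt (vertex_pt v)"
  | (endpt) \<omega> where "\<omega> \<in> vertex_ends H" "a = End \<omega>"
proof -
  have cases: thesis if "p \<in> complex_pts H" "a = Pt p" for p
    using that inner vertex unfolding complex_pts_def by blast
  obtain U where "U \<in> {Pt ` W | e W. e \<in> edges H \<and> open_in_edge e W}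
      \<union> {Pt ` open_star H v \<epsilon> | v \<epsilon>. v \<in> verts H \<and> 0 < \<epsilon> \<and> \<epsilon> < 1} \<union> MTOP_end_nbhds H" and a: "a \<in> U"
    using assms(2) unfolding MTOP_def topology_generated_by_topspace by (elim UnionE)
  then show thesis
  proof (cases rule: MTOP_subbasis_cases)
    case (edge e x V)
    then show ?thesis using inner a by auto
  next
    case (star v \<epsilon>)
    then show ?thesis using a cases unfolding open_star_def complex_pts_def by blast
  next
    case (nbhd S C \<epsilon>)
    from a consider "a \<in> Pt ` complex_pts C" | \<omega> where "a = End \<omega>" "\<omega> \<in> vertex_ends H"
      | "a \<in> Pt ` edge_nbhd H S C \<epsilon>" unfolding nbhd(5) end_nbhd_def by blast
    then show ?thesis
    proof cases
      case 1
      then show ?thesis using cases edges_component_del_verts[OF nbhd(3)] complex_pts_subgraph[of C H] by blast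
    next
      case 2
      then show ?thesis using endpt by blast
    next
      case 3
      then show ?thesis using inner unfolding edge_nbhd_def by blast
    qed
  qed
qed

text \<open>The Hausdorff property for a single pair of points; the kinds of points of MTOP are treated
  separately.\<close>

definition separated :: "'a topology \<Rightarrow> 'a \<Rightarrow> 'a \<Rightarrow> bool" where
  "separated X a b \<longleftrightarrow> (\<exists>U V. openin X U \<and> openin X V \<and> a \<in> U \<and> b \<in> V \<and> disjnt U V)"

lemma separatedI: "openin X U \<Longrightarrow> openin X V \<Longrightarrow> a \<in> U \<Longrightarrow> b \<in> V \<Longrightarrow> disjnt U V \<Longrightarrow> separated X a b"
  unfolding separated_def by (intro exI conjI)

lemma separated_sym: "separated X a b \<Longrightarrow> separated X b a"
  unfolding separated_def using disjnt_sym by metis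

lemma Pt_disjnt: "(\<And>p. p \<in> A \<Longrightarrow> p \<in> B \<Longrightarrow> False) \<Longrightarrow> disjnt (Pt ` A) (Pt ` B)"
  by (auto simp: disjnt_iff)

lemma Pt_image_iff [simp]: "Pt p \<in> Pt ` A \<longleftrightarrow> p \<in> A" "End \<omega> \<notin> Pt ` A" "Pt p \<notin> End ` B"
  "End \<omega> \<in> End ` B \<longleftrightarrow> \<omega> \<in> B"
  by auto

lemma openin_MTOP_inner:
  assumes "simple_graph H" "e \<in> edges H"
  shows "openin (MTOP H) (Pt ` inner_pts e)"
proof -
  obtain x y where "e = {x, y}" using edgeE[OF assms] .
  then have "x \<in> e" by simp
  from openin_MTOP_edge[OF assms(2) this open_UNIV] show ?thesis by simp
qed

lemma star_inner: "p \<in> open_star H v \<epsilon> \<Longrightarrow> p = vertex_pt v \<or> (\<exists>e\<in>edges H. v \<in> e \<and> p \<in> inner_pts e \<and> 1 - p v < \<epsilon>)"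
  by (auto simp: open_star_def)

lemma vertex_in_star: "vertex_pt v \<in> open_star H v \<epsilon>"
  by (simp add: open_star_def)

lemma separated_inner_inner:
  assumes H: "simple_graph H" and "e \<in> edges H" "p \<in> inner_pts e" "f \<in> edges H" "q \<in> inner_pts f" "p \<noteq> q"
  shows "separated (MTOP H) (Pt p) (Pt q)"
proof (cases "e = f")
  case False
  have "disjnt (Pt ` inner_pts e) (Pt ` inner_pts f)"
  proof (rule Pt_disjnt)
    fix q assume "q \<in> inner_pts e" "q \<in> inner_pts f"
    then show False using inner_unique[of q e f] False by simp
  qed
  from separatedI[OF openin_MTOP_inner[OF H assms(2)] openin_MTOP_inner[OF H assms(4)] _ _ this]
  show ?thesis using assms(3,5) by simp
next
  case True
  obtain x where x: "p x \<noteq> q x" using assms(6) by blast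
  have "x \<in> e"
  proof (rule ccontr)
    assume "x \<notin> e"
    then have "p x = 0" "q x = 0" using assms(3,5) True by (simp_all add: inner_pts_def)
    then show False using x by simp
  qed
  obtain U V where UV: "open U" "open V" "p x \<in> U" "q x \<in> V" "U \<inter> V = {}" using hausdorff[OF x] by blast
  have "disjnt (Pt ` {p \<in> inner_pts e. p x \<in> U}) (Pt ` {p \<in> inner_pts e. p x \<in> V})"
    using UV(5) by (intro Pt_disjnt) auto
  from separatedI[OF openin_MTOP_edge[OF assms(2) \<open>x \<in> e\<close> UV(1)] openin_MTOP_edge[OF assms(2) \<open>x \<in> e\<close> UV(2)] _ _ this]
  show ?thesis using assms(3,5) True UV(3,4) by simp
qed

lemma separated_inner_vertex:
  assumes H: "simple_graph H" and "e \<in> edges H" "p \<in> inner_pts e" "v \<in> verts H"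
  shows "separated (MTOP H) (Pt p) (Pt (vertex_pt v))"
proof (cases "v \<in> e")
  case False
  have st: "openin (MTOP H) (Pt ` open_star H v (1/2))" using openin_MTOP_star[OF assms(4)] by simp
  have "disjnt (Pt ` inner_pts e) (Pt ` open_star H v (1/2))"
  proof (rule Pt_disjnt)
    fix q assume q: "q \<in> inner_pts e" "q \<in> open_star H v (1/2)"
    have "q \<noteq> vertex_pt v" by (rule inner_not_vertex[OF H assms(2) q(1)])
    then obtain f where "v \<in> f" "q \<in> inner_pts f" using star_inner[OF q(2)] by blast
    then show False using inner_unique[OF q(1)] False by blast
  qed
  from separatedI[OF openin_MTOP_inner[OF H assms(2)] st _ _ this] show ?thesis
    using assms(3) vertex_in_star[of v H "1/2"] by simp
next
  case True
  obtain w where w: "v \<noteq> w" "e = {v, w}" using edge_otherE[OF H assms(2) True] .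
  have "p v + p w = 1" "0 < p v" "0 < p w" using inner_sum[of p v w] inner_pos[OF assms(3)] assms(3) w by simp_all
  then have pv: "0 < p v" "p v < 1" by simp_all
  \<comment> \<open>On \<open>e\<close> the coordinate at \<open>v\<close> is 1 at \<open>v\<close>, so \<open>c\<close> lies half way between \<open>p\<close> and \<open>v\<close>.\<close>
  define c where "c = (1 + p v) / 2"
  have c: "p v < c" "0 < 1 - c" "1 - c < 1" using pv by (simp_all add: c_def)
  have "disjnt (Pt ` {q \<in> inner_pts e. q v \<in> {..<c}}) (Pt ` open_star H v (1 - c))"
  proof (rule Pt_disjnt)
    fix q assume q: "q \<in> {q \<in> inner_pts e. q v \<in> {..<c}}" "q \<in> open_star H v (1 - c)"
    have "q \<noteq> vertex_pt v" by (rule inner_not_vertex[OF H assms(2)]) (use q(1) in simp)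
    then have "1 - q v < 1 - c" using star_inner[OF q(2)] by blast
    then show False using q(1) by simp
  qed
  from separatedI[OF openin_MTOP_edge[OF assms(2) True open_lessThan] openin_MTOP_star[OF assms(4) c(2,3)] _ _ this]
  show ?thesis using assms(3) vertex_in_star[of v H "1 - c"] c(1) by simp
qed

lemma separated_vertex_vertex:
  assumes H: "simple_graph H" and "v \<in> verts H" "w \<in> verts H" "v \<noteq> w"
  shows "separated (MTOP H) (Pt (vertex_pt v)) (Pt (vertex_pt w))"
proof -
  have st: "openin (MTOP H) (Pt ` open_star H u (1/2))" if "u \<in> verts H" for u
    using openin_MTOP_star[OF that] by simp
  have "disjnt (Pt ` open_star H v (1/2)) (Pt ` open_star H w (1/2))"
  proof (rule Pt_disjnt)
    fix q assume q: "q \<in> open_star H v (1/2)" "q \<in> open_star H w (1/2)"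
    from star_inner[OF q(1)] show False
    proof
      assume "q = vertex_pt v"
      moreover have "vertex_pt v \<noteq> vertex_pt w" using vertex_pt_inj assms(4) by metis
      ultimately show False using star_inner[OF q(2)] inner_not_vertex[OF H] by metis
    next
      assume "\<exists>e\<in>edges H. v \<in> e \<and> q \<in> inner_pts e \<and> 1 - q v < 1 / 2"
      then obtain e where e: "e \<in> edges H" "v \<in> e" "q \<in> inner_pts e" "1 - q v < 1 / 2" by blast
      then have "q \<noteq> vertex_pt w" using inner_not_vertex[OF H] by metis
      then obtain f where f: "w \<in> f" "q \<in> inner_pts f" "1 - q w < 1/2" using star_inner[OF q(2)] by blast
      then have "w \<in> e" using inner_unique[OF e(3)] by blast
      obtain u where u: "v \<noteq> u" "e = {v, u}" using edge_otherE[OF H e(1,2)] .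
      then have "e = {v, w}" using \<open>w \<in> e\<close> assms(4) by auto
      then have "q v + q w = 1" using inner_sum e(3) assms(4) by metis
      then show False using e(4) f(3) by simp
    qed
  qed
  from separatedI[OF st[OF assms(2)] st[OF assms(3)] _ _ this] show ?thesis
    using vertex_in_star[of v H "1/2"] vertex_in_star[of w H "1/2"] by simp
qed

lemma inner_in_end_nbhd:
  assumes H: "simple_graph H" and C: "C \<in> components (del_verts H S)" and f: "f \<in> edges H" "q \<in> inner_pts f"
    and q: "Pt q \<in> end_nbhd H S C \<epsilon>"
  shows "f \<subseteq> verts C \<or> (\<exists>x\<in>S. \<exists>y\<in>verts C. f = {x, y} \<and> 1 - q y < \<epsilon>)"
proof -
  from q consider "q \<in> complex_pts C" | "q \<in> edge_nbhd H S C \<epsilon>" unfolding end_nbhd_def by blast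
  then show ?thesis
  proof cases
    case 1
    have "q \<noteq> vertex_pt v" for v by (rule inner_not_vertex[OF H f])
    then obtain e where "e \<in> edges C" "q \<in> inner_pts e" using 1 unfolding complex_pts_def by blast
    then have "f \<in> edges C" using inner_unique[OF f(2)] by metis
    then show ?thesis using edges_component_del_verts(1)[OF C] by simp
  next
    case 2
    then obtain x y where "x \<in> S" "y \<in> verts C" "q \<in> inner_pts {x, y}" "1 - q y < \<epsilon>"
      unfolding edge_nbhd_def by blast
    then show ?thesis using inner_unique[OF f(2)] by blast
  qed
qed

lemma vertex_in_end_nbhd:
  assumes H: "simple_graph H" and C: "C \<in> components (del_verts H S)"
  shows "Pt (vertex_pt v) \<in> end_nbhd H S C \<epsilon> \<longleftrightarrow> v \<in> verts C"
proof
  assume "Pt (vertex_pt v) \<in> end_nbhd H S C \<epsilon>"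
  then consider "vertex_pt v \<in> complex_pts C" | "vertex_pt v \<in> edge_nbhd H S C \<epsilon>" unfolding end_nbhd_def by blast
  then show "v \<in> verts C"
  proof cases
    case 1
    have "vertex_pt v \<notin> inner_pts e" if "e \<in> edges C" for e
      using inner_not_vertex[OF H, of e "vertex_pt v" v] that edges_component_del_verts(1)[OF C] by auto
    then have "vertex_pt v \<in> vertex_pt ` verts C" using 1 unfolding complex_pts_def by blast
    then show ?thesis by (auto dest: vertex_pt_inj)
  next
    case 2
    then obtain x y where "{x, y} \<in> edges H" "vertex_pt v \<in> inner_pts {x, y}" unfolding edge_nbhd_def by blast
    then show ?thesis using inner_not_vertex[OF H, of "{x, y}" "vertex_pt v" v] by simp
  qed
qed (simp add: end_nbhd_def complex_pts_def)

text \<open>Deleting both endvertices of an edge leaves no half-edge of it in any neighbourhood of an end.\<close>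

lemma separated_inner_end:
  assumes H: "simple_graph H" and "e \<in> edges H" "p \<in> inner_pts e" "\<omega> \<in> vertex_ends H"
  shows "separated (MTOP H) (Pt p) (End \<omega>)"
proof -
  obtain x y where xy: "x \<in> verts H" "y \<in> verts H" "e = {x, y}" using edgeE[OF H assms(2)] .
  then have e: "finite e" "e \<subseteq> verts H" by simp_all
  obtain C where C: "C \<in> components (del_verts H e)" "\<exists>r\<in>\<omega>. ray C r" using vertex_end_component[OF assms(4) e] .
  have "disjnt (Pt ` inner_pts e) (end_nbhd H e C 1)"
  proof (rule ccontr)
    assume "\<not> disjnt (Pt ` inner_pts e) (end_nbhd H e C 1)"
    then obtain q where q: "q \<in> inner_pts e" "Pt q \<in> end_nbhd H e C 1" unfolding disjnt_iff by blast
    have "e \<inter> verts C \<noteq> {}" using inner_in_end_nbhd[OF H C(1) assms(2) q] xy(3) by auto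
    then show False using edges_component_del_verts(3)[OF C(1)] by blast
  qed
  from separatedI[OF openin_MTOP_inner[OF H assms(2)] openin_MTOP_end[OF e assms(4) C zero_less_one] _ _ this]
  show ?thesis using assms(3,4) C(2) unfolding end_nbhd_def by blast
qed

text \<open>Deleting \<open>v\<close> leaves of the edges at \<open>v\<close> only halves that lie outside the star of radius one half.\<close>

lemma separated_vertex_end:
  assumes H: "simple_graph H" and "v \<in> verts H" "\<omega> \<in> vertex_ends H"
  shows "separated (MTOP H) (Pt (vertex_pt v)) (End \<omega>)"
proof -
  have S: "finite {v}" "{v} \<subseteq> verts H" using assms(2) by simp_all
  obtain C where C: "C \<in> components (del_verts H {v})" "\<exists>r\<in>\<omega>. ray C r" using vertex_end_component[OF assms(3) S] .
  have vC: "v \<notin> verts C" using edges_component_del_verts(3)[OF C(1)] by simp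
  have "disjnt (Pt ` open_star H v (1/2)) (end_nbhd H {v} C (1/2))"
  proof (rule ccontr)
    assume "\<not> disjnt (Pt ` open_star H v (1/2)) (end_nbhd H {v} C (1/2))"
    then obtain q where q: "q \<in> open_star H v (1/2)" "Pt q \<in> end_nbhd H {v} C (1/2)" unfolding disjnt_iff by blast
    have "q \<noteq> vertex_pt v" using vertex_in_end_nbhd[OF H C(1)] vC q(2) by blast
    then obtain e where e: "e \<in> edges H" "v \<in> e" "q \<in> inner_pts e" "1 - q v < 1 / 2" using star_inner[OF q(1)] by blast
    have "\<not> e \<subseteq> verts C" using e(2) vC by blast
    then obtain y where y: "y \<in> verts C" "e = {v, y}" "1 - q y < 1/2"
      using inner_in_end_nbhd[OF H C(1) e(1,3) q(2)] by blast
    then have "q v + q y = 1" using inner_sum[of q v y] e(3) vC by auto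
    then show False using e(4) y(3) by simp
  qed
  from separatedI[OF openin_MTOP_star[OF assms(2)] openin_MTOP_end[OF S assms(3) C] _ _ this]
  show ?thesis using assms(3) C(2) vertex_in_star[of v H "1/2"] by (simp add: end_nbhd_def)
qed

text \<open>A finite vertex set \<open>S\<close> that tells the ends apart gives different components \<open>C\<close> and \<open>C'\<close>; an
  edge from \<open>S\<close> to \<open>C\<close> has no endvertex in \<open>C'\<close>, so any radius will do.\<close>

lemma separated_end_end:
  assumes H: "simple_graph H" and \<omega>: "\<omega> \<in> vertex_ends H" "\<omega>' \<in> vertex_ends H" "\<omega> \<noteq> \<omega>'"
  shows "separated (MTOP H) (End \<omega>) (End \<omega>')"
proof -
  obtain r where r: "r \<in> \<omega>" using vertex_end_nonempty[OF \<omega>(1)] by (elim exE)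
  obtain r' where r': "r' \<in> \<omega>'" using vertex_end_nonempty[OF \<omega>(2)] by (elim exE)
  have "\<not> vertex_equivalent H r r'" using vertex_ends_eq_iff[OF \<omega>(1,2) r r'] \<omega>(3) by simp
  then obtain S where S: "finite S" "S \<subseteq> verts H"
    and sep: "\<not> (\<exists>C\<in>components (del_verts H S). tail_in C r \<and> tail_in C r')"
    unfolding vertex_equivalent_def by blast
  obtain C where C: "C \<in> components (del_verts H S)" "\<exists>r\<in>\<omega>. ray C r" using vertex_end_component[OF \<omega>(1) S] .
  obtain C' where C': "C' \<in> components (del_verts H S)" "\<exists>r\<in>\<omega>'. ray C' r" using vertex_end_component[OF \<omega>(2) S] .
  obtain D where D: "D \<in> components (del_verts H S)" "tail_in D r"
    using ray_tail_avoiding_vertices[OF vertex_end_ray[OF \<omega>(1) r] S(1)] by blast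
  obtain D' where D': "D' \<in> components (del_verts H S)" "tail_in D' r'"
    using ray_tail_avoiding_vertices[OF vertex_end_ray[OF \<omega>(2) r'] S(1)] by blast
  have "C = D" "C' = D'"
    using vertex_end_component_unique[OF \<omega>(1) S C(1) D(1) _ _ r D(2)] C(2)
      vertex_end_component_unique[OF \<omega>(2) S C'(1) D'(1) _ _ r' D'(2)] C'(2) ray_tail_in by blast+
  then have ne: "C \<noteq> C'" using sep D D' by blast
  have vd: "verts C \<inter> verts C' = {}" using component_eqI[OF C(1) C'(1)] ne by blast
  have SC: "verts C \<inter> S = {}" "verts C' \<inter> S = {}"
    using edges_component_del_verts(3)[OF C(1)] edges_component_del_verts(3)[OF C'(1)] by simp_all
  have "disjnt (end_nbhd H S C 1) (end_nbhd H S C' 1)"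
  proof (rule ccontr)
    assume "\<not> disjnt (end_nbhd H S C 1) (end_nbhd H S C' 1)"
    then obtain a where a: "a \<in> end_nbhd H S C 1" "a \<in> end_nbhd H S C' 1" unfolding disjnt_iff by blast
    have "a \<in> topspace (MTOP H)"
      using openin_subset[OF openin_MTOP_end[OF S \<omega>(1) C zero_less_one]] a(1) by blast
    from H this show False
    proof (cases rule: MTOP_pt_cases)
      case (inner f q)
      note i = inner_in_end_nbhd[OF H C(1) inner(1,2) a(1)[unfolded inner(3)]]
        inner_in_end_nbhd[OF H C'(1) inner(1,2) a(2)[unfolded inner(3)]]
      obtain x y where xy: "f = {x, y}" using edgeE[OF H inner(1)] .
      show False using i vd SC unfolding xy by (auto simp: doubleton_eq_iff)
    next
      case (vertex v)
      then show False
        using vertex_in_end_nbhd[OF H C(1), of v 1] vertex_in_end_nbhd[OF H C'(1), of v 1] a vd by auto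
    next
      case (endpt \<eta>)
      obtain s where s: "s \<in> \<eta>" "ray C s" using a(1) unfolding endpt(2) end_nbhd_def by blast
      obtain s' where s': "s' \<in> \<eta>" "ray C' s'" using a(2) unfolding endpt(2) end_nbhd_def by blast
      show False
        using vertex_end_component_unique[OF endpt(1) S C(1) C'(1) s(1) ray_tail_in[OF s(2)] s'(1) ray_tail_in[OF s'(2)]] ne
        by simp
    qed
  qed
  from separatedI[OF openin_MTOP_end[OF S \<omega>(1) C zero_less_one] openin_MTOP_end[OF S \<omega>(2) C' zero_less_one] _ _ this]
  show ?thesis using \<omega> C(2) C'(2) unfolding end_nbhd_def by blast
qed

theorem Hausdorff_MTOP:
  assumes H: "simple_graph H"
  shows "Hausdorff_space (MTOP H)"
proof -
  have "separated (MTOP H) a b"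
    if ab: "a \<in> topspace (MTOP H)" "b \<in> topspace (MTOP H)" "a \<noteq> b" for a b
    using H ab(1)
  proof (cases rule: MTOP_pt_cases)
    case a: (inner e p)
    show ?thesis using H ab(2)
    proof (cases rule: MTOP_pt_cases)
      case (inner f q)
      then show ?thesis using separated_inner_inner[OF H a(1,2) inner(1,2)] a(3) ab(3) by auto
    next
      case (vertex v)
      then show ?thesis using separated_inner_vertex[OF H a(1,2)] a(3) by auto
    next
      case (endpt \<omega>)
      then show ?thesis using separated_inner_end[OF H a(1,2)] a(3) by auto
    qed
  next
    case a: (vertex v)
    show ?thesis using H ab(2)
    proof (cases rule: MTOP_pt_cases)
      case (inner f q)
      then show ?thesis using separated_sym[OF separated_inner_vertex[OF H inner(1,2) a(1)]] a by auto
    next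
      case (vertex w)
      then show ?thesis using separated_vertex_vertex[OF H a(1)] a ab(3) by auto
    next
      case (endpt \<omega>)
      then show ?thesis using separated_vertex_end[OF H a(1)] a by auto
    qed
  next
    case a: (endpt \<omega>)
    show ?thesis using H ab(2)
    proof (cases rule: MTOP_pt_cases)
      case (inner f q)
      then show ?thesis using separated_sym[OF separated_inner_end[OF H inner(1,2) a(1)]] a by auto
    next
      case (vertex w)
      then show ?thesis using separated_sym[OF separated_vertex_end[OF H vertex(1) a(1)]] a by auto
    next
      case (endpt \<eta>)
      then show ?thesis using separated_end_end[OF H a(1) endpt(1)] a ab(3) by auto
    qed
  qed
  then show ?thesis unfolding Hausdorff_space_def separated_def by blast
qed

text \<open>An edge that leaves \<open>C\<close> ends in \<open>S\<close>, and a neighbourhood of an end contains the part of it close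
  to \<open>C\<close>.\<close>

lemma edge_path_in_end_nbhd:
  assumes H: "simple_graph H" and xy: "{x, y} \<in> edges H" and S: "S \<subseteq> verts H"
    and C: "C \<in> components (del_verts H S)" and \<tau>: "0 < \<tau>" "\<tau> < 1" and \<epsilon>: "0 < \<epsilon>"
  shows "Pt (edge_pt x y \<tau>) \<in> end_nbhd H S C \<epsilon> \<longleftrightarrow>
    x \<in> verts C \<and> y \<in> verts C \<or> x \<in> verts C \<and> y \<notin> verts C \<and> \<tau> < \<epsilon> \<or>
    y \<in> verts C \<and> x \<notin> verts C \<and> 1 - \<tau> < \<epsilon>"
proof -
  obtain y' where "x \<in> verts H" "y' \<in> verts H" "x \<noteq> y'" "{x, y} = {x, y'}" using edge_otherE[OF H xy, of x] by auto
  then have ne: "x \<noteq> y" and V: "x \<in> verts H" "y \<in> verts H" by auto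
  let ?p = "edge_pt x y \<tau>"
  have p: "?p \<in> inner_pts {x, y}" "?p x = 1 - \<tau>" "?p y = \<tau>"
    using edge_pt_inner[OF ne \<tau>] ne by (auto simp: edge_pt_def)
  have dj: "verts C \<inter> S = {}" using edges_component_del_verts(3)[OF C] .
  have leave: "b \<in> S" if "{a, b} \<in> edges H" "a \<in> verts C" "b \<notin> verts C" "b \<in> verts H" for a b
  proof (rule ccontr)
    assume "b \<notin> S"
    then have "{a, b} \<in> edges (del_verts H S)" "b \<in> verts (del_verts H S)"
      using that dj by (auto simp: del_verts_def)
    from component_closed[OF C that(2) this] that(3) show False by simp
  qed
  show ?thesis
  proof
    assume "Pt ?p \<in> end_nbhd H S C \<epsilon>"
    from inner_in_end_nbhd[OF H C xy p(1) this] p(2,3) dj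
    show "x \<in> verts C \<and> y \<in> verts C \<or> x \<in> verts C \<and> y \<notin> verts C \<and> \<tau> < \<epsilon> \<or>
      y \<in> verts C \<and> x \<notin> verts C \<and> 1 - \<tau> < \<epsilon>"
      by (auto simp: doubleton_eq_iff)
  next
    assume "x \<in> verts C \<and> y \<in> verts C \<or> x \<in> verts C \<and> y \<notin> verts C \<and> \<tau> < \<epsilon> \<or>
      y \<in> verts C \<and> x \<notin> verts C \<and> 1 - \<tau> < \<epsilon>"
    then consider "x \<in> verts C" "y \<in> verts C" | "x \<in> verts C" "y \<notin> verts C" "\<tau> < \<epsilon>"
      | "y \<in> verts C" "x \<notin> verts C" "1 - \<tau> < \<epsilon>" by blast
    then show "Pt ?p \<in> end_nbhd H S C \<epsilon>"
    proof cases
      case 1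
      then have "{x, y} \<in> edges C" using edges_component_del_verts(1)[OF C] xy by simp
      then have "?p \<in> complex_pts C" using p(1) unfolding complex_pts_def by blast
      then show ?thesis by (simp add: end_nbhd_def)
    next
      case 2
      have "y \<in> S" using leave[OF xy 2(1,2) V(2)] .
      then have "?p \<in> edge_nbhd H S C \<epsilon>" unfolding edge_nbhd_def
        using xy p 2 by (intro CollectI bexI[of _ y] bexI[of _ x]) (simp_all add: insert_commute)
      then show ?thesis by (simp add: end_nbhd_def)
    next
      case 3
      have "{y, x} \<in> edges H" using xy by (simp add: insert_commute)
      from leave[OF this 3(1,2) V(1)] have "x \<in> S" .
      then have "?p \<in> edge_nbhd H S C \<epsilon>" unfolding edge_nbhd_def
        using xy p 3 by (intro CollectI bexI[of _ x] bexI[of _ y]) simp_all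
      then show ?thesis by (simp add: end_nbhd_def)
    qed
  qed
qed

lemma unit_interval_cases:
  fixes \<tau> :: real
  assumes "\<tau> \<in> {0..1}"
  obtains "\<tau> = 0" | "\<tau> = 1" | "0 < \<tau>" "\<tau> < 1"
  using assms by fastforce

text \<open>Each subbasic open set meets the edge in a relatively open set: an open set of inner points, an
  initial or final part, the whole edge, or nothing.\<close>

lemma continuous_edge_path:
  assumes H: "simple_graph H" and xy: "{x, y} \<in> edges H"
  shows "continuous_map (top_of_set {0..1}) (MTOP H) (\<lambda>\<tau>. Pt (edge_pt x y \<tau>))"
  unfolding MTOP_def
proof (rule continuous_on_generated_topo)
  obtain y' where "x \<in> verts H" "y' \<in> verts H" "x \<noteq> y'" "{x, y} = {x, y'}" using edge_otherE[OF H xy, of x] by auto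
  then have ne: "x \<noteq> y" and V: "x \<in> verts H" "y \<in> verts H" by auto
  let ?p = "edge_pt x y"
  have p: "?p \<tau> x = 1 - \<tau>" "?p \<tau> y = \<tau>" for \<tau> using ne by (auto simp: edge_pt_def)
  have inn: "?p \<tau> \<in> inner_pts {x, y}" if "0 < \<tau>" "\<tau> < 1" for \<tau> using edge_pt_inner[OF ne that] .
  have inn_iff: "?p \<tau> \<in> inner_pts e \<longleftrightarrow> e = {x, y} \<and> 0 < \<tau> \<and> \<tau> < 1" if "\<tau> \<in> {0..1}" "e \<in> edges H" for \<tau> e
    using that(1)
  proof (cases rule: unit_interval_cases)
    case 1
    then show ?thesis using inner_not_vertex[OF H that(2), of "?p \<tau>" x] by (auto simp: edge_pt_0)
  next
    case 2
    then show ?thesis using inner_not_vertex[OF H that(2), of "?p \<tau>" y] by (auto simp: edge_pt_1 ne)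
  next
    case 3
    then show ?thesis using inn inner_unique by blast
  qed
  have vert_iff: "?p \<tau> = vertex_pt v \<longleftrightarrow> v = x \<and> \<tau> = 0 \<or> v = y \<and> \<tau> = 1" if "\<tau> \<in> {0..1}" for \<tau> v
    using that
  proof (cases rule: unit_interval_cases)
    case 1
    then show ?thesis using vertex_pt_inj[of x v] by (auto simp: edge_pt_0)
  next
    case 2
    then show ?thesis using vertex_pt_inj[of y v] by (auto simp: edge_pt_1 ne)
  next
    case 3
    then show ?thesis using inner_not_vertex[OF H xy inn[OF 3]] by auto
  qed
  show "openin (top_of_set {0..1}) ((\<lambda>\<tau>. Pt (?p \<tau>)) -` U \<inter> topspace (top_of_set {0..1}))"
    if U: "U \<in> {Pt ` W | e W. e \<in> edges H \<and> open_in_edge e W}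
      \<union> {Pt ` open_star H v \<epsilon> | v \<epsilon>. v \<in> verts H \<and> 0 < \<epsilon> \<and> \<epsilon> < 1} \<union> MTOP_end_nbhds H" for U
  proof -
    have "\<exists>T. open T \<and> (\<forall>\<tau>\<in>{0..1}. Pt (?p \<tau>) \<in> U \<longleftrightarrow> \<tau> \<in> T)"
      using U
    proof (cases rule: MTOP_subbasis_cases)
      case (edge e z W)
      have mem: "Pt (?p \<tau>) \<in> U \<longleftrightarrow> e = {x, y} \<and> 0 < \<tau> \<and> \<tau> < 1 \<and> ?p \<tau> z \<in> W" if "\<tau> \<in> {0..1}" for \<tau>
        using inn_iff[OF that edge(1)] by (auto simp: edge(4))
      consider "e \<noteq> {x, y}" | "e = {x, y}" "z = x" | "e = {x, y}" "z = y" using edge(2) by blast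
      then show ?thesis
      proof cases
        case 1
        then show ?thesis using mem by (intro exI[of _ "{}"]) simp
      next
        case 2
        have "open ((\<lambda>\<tau>. 1 - \<tau>) -` W)" using edge(3) by (intro open_vimage continuous_intros)
        then show ?thesis using 2 mem p by (intro exI[of _ "{0<..<1} \<inter> (\<lambda>\<tau>. 1 - \<tau>) -` W"]) auto
      next
        case 3
        then show ?thesis using edge(3) mem p by (intro exI[of _ "{0<..<1} \<inter> W"]) auto
      qed
    next
      case (star v \<epsilon>)
      have mem: "Pt (?p \<tau>) \<in> U \<longleftrightarrow> v = x \<and> \<tau> = 0 \<or> v = y \<and> \<tau> = 1 \<or>
          v \<in> {x, y} \<and> 0 < \<tau> \<and> \<tau> < 1 \<and> 1 - ?p \<tau> v < \<epsilon>" if "\<tau> \<in> {0..1}" for \<tau>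
      proof -
        have "Pt (?p \<tau>) \<in> U \<longleftrightarrow> ?p \<tau> = vertex_pt v \<or>
            (\<exists>e\<in>edges H. v \<in> e \<and> ?p \<tau> \<in> inner_pts e \<and> 1 - ?p \<tau> v < \<epsilon>)"
          unfolding star(4) Pt_image_iff by (auto simp: open_star_def)
        also have "(\<exists>e\<in>edges H. v \<in> e \<and> ?p \<tau> \<in> inner_pts e \<and> 1 - ?p \<tau> v < \<epsilon>) \<longleftrightarrow>
            v \<in> {x, y} \<and> 0 < \<tau> \<and> \<tau> < 1 \<and> 1 - ?p \<tau> v < \<epsilon>"
          using inn_iff[OF that] xy by metis
        finally show ?thesis using vert_iff[OF that] by auto
      qed
      consider "v = x" | "v = y" | "v \<notin> {x, y}" by blast
      then show ?thesis
      proof cases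
        case 1
        then show ?thesis using mem p ne star(2,3) by (intro exI[of _ "{..<\<epsilon>}"]) auto
      next
        case 2
        then show ?thesis using mem p ne star(2,3) by (intro exI[of _ "{1 - \<epsilon><..}"]) auto
      next
        case 3
        then show ?thesis using mem by (intro exI[of _ "{}"]) auto
      qed
    next
      case (nbhd S C \<epsilon>)
      note mem = edge_path_in_end_nbhd[OF H xy nbhd(2,3) _ _ nbhd(4)]
      note mem0 = vertex_in_end_nbhd[OF H nbhd(3), of _ \<epsilon>]
      define T where "T = (if x \<in> verts C \<and> y \<in> verts C then UNIV
        else if x \<in> verts C then {..<min \<epsilon> 1} else if y \<in> verts C then {max 0 (1 - \<epsilon>)<..} else {})"
      have "Pt (?p \<tau>) \<in> U \<longleftrightarrow> \<tau> \<in> T" if "\<tau> \<in> {0..1}" for \<tau>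
        using that
      proof (cases rule: unit_interval_cases)
        case 1
        then show ?thesis using mem0[of x] nbhd(4) by (auto simp: edge_pt_0 nbhd(5) T_def)
      next
        case 2
        then show ?thesis using mem0[of y] nbhd(4) by (auto simp: edge_pt_1 ne nbhd(5) T_def)
      next
        case 3
        then show ?thesis using mem[OF 3] by (auto simp: nbhd(5) T_def)
      qed
      moreover have "open T" by (simp add: T_def)
      ultimately show ?thesis by blast
    qed
    then obtain T where T: "open T" "\<forall>\<tau>\<in>{0..1}. Pt (?p \<tau>) \<in> U \<longleftrightarrow> \<tau> \<in> T" by blast
    then have "(\<lambda>\<tau>. Pt (?p \<tau>)) -` U \<inter> topspace (top_of_set {0..1}) = {0..1} \<inter> T" by auto
    then show ?thesis using T(1) by (simp add: openin_open_Int)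
  qed
  show "(\<lambda>\<tau>. Pt (?p \<tau>)) ` topspace (top_of_set {0..1}) \<subseteq> \<Union> ({Pt ` W | e W. e \<in> edges H \<and> open_in_edge e W}
      \<union> {Pt ` open_star H v \<epsilon> | v \<epsilon>. v \<in> verts H \<and> 0 < \<epsilon> \<and> \<epsilon> < 1} \<union> MTOP_end_nbhds H)"
    unfolding topology_generated_by_topspace[symmetric] MTOP_def[symmetric]
  proof (rule image_subsetI)
    fix \<tau> :: real assume "\<tau> \<in> topspace (top_of_set {0..1})"
    then have "\<tau> \<in> {0..1}" by simp
    have star: "Pt (vertex_pt v) \<in> topspace (MTOP H)" if "v \<in> verts H" for v
      using openin_subset[OF openin_MTOP_star[OF that, of "1/2"]] vertex_in_star[of v H "1/2"] by auto
    have edge: "Pt q \<in> topspace (MTOP H)" if "q \<in> inner_pts {x, y}" for q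
      using openin_subset[OF openin_MTOP_inner[OF H xy]] that by auto
    show "Pt (?p \<tau>) \<in> topspace (MTOP H)"
      using \<open>\<tau> \<in> {0..1}\<close>
    proof (cases rule: unit_interval_cases)
      case 1
      then show ?thesis using star V by (simp add: edge_pt_0)
    next
      case 2
      then show ?thesis using star V by (simp add: edge_pt_1 ne)
    next
      case 3
      then show ?thesis using edge inn by simp
    qed
  qed
qed

section \<open>Closed curves\<close>

lemma cis_eq_imp:
  assumes "cis a = cis b" "0 \<le> a" "a < 2 * pi" "0 \<le> b" "b < 2 * pi"
  shows "a = b"
proof -
  have "sin a = sin b \<and> cos a = cos b" using assms(1) by (simp add: complex_eq_iff)
  then obtain n :: int where n: "a = b + 2 * pi * n" using sin_cos_eq_iff by blast
  have "2 * pi * (- 1) < 2 * pi * n" "2 * pi * n < 2 * pi * 1" using n assms by linarith+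
  then have "- 1 < real_of_int n" "real_of_int n < 1"
    using mult_less_cancel_left_pos[of "2 * pi" "- 1" n] mult_less_cancel_left_pos[of "2 * pi" n 1] by simp_all
  then have "n = 0" by linarith
  then show ?thesis using n by simp
qed

text \<open>The curve factors through the quotient map from the interval to the circle, and a continuous
  injection from a compact space into a Hausdorff space is an embedding.\<close>

lemma homeomorphic_circle_of_closed_curve:
  fixes f :: "real \<Rightarrow> 'a"
  assumes M: "0 < M" and X: "Hausdorff_space X" and f: "continuous_map (top_of_set {0..M}) X f"
    and closed: "f 0 = f M" and inj: "inj_on f {0..<M}"
  shows "circle homeomorphic_space subtopology X (f ` {0..M})"
proof -
  define q where "q s = cis (2 * pi * s / M)" for s
  define g where "g z = f (SOME s. s \<in> {0..M} \<and> q s = z)" for z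
  have qeq: "s = s' \<or> s = 0 \<and> s' = M \<or> s = M \<and> s' = 0"
    if "s \<in> {0..M}" "s' \<in> {0..M}" "q s = q s'" for s s'
  proof -
    \<comment> \<open>Moving the endpoint \<open>M\<close> to 0 keeps the point of the circle.\<close>
    define r where "r u = (if u = M then 0 else u)" for u :: real
    have rq: "q (r u) = q u" for u using M by (simp add: r_def q_def complex_eq_iff)
    have rr: "0 \<le> 2 * pi * r u / M \<and> 2 * pi * r u / M < 2 * pi" if "u \<in> {0..M}" for u
      using that M by (auto simp: r_def field_simps)
    have "cis (2 * pi * r s / M) = cis (2 * pi * r s' / M)"
      using that(3) rq[of s] rq[of s'] by (simp add: q_def)
    from cis_eq_imp[OF this] rr[OF that(1)] rr[OF that(2)] have "2 * pi * r s / M = 2 * pi * r s' / M" by blast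
    then have "r s = r s'" using M by simp
    then show ?thesis by (auto simp: r_def split: if_splits)
  qed
  have gq: "g (q s) = f s" if "s \<in> {0..M}" for s
  proof -
    have "\<exists>u. u \<in> {0..M} \<and> q u = q s" using that by blast
    from someI_ex[OF this] have "(SOME u. u \<in> {0..M} \<and> q u = q s) \<in> {0..M}"
      "q (SOME u. u \<in> {0..M} \<and> q u = q s) = q s" by (blast, blast)
    from qeq[OF this(1) that this(2)] show ?thesis unfolding g_def using closed by (elim disjE conjE) simp_all
  qed
  have surj: "q ` {0..M} = sphere 0 1"
  proof
    show "q ` {0..M} \<subseteq> sphere 0 1" by (auto simp: q_def)
    show "sphere 0 1 \<subseteq> q ` {0..M}"
    proof
      fix z :: complex assume "z \<in> sphere 0 1"
      then have "norm z = 1" by simp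
      then obtain t where t: "0 \<le> t" "t < 2 * pi" "z = Complex (cos t) (sin t)" using complex_unimodular_polar by blast
      have "z = q (M * t / (2 * pi))" using t M by (simp add: q_def complex_eq_iff)
      moreover have "M * t / (2 * pi) \<in> {0..M}" using t M by (simp add: field_simps)
      ultimately show "z \<in> q ` {0..M}" by blast
    qed
  qed
  have "continuous_on {0..M} q" unfolding q_def using M by (intro continuous_intros) auto
  then have "continuous_map (top_of_set {0..M}) circle q" using surj by (auto simp: continuous_map_in_subtopology)
  then have quot: "quotient_map (top_of_set {0..M}) circle q"
    by (rule continuous_imp_quotient_map)
      (use surj in \<open>simp_all add: compact_space_subtopology Hausdorff_space_subtopology\<close>)
  have "continuous_map (top_of_set {0..M}) X (g \<circ> q)"
    using f by (rule continuous_map_eq) (simp add: gq)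
  then have g: "continuous_map circle X g" using continuous_compose_quotient_map_eq[OF quot] by blast
  have img: "g ` sphere 0 1 = f ` {0..M}" unfolding surj[symmetric] image_image using gq by simp
  have "inj_on g (sphere 0 1)"
  proof (rule inj_onI)
    fix z w assume "z \<in> sphere 0 1" "w \<in> sphere 0 1" and eq: "g z = g w"
    then obtain s u where su: "s \<in> {0..M}" "u \<in> {0..M}" "z = q s" "w = q u" unfolding surj[symmetric] by blast
    then have fe: "f s = f u" using eq gq by simp
    define r where "r v = (if v = M then 0 else v)" for v :: real
    have "r s \<in> {0..<M}" "r u \<in> {0..<M}" "f (r s) = f (r u)" using su fe closed M by (auto simp: r_def)
    then have "r s = r u" using inj by (simp add: inj_on_def)
    moreover have "q (r v) = q v" for v using M by (simp add: r_def q_def complex_eq_iff)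
    ultimately show "z = w" using su by metis
  qed
  moreover have "continuous_map circle (subtopology X (f ` {0..M})) g"
    using g img by (auto simp: continuous_map_in_subtopology)
  moreover have "f ` {0..M} \<subseteq> topspace X" using continuous_map_image_subset_topspace[OF f] by simp
  ultimately have "homeomorphic_map circle (subtopology X (f ` {0..M})) g"
    using X img by (intro continuous_imp_homeomorphic_map)
      (auto simp: compact_space_subtopology Hausdorff_space_subtopology Int_absorb1)
  then show ?thesis by (rule homeomorphic_map_imp_homeomorphic_space)
qed

definition cut :: "'v set set \<Rightarrow> 'v set \<Rightarrow> 'v set set" where
  "cut E X = {e \<in> E. e \<inter> X \<noteq> {} \<and> \<not> e \<subseteq> X}"

section \<open>Finite cuts and Euler tours\<close>

subsection \<open>Edge-ends\<close>

lemma ray_tail_avoiding_edges: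
  assumes r: "ray G r" and S: "finite S"
  shows "\<exists>C\<in>components (del_edges G S). tail_in C r"
proof -
  have inj: "inj r" using r by (simp add: ray_def)
  have "inj (\<lambda>n. {r n, r (Suc n)})"
    by (rule injI) (auto simp: doubleton_eq_iff inj_eq[OF inj])
  from finite_vimageI[OF S this] have "finite ((\<lambda>n. {r n, r (Suc n)}) -` S)" .
  from finite_nat_bounded[OF this] obtain i where sub: "(\<lambda>n. {r n, r (Suc n)}) -` S \<subseteq> {..<i}" by (elim exE)
  have i: "{r j, r (Suc j)} \<notin> S" if "i \<le> j" for j
  proof
    assume "{r j, r (Suc j)} \<in> S"
    then have "j \<in> {..<i}" by (intro subsetD[OF sub]) simp
    then show False using that by simp
  qed
  show ?thesis
    by (rule ray_eventually_linked[OF r, of i]) (use r i in \<open>auto simp: ray_def del_edges_def\<close>)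
qed

lemma edge_endE:
  assumes "\<omega> \<in> edge_ends G"
  obtains r0 where "ray G r0" "\<And>r. r \<in> \<omega> \<longleftrightarrow> ray G r \<and> edge_equivalent G r0 r"
proof -
  from assms obtain r0 where "ray G r0"
    "\<omega> = {(r, s). ray G r \<and> ray G s \<and> edge_equivalent G r s} `` {r0}"
    unfolding edge_ends_def by (elim quotientE) simp
  then show ?thesis using that[of r0] by simp
qed

lemma edge_end_component:
  assumes "\<omega> \<in> edge_ends G" "finite S"
  obtains C where "C \<in> components (del_edges G S)" "\<exists>r\<in>\<omega>. ray C r"
proof -
  obtain r0 where r0: "ray G r0" "\<And>r. r \<in> \<omega> \<longleftrightarrow> ray G r \<and> edge_equivalent G r0 r"
    using edge_endE[OF assms(1)] by metis
  obtain C where C: "C \<in> components (del_edges G S)" "tail_in C r0"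
    using ray_tail_avoiding_edges[OF r0(1) assms(2)] by (elim bexE)
  obtain i where i: "ray C (\<lambda>k. r0 (k + i))" using C(2) unfolding tail_in_def by (elim exE)
  have "edge_equivalent G r0 (\<lambda>k. r0 (k + i))"
    unfolding edge_equivalent_def
  proof (intro allI impI)
    fix S' assume "finite S' \<and> S' \<subseteq> edges G"
    then obtain C' where "C' \<in> components (del_edges G S')" "tail_in C' r0"
      using ray_tail_avoiding_edges[OF r0(1)] by metis
    then show "\<exists>C\<in>components (del_edges G S'). tail_in C r0 \<and> tail_in C (\<lambda>k. r0 (k + i))"
      using tail_in_tail by (intro bexI[of _ C']) simp_all
  qed
  then have "(\<lambda>k. r0 (k + i)) \<in> \<omega>" using r0 ray_tail[OF r0(1)] by simp
  then show ?thesis using that[OF C(1)] i by (intro that[OF C(1)] bexI)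
qed

lemma edge_end_component_unique:
  assumes "\<omega> \<in> edge_ends G" "finite S" "S \<subseteq> edges G"
    and C: "C \<in> components (del_edges G S)" "C' \<in> components (del_edges G S)"
    and "r \<in> \<omega>" "tail_in C r" "r' \<in> \<omega>" "tail_in C' r'"
  shows "C = C'"
proof -
  obtain r0 where r0: "ray G r0" "\<And>r. r \<in> \<omega> \<longleftrightarrow> ray G r \<and> edge_equivalent G r0 r"
    using edge_endE[OF assms(1)] by metis
  have "\<exists>D\<in>components (del_edges G S). tail_in D r0 \<and> tail_in D s" if "s \<in> \<omega>" for s
    using r0(2) that assms(2,3) by (simp add: edge_equivalent_def)
  then obtain D D' where D: "D \<in> components (del_edges G S)" "tail_in D r0" "tail_in D r"
    "D' \<in> components (del_edges G S)" "tail_in D' r0" "tail_in D' r'" using assms(6,8) by metis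
  have "C = D" by (rule component_unique_tail[OF C(1) D(1) assms(7) D(3)])
  also have "D = D'" by (rule component_unique_tail[OF D(1,4,2,5)])
  also have "D' = C'" by (rule component_unique_tail[OF D(4) C(2) D(6) assms(9)])
  finally show ?thesis .
qed


subsection \<open>The two sides of a finite cut in ETOP\<close>

text \<open>The barycentric coordinates of the midpoint if \<open>e\<close> has two elements.\<close>

definition midpoint :: "'v set \<Rightarrow> 'v \<Rightarrow> real" where
  "midpoint e = (\<lambda>v. if v \<in> e then 1 / 2 else 0)"

lemma midpoint_inner:
  assumes "simple_graph G" "e \<in> edges G"
  shows "midpoint e \<in> inner_pts e"
proof -
  obtain x y where "x \<noteq> y" "e = {x, y}" using edgeE[OF assms] .
  then show ?thesis by (simp add: inner_pts_def midpoint_def)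
qed

definition ETOP_nbhd :: "'v graph \<Rightarrow> 'v set set \<Rightarrow> 'v graph \<Rightarrow> 'v space_pt set" where
  "ETOP_nbhd G S C = Pt ` complex_pts C \<union> End ` {\<omega> \<in> edge_ends G. \<exists>r\<in>\<omega>. ray C r}
    \<union> Pt ` (\<Union>e\<in>S. \<Union>y \<in> e \<inter> verts C. half_edge e (midpoint e) y)"

text \<open>Every component of the graph without the cut edges lies inside or outside \<open>X\<close>. The cut edges
  are divided at their midpoints, so that the union of the basic neighbourhoods of the components
  inside \<open>X\<close> contains the half-edges attached to \<open>X\<close>.\<close>

definition side :: "'v graph \<Rightarrow> 'v set \<Rightarrow> 'v space_pt set" where
  "side G X = \<Union> (ETOP_nbhd G (cut (edges G) X) `
     {C \<in> components (del_edges G (cut (edges G) X)). verts C \<subseteq> X})"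

lemma in_sideI:
  "C \<in> components (del_edges G (cut (edges G) X)) \<Longrightarrow> verts C \<subseteq> X \<Longrightarrow>
    a \<in> ETOP_nbhd G (cut (edges G) X) C \<Longrightarrow> a \<in> side G X"
  unfolding side_def by blast

lemma openin_ETOP'_edge:
  assumes "e \<in> edges G" "x \<in> e" "open U"
  shows "openin (ETOP' G) (Pt ` {p \<in> inner_pts e. p x \<in> U})"
  unfolding ETOP'_def
proof (intro topology_generated_by_Basis UnI1 CollectI exI conjI)
  show "open_in_edge e {p \<in> inner_pts e. p x \<in> U}"
    unfolding open_in_edge_def using assms(2,3) by (intro bexI[of _ x] exI[of _ U]) simp_all
qed (use assms(1) in simp_all)

lemma cut_sub: "cut E X \<subseteq> E"
  by (auto simp: cut_def)

lemma cut_Compl: "cut E (- X) = cut E X"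
  by (auto simp: cut_def)

lemma openin_side:
  assumes G: "simple_graph G" and fin: "finite (cut (edges G) X)"
  shows "openin (ETOP' G) (side G X)"
  unfolding side_def
proof (rule openin_Union, clarify)
  fix U E assume C: "(U, E) \<in> components (del_edges G (cut (edges G) X))"
  let ?S = "cut (edges G) X"
  have "ETOP_nbhd G ?S (U, E) \<in> ETOP'_basic G"
    unfolding ETOP'_basic_def ETOP_nbhd_def
    using C fin cut_sub[of "edges G" X] midpoint_inner[OF G]
    by (intro CollectI exI[of _ ?S] exI[of _ "(U, E)"] exI[of _ "\<lambda>e y. midpoint e"]) (simp add: subset_iff)
  then show "openin (ETOP' G) (ETOP_nbhd G ?S (U, E))"
    unfolding ETOP'_def by (intro topology_generated_by_Basis UnI2)
qed

lemma ETOP'_pt_cases: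
  assumes G: "simple_graph G" and a: "a \<in> topspace (ETOP' G)"
  obtains (inner) e p where "e \<in> edges G" "p \<in> inner_pts e" "a = Pt p"
  | (vertex) v where "v \<in> verts G" "a = Pt (vertex_pt v)"
  | (endpt) \<omega> where "\<omega> \<in> edge_ends G" "a = End \<omega>"
proof -
  have "a \<in> \<Union> ({Pt ` W | e W. e \<in> edges G \<and> open_in_edge e W} \<union> ETOP'_basic G)"
    using a by (simp only: ETOP'_def topology_generated_by_topspace)
  then obtain U where "a \<in> U" and U: "U \<in> {Pt ` W | e W. e \<in> edges G \<and> open_in_edge e W} \<union> ETOP'_basic G"
    by (elim UnionE)
  from U show thesis
  proof
    assume "U \<in> {Pt ` W | e W. e \<in> edges G \<and> open_in_edge e W}"
    then obtain e W where "U = Pt ` W" "e \<in> edges G" "open_in_edge e W" by blast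
    then show ?thesis using inner \<open>a \<in> U\<close> unfolding open_in_edge_def by auto
  next
    assume "U \<in> ETOP'_basic G"
    then obtain S C z where S: "S \<subseteq> edges G" and C: "C \<in> components (del_edges G S)"
      and U: "U = Pt ` complex_pts C \<union> End ` {\<omega> \<in> edge_ends G. \<exists>r\<in>\<omega>. ray C r}
      \<union> Pt ` (\<Union>e\<in>S. \<Union>y \<in> e \<inter> verts C. half_edge e (z e y) y)"
      unfolding ETOP'_basic_def mem_Collect_eq by (elim exE conjE)
    have vC: "verts C \<subseteq> verts G" and eC: "edges C \<subseteq> edges G"
      using component_verts[OF C] component_edges[OF C] by (auto simp: del_edges_def)
    from \<open>a \<in> U\<close> consider p where "a = Pt p" "p \<in> complex_pts C" | \<omega> where "a = End \<omega>" "\<omega> \<in> edge_ends G"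
      | p e y where "a = Pt p" "e \<in> S" "y \<in> verts C" "p \<in> half_edge e (z e y) y" unfolding U by blast
    then show ?thesis
    proof cases
      case 1
      then show ?thesis using inner vertex vC eC unfolding complex_pts_def by blast
    next
      case 2
      then show ?thesis using endpt by blast
    next
      case 3
      then show ?thesis using inner vertex vC S unfolding half_edge_def by blast
    qed
  qed
qed

lemma component_one_side:
  assumes C: "C \<in> components (del_edges G (cut (edges G) X))" and x: "x \<in> verts C"
  shows "verts C \<subseteq> (if x \<in> X then X else - X)"
proof
  fix y assume "y \<in> verts C"
  then have "(x, y) \<in> linked (del_edges G (cut (edges G) X))" using component_linked[OF C x] by simp
  then have "(x, y) \<in> {(u, v). {u, v} \<in> edges (del_edges G (cut (edges G) X))}\<^sup>*" by (simp add: linked_def)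
  then have "y \<in> X \<longleftrightarrow> x \<in> X"
    by (induction rule: rtrancl_induct) (auto simp: del_edges_def cut_def)
  then show "y \<in> (if x \<in> X then X else - X)" by simp
qed

lemma vertex_in_side:
  assumes "x \<in> verts G" "x \<in> X"
  obtains C where "C \<in> components (del_edges G (cut (edges G) X))" "verts C \<subseteq> X" "x \<in> verts C"
proof -
  have "x \<in> verts (del_edges G (cut (edges G) X))" using assms(1) by (simp add: del_edges_def)
  from in_component[OF this] obtain C where C: "C \<in> components (del_edges G (cut (edges G) X))" "x \<in> verts C" .
  then have "verts C \<subseteq> X" using component_one_side[OF C] assms(2) by simp
  then show ?thesis using that C by blast
qed

lemma inside_edge_in_side:
  assumes G: "simple_graph G" and e: "e \<in> edges G" "e \<subseteq> X" and p: "p \<in> inner_pts e"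
  shows "Pt p \<in> side G X"
proof -
  obtain x y where xy: "x \<in> verts G" "y \<in> verts G" "x \<noteq> y" "e = {x, y}" using edgeE[OF G e(1)] .
  then have "x \<in> X" using e by simp
  obtain C where C: "C \<in> components (del_edges G (cut (edges G) X))" "verts C \<subseteq> X" "x \<in> verts C"
    using vertex_in_side[OF xy(1) \<open>x \<in> X\<close>] .
  have e': "{x, y} \<in> edges (del_edges G (cut (edges G) X))"
    using e xy(4) by (simp add: del_edges_def cut_def)
  have "y \<in> verts C" using component_closed[OF C(1,3) e'] xy(2) by (simp add: del_edges_def)
  then have "e \<in> edges C" using component_edges[OF C(1)] e' C(3) xy(4) by simp
  then have "p \<in> complex_pts C" using p unfolding complex_pts_def by blast
  then show ?thesis unfolding side_def ETOP_nbhd_def using C(1,2) by blast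
qed

lemma cut_edge_in_side:
  assumes G: "simple_graph G" and e: "e \<in> cut (edges G) X" "x \<in> e" "x \<in> X"
    and p: "p \<in> inner_pts e" "1 / 2 < p x"
  shows "Pt p \<in> side G X"
proof -
  have eG: "e \<in> edges G" using e(1) by (simp add: cut_def)
  obtain y where "x \<in> verts G" using edge_otherE[OF G eG e(2)] by metis
  obtain C where C: "C \<in> components (del_edges G (cut (edges G) X))" "verts C \<subseteq> X" "x \<in> verts C"
    using vertex_in_side[OF \<open>x \<in> verts G\<close> e(3)] .
  have "p \<in> half_edge e (midpoint e) x" using p e(2) by (simp add: half_edge_def midpoint_def)
  then have "Pt p \<in> ETOP_nbhd G (cut (edges G) X) C"
    unfolding ETOP_nbhd_def using e(1,2) C(3) by blast
  then show ?thesis unfolding side_def using C(1,2) by blast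
qed

lemma sides_cover:
  assumes G: "simple_graph G" and fin: "finite (cut (edges G) X)" and a: "a \<in> topspace (ETOP' G)"
  shows "a \<in> side G X \<or> a \<in> side G (- X) \<or> (\<exists>e\<in>cut (edges G) X. a = Pt (midpoint e))"
  using G a
proof (cases rule: ETOP'_pt_cases)
  case (inner e p)
  show ?thesis
  proof (cases "e \<in> cut (edges G) X")
    case False
    then have "e \<subseteq> X \<or> e \<subseteq> - X" using inner(1) by (auto simp: cut_def)
    then show ?thesis using inside_edge_in_side[OF G inner(1) _ inner(2)] inner(3) by blast
  next
    case cut: True
    then obtain x where x: "x \<in> e" "x \<in> X" by (auto simp: cut_def)
    obtain y where y: "x \<noteq> y" "e = {x, y}" using edge_otherE[OF G inner(1) x(1)] .
    have "y \<notin> X" using cut x y by (auto simp: cut_def)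
    have s: "p x + p y = 1" using inner_sum inner(2) y by metis
    consider "1 / 2 < p x" | "1 / 2 < p y" | "p x = 1 / 2" "p y = 1 / 2" using s by linarith
    then show ?thesis
    proof cases
      case 1
      then show ?thesis using cut_edge_in_side[OF G cut x inner(2)] inner(3) by simp
    next
      case 2
      then show ?thesis using cut_edge_in_side[OF G, of e "- X" y p] cut inner \<open>y \<notin> X\<close> y(2) by (simp add: cut_Compl)
    next
      case 3
      have "p = midpoint e"
      proof
        fix v show "p v = midpoint e v" using 3 inner(2) y(2) by (auto simp: midpoint_def inner_pts_def)
      qed
      then show ?thesis using cut inner(3) by blast
    qed
  qed
next
  case (vertex v)
  have "Pt (vertex_pt v) \<in> side G Y" if vY: "v \<in> Y" for Y
  proof -
    obtain C where C: "C \<in> components (del_edges G (cut (edges G) Y))" "verts C \<subseteq> Y" "v \<in> verts C"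
      using vertex_in_side[OF vertex(1) vY] .
    then have "vertex_pt v \<in> complex_pts C" by (simp add: complex_pts_def)
    then show ?thesis unfolding side_def ETOP_nbhd_def using C(1,2) by blast
  qed
  from this[of X] this[of "- X"] show ?thesis using vertex(2) by (cases "v \<in> X") simp_all
next
  case (endpt \<omega>)
  obtain C where C: "C \<in> components (del_edges G (cut (edges G) X))" "\<exists>r\<in>\<omega>. ray C r"
    using edge_end_component[OF endpt(1) fin] .
  then obtain r where "ray C r" by (elim bexE)
  then have "r 0 \<in> verts C" by (auto simp: ray_def)
  then have "verts C \<subseteq> X \<or> verts C \<subseteq> - X" using component_one_side[OF C(1)] by (metis (full_types))
  moreover have "End \<omega> \<in> ETOP_nbhd G (cut (edges G) X) C"
    using C(2) endpt(1) by (simp add: ETOP_nbhd_def)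
  ultimately show ?thesis
    using in_sideI[OF C(1), of "End \<omega>"] in_sideI[of C G "- X" "End \<omega>", unfolded cut_Compl, OF C(1)] endpt(2)
    by auto
qed

text \<open>The total mass on \<open>X\<close> distinguishes the side of \<open>X\<close> from the side of its complement for all points
  of the 1-complex at once, whatever kind of point they are.\<close>

lemma side_mass:
  assumes G: "simple_graph G" and p: "Pt p \<in> side G X"
  shows "finite {v. p v \<noteq> 0}" "(\<Sum>v | p v \<noteq> 0. p v) = 1" "1 / 2 < (\<Sum>v | v \<in> X \<and> p v \<noteq> 0. p v)"
proof -
  obtain C where C: "C \<in> components (del_edges G (cut (edges G) X))" "verts C \<subseteq> X"
    and p: "Pt p \<in> ETOP_nbhd G (cut (edges G) X) C" using p unfolding side_def by blast
  have eC: "edges C \<subseteq> {e \<in> edges G. e \<subseteq> verts C}"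
    using component_edges[OF C(1)] by (auto simp: del_edges_def)
  consider v where "v \<in> X" "p = vertex_pt v"
    | e y where "e \<in> edges G" "p \<in> inner_pts e" "y \<in> e" "y \<in> X" "1 / 2 < p y \<or> e \<subseteq> X"
  proof -
    from p consider "p \<in> complex_pts C" | e y where "e \<in> cut (edges G) X" "y \<in> e" "y \<in> verts C" "p \<in> half_edge e (midpoint e) y"
      unfolding ETOP_nbhd_def by blast
    then show thesis
    proof cases
      case 1
      then consider v where "v \<in> verts C" "p = vertex_pt v" | e where "e \<in> edges C" "p \<in> inner_pts e"
        unfolding complex_pts_def by blast
      then show thesis
      proof cases
        case 1
        then show ?thesis using that(1) C(2) by blast
      next
        case 2
        then have e: "e \<in> edges G" "e \<subseteq> X" using eC C(2) by blast+
        obtain x y where "e = {x, y}" using edgeE[OF G e(1)] .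
        then have "x \<in> e" by simp
        then show ?thesis using that(2)[OF e(1) 2(2)] e(2) by blast
      qed
    next
      case 2
      have y: "y \<in> X" using 2 C(2) by blast
      have eG: "e \<in> edges G" using 2(1) by (simp add: cut_def)
      from 2(4) consider "p \<in> inner_pts e" "1 / 2 < p y" | "p = vertex_pt y"
        using 2(2) by (auto simp: half_edge_def midpoint_def)
      then show ?thesis
      proof cases
        case 1
        then show ?thesis using that(2)[OF eG 1(1) 2(2) y] by simp
      next
        case 2
        then show ?thesis using that(1) y by blast
      qed
    qed
  qed
  then have "finite {v. p v \<noteq> 0} \<and> (\<Sum>v | p v \<noteq> 0. p v) = 1 \<and> 1 / 2 < (\<Sum>v | v \<in> X \<and> p v \<noteq> 0. p v)"
  proof cases
    case 1
    then have "{v. p v \<noteq> 0} = {v}" "{u. u \<in> X \<and> p u \<noteq> 0} = {v}" "p v = 1" by (auto simp: vertex_pt_def)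
    then show ?thesis by simp
  next
    case 2
    obtain z where z: "y \<noteq> z" "e = {y, z}" using edge_otherE[OF G 2(1,3)] .
    have s: "p y + p z = 1" using inner_sum 2(2) z by metis
    have pos: "0 < p y" "0 < p z" using inner_pos[OF 2(2)] z(2) by simp_all
    have supp: "{v. p v \<noteq> 0} = {y, z}" using support_inner[OF 2(2)] z(2) by simp
    then have "{u. u \<in> X \<and> p u \<noteq> 0} = (if z \<in> X then {y, z} else {y})" using 2(4) pos by auto
    moreover have "z \<in> X \<or> 1 / 2 < p y" using 2(5) z(2) by blast
    ultimately show ?thesis using s z(1) pos by (auto simp: supp)
  qed
  then show "finite {v. p v \<noteq> 0}" "(\<Sum>v | p v \<noteq> 0. p v) = 1" "1 / 2 < (\<Sum>v | v \<in> X \<and> p v \<noteq> 0. p v)" by simp_all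
qed

lemma sides_disjoint:
  assumes G: "simple_graph G" and fin: "finite (cut (edges G) X)"
    and a: "a \<in> side G X" "a \<in> side G (- X)"
  shows False
proof (cases a)
  case (Pt p)
  note X = side_mass[OF G a(1)[unfolded Pt]] and Y = side_mass[OF G a(2)[unfolded Pt]]
  have eq: "{v. p v \<noteq> 0} = {v. v \<in> X \<and> p v \<noteq> 0} \<union> {v. v \<in> - X \<and> p v \<noteq> 0}" by auto
  have "sum p {v. p v \<noteq> 0} = sum p {v. v \<in> X \<and> p v \<noteq> 0} + sum p {v. v \<in> - X \<and> p v \<noteq> 0}"
    unfolding eq by (rule sum.union_disjoint) (auto intro: finite_subset[OF _ X(1)])
  then show ?thesis using X(2,3) Y(3) by linarith
next
  case (End \<omega>)
  let ?S = "cut (edges G) X"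
  obtain C r where C: "C \<in> components (del_edges G ?S)" "verts C \<subseteq> X" "\<omega> \<in> edge_ends G" "r \<in> \<omega>" "ray C r"
    using a(1) unfolding side_def ETOP_nbhd_def End by auto
  obtain C' r' where C': "C' \<in> components (del_edges G ?S)" "verts C' \<subseteq> - X" "r' \<in> \<omega>" "ray C' r'"
    using a(2) unfolding side_def ETOP_nbhd_def End cut_Compl by auto
  have "C = C'"
    by (rule edge_end_component_unique[OF C(3) fin cut_sub C(1) C'(1) C(4) ray_tail_in[OF C(5)] C'(3) ray_tail_in[OF C'(4)]])
  moreover have "r 0 \<in> verts C" using C(5) by (auto simp: ray_def)
  ultimately show ?thesis using C(2) C'(2) by blast
qed

subsection \<open>Counting sign changes\<close>

text \<open>The property \<open>P\<close> is constant between consecutive points of \<open>Z\<close> and changes at each of them. The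
  induction removes the last point of \<open>Z\<close>.\<close>

lemma parity_of_crossings:
  fixes P :: "real \<Rightarrow> bool"
  assumes "finite Z" "a \<le> b" "Z \<subseteq> {a<..<b}"
    and "\<And>t. t \<in> {a..b} - Z \<Longrightarrow> \<exists>\<delta>>0. \<forall>t'\<in>{a..b}. \<bar>t' - t\<bar> < \<delta> \<longrightarrow> P t' = P t"
    and "\<And>z. z \<in> Z \<Longrightarrow> \<exists>\<delta>>0. \<forall>t t'. z - \<delta> < t \<and> t < z \<and> z < t' \<and> t' < z + \<delta> \<longrightarrow> P t \<noteq> P t'"
  shows "P a = P b \<longleftrightarrow> even (card Z)"
  using assms
proof (induction "card Z" arbitrary: Z b)
  case 0
  then have Z: "Z = {}" by simp
  have "P a = P b"
  proof (rule connected_local_const[of "{a..b}"])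
    show "connected {a..b}" by simp
    show "a \<in> {a..b}" "b \<in> {a..b}" using 0(3) by simp_all
    show "\<forall>t\<in>{a..b}. eventually (\<lambda>t'. P t = P t') (at t within {a..b})"
    proof
      fix t assume "t \<in> {a..b}"
      then obtain \<delta> where "\<delta> > 0" "\<forall>t'\<in>{a..b}. \<bar>t' - t\<bar> < \<delta> \<longrightarrow> P t' = P t" using 0(5)[of t] Z by auto
      then show "eventually (\<lambda>t'. P t = P t') (at t within {a..b})"
        unfolding eventually_at by (intro exI[of _ \<delta>]) (auto simp: dist_real_def)
    qed
  qed
  then show ?case using Z by simp
next
  case (Suc n)
  define z where "z = Max Z"
  have ne: "Z \<noteq> {}" using Suc.hyps(2) by auto
  have z: "z \<in> Z" and zmax: "\<And>u. u \<in> Z \<Longrightarrow> u \<le> z"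
    using Max_in[OF Suc.prems(1) ne] Max_ge[OF Suc.prems(1)] by (simp_all add: z_def)
  have zab: "a < z" "z < b" using z Suc.prems(3) by auto
  obtain \<delta> where \<delta>: "\<delta> > 0" "\<forall>t t'. z - \<delta> < t \<and> t < z \<and> z < t' \<and> t' < z + \<delta> \<longrightarrow> P t \<noteq> P t'"
    using Suc.prems(5)[OF z] by blast
  define c0 where "c0 = Max (insert a (insert (z - \<delta>) (Z - {z})))"
  have fin: "finite (insert a (insert (z - \<delta>) (Z - {z})))" using Suc.prems(1) by simp
  have c0: "c0 < z" "\<And>u. u \<in> insert a (insert (z - \<delta>) (Z - {z})) \<Longrightarrow> u \<le> c0"
  proof -
    have "u < z" if "u \<in> insert a (insert (z - \<delta>) (Z - {z}))" for u
      using that zab \<delta>(1) zmax[of u] by auto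
    then show "c0 < z" unfolding c0_def using Max_in[OF fin] by blast
    show "\<And>u. u \<in> insert a (insert (z - \<delta>) (Z - {z})) \<Longrightarrow> u \<le> c0"
      unfolding c0_def using Max_ge[OF fin] by blast
  qed
  define c where "c = (c0 + z) / 2"
  have c: "c0 < c" "c < z" using c0(1) by (simp_all add: c_def)
  \<comment> \<open>All other points of \<open>Z\<close> lie before \<open>c\<close>, none lies after \<open>d\<close>, and \<open>P\<close> changes from \<open>c\<close> to \<open>d\<close>.\<close>
  define d where "d = min ((z + b) / 2) (z + \<delta> / 2)"
  have d: "z < d" "d < b" "d < z + \<delta>" using zab \<delta>(1) by (auto simp: d_def min_def)
  have ac: "a < c" "z - \<delta> < c" using c0(2)[of a] c0(2)[of "z - \<delta>"] c(1) by auto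
  have Zc: "Z - {z} \<subseteq> {a<..<c}"
  proof
    fix u assume u: "u \<in> Z - {z}"
    then show "u \<in> {a<..<c}" using c0(2)[of u] c(1) Suc.prems(3) by auto
  qed
  have "P a = P c \<longleftrightarrow> even (card (Z - {z}))"
  proof (rule Suc.hyps(1))
    show "n = card (Z - {z})" using Suc.hyps(2) z Suc.prems(1) by simp
    show "finite (Z - {z})" "a \<le> c" "Z - {z} \<subseteq> {a<..<c}" using Suc.prems(1) ac Zc by simp_all
    fix t assume t: "t \<in> {a..c} - (Z - {z})"
    then have "t \<in> {a..b} - Z" using c zab by auto
    then obtain \<epsilon> where "\<epsilon> > 0" "\<forall>t'\<in>{a..b}. \<bar>t' - t\<bar> < \<epsilon> \<longrightarrow> P t' = P t" using Suc.prems(4) by blast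
    then show "\<exists>\<epsilon>>0. \<forall>t'\<in>{a..c}. \<bar>t' - t\<bar> < \<epsilon> \<longrightarrow> P t' = P t"
      using c zab by (intro exI[of _ \<epsilon>]) auto
  qed (use Suc.prems(5) in blast)
  moreover have "P c \<noteq> P d" using \<delta>(2) ac(2) c(2) d(1,3) by blast
  moreover have "P d = P b"
  proof (rule connected_local_const[of "{d..b}"])
    show "connected {d..b}" by simp
    show "d \<in> {d..b}" "b \<in> {d..b}" using d by simp_all
    show "\<forall>t\<in>{d..b}. eventually (\<lambda>t'. P t = P t') (at t within {d..b})"
    proof
      fix t assume t: "t \<in> {d..b}"
      then have "t \<notin> Z" using zmax[of t] d(1) by auto
      then have "t \<in> {a..b} - Z" using t d zab by auto
      then obtain \<epsilon> where \<epsilon>: "\<epsilon> > 0" "\<forall>t'\<in>{a..b}. \<bar>t' - t\<bar> < \<epsilon> \<longrightarrow> P t' = P t" using Suc.prems(4) by blast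
      have "{d..b} \<subseteq> {a..b}" using d zab by auto
      then show "eventually (\<lambda>t'. P t = P t') (at t within {d..b})"
        unfolding eventually_at using \<epsilon> by (intro exI[of _ \<epsilon>]) (auto simp: dist_real_def)
    qed
  qed
  moreover have "card Z = Suc (card (Z - {z}))" using card_Suc_Diff1[OF Suc.prems(1) z] by simp
  ultimately show ?case by (cases "P a"; cases "P b"; cases "P c"; cases "P d") simp_all
qed

subsection \<open>Tours cross finite cuts evenly\<close>

text \<open>The coordinates of an inner point can be read off from the open sets that contain it, so the
  identification of indistinguishable points leaves it alone.\<close>

lemma Kolmogorov_quotient_inner:
  assumes G: "simple_graph G" and e: "e \<in> edges G" "p \<in> inner_pts e"
  shows "Kolmogorov_quotient (ETOP' G) (Pt p) = Pt p"
proof -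
  let ?k = "Kolmogorov_quotient (ETOP' G) (Pt p)"
  have mem: "?k \<in> Pt ` {q \<in> inner_pts e. q x \<in> U} \<longleftrightarrow> p x \<in> U" if "x \<in> e" "open U" for x U
    using Kolmogorov_quotient_in_open[OF openin_ETOP'_edge[OF e(1) that], of "Pt p"] e(2) by simp
  obtain x y where xy: "e = {x, y}" using edgeE[OF G e(1)] .
  have "?k \<in> Pt ` {q \<in> inner_pts e. q x \<in> UNIV}" using mem[of x UNIV] xy by simp
  then obtain q where q: "?k = Pt q" "q \<in> inner_pts e" by auto
  have "q v = p v" for v
  proof (cases "v \<in> e")
    case True
    \<comment> \<open>The open set of points of \<open>e\<close> whose coordinate at \<open>v\<close> is not \<open>q v\<close> does not contain \<open>Pt q\<close>.\<close>
    have "p v \<notin> - {q v}" using mem[OF True, of "- {q v}"] q by auto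
    then show ?thesis by simp
  next
    case False
    then show ?thesis using q(2) e(2) by (simp add: inner_pts_def)
  qed
  then show ?thesis using q(1) by (simp add: fun_eq_iff)
qed

locale tour =
  fixes G :: "'v graph" and \<sigma> :: "complex \<Rightarrow> 'v space_pt"
  assumes graph: "simple_graph G" and tour: "euler_tour G \<sigma>" and nonempty: "edges G \<noteq> {}"
begin

lemma \<sigma>_continuous: "continuous_map circle (ETOP' G) \<sigma>"
  using tour unfolding euler_tour_def ETOP_def continuous_map_in_subtopology by blast

lemma \<sigma>_once:
  assumes "e \<in> edges G" "p \<in> inner_pts e"
  shows "\<exists>!s. s \<in> sphere 0 1 \<and> \<sigma> s = Pt p"
  using tour assms Kolmogorov_quotient_inner[OF graph assms] unfolding euler_tour_def by metis

text \<open>A parametrisation that starts at a point which is not the midpoint of an edge passes the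
  midpoints at inner points of the parameter interval.\<close>

definition base :: complex where
  "base = (SOME s. s \<in> sphere 0 1 \<and> (\<exists>e\<in>edges G. \<exists>p\<in>inner_pts e. p \<noteq> midpoint e \<and> \<sigma> s = Pt p))"

definition \<gamma> :: "real \<Rightarrow> 'v space_pt" where
  "\<gamma> t = \<sigma> (base * cis t)"

lemma base: "norm base = 1" "\<exists>e\<in>edges G. \<exists>p\<in>inner_pts e. p \<noteq> midpoint e \<and> \<sigma> base = Pt p"
proof -
  obtain e where e: "e \<in> edges G" using nonempty by blast
  obtain x y where xy: "x \<noteq> y" "e = {x, y}" using edgeE[OF graph e] .
  \<comment> \<open>Any inner point other than the midpoint will do.\<close>
  let ?p = "edge_pt x y (1 / 3)"
  have p: "?p \<in> inner_pts e" using edge_pt_inner[OF xy(1), of "1/3"] xy(2) by simp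
  have "?p x = 2 / 3" "midpoint e x = 1 / 2" using xy by (simp_all add: edge_pt_def midpoint_def)
  then have "?p \<noteq> midpoint e" by auto
  moreover obtain s where "s \<in> sphere 0 1" "\<sigma> s = Pt ?p" using \<sigma>_once[OF e p] by blast
  ultimately have "\<exists>s. s \<in> sphere 0 1 \<and> (\<exists>e\<in>edges G. \<exists>p\<in>inner_pts e. p \<noteq> midpoint e \<and> \<sigma> s = Pt p)"
    using e p by blast
  from someI_ex[OF this] show "norm base = 1" "\<exists>e\<in>edges G. \<exists>p\<in>inner_pts e. p \<noteq> midpoint e \<and> \<sigma> base = Pt p"
    unfolding base_def by simp_all
qed

lemma \<gamma>_closed: "\<gamma> (2 * pi) = \<gamma> 0"
  by (simp add: \<gamma>_def)

lemma \<gamma>_continuous: "continuous_map euclideanreal (ETOP' G) \<gamma>"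
proof -
  have "continuous_on UNIV (\<lambda>t. base * cis t)" by (intro continuous_intros)
  then have "continuous_map euclideanreal circle (\<lambda>t. base * cis t)"
    using base(1) by (auto simp: continuous_map_in_subtopology norm_mult)
  from continuous_map_compose[OF this \<sigma>_continuous] show ?thesis by (simp add: comp_def \<gamma>_def[abs_def])
qed

lemma open_\<gamma>: "openin (ETOP' G) U \<Longrightarrow> open {t. \<gamma> t \<in> U}"
  using openin_continuous_map_preimage[OF \<gamma>_continuous] by simp

lemma \<gamma>_inj:
  assumes "e \<in> edges G" "p \<in> inner_pts e" "\<gamma> t = Pt p" "\<gamma> t' = Pt p"
    and "0 \<le> t" "t < 2 * pi" "0 \<le> t'" "t' < 2 * pi"
  shows "t = t'"
proof -
  have "base * cis t \<in> sphere 0 1" "base * cis t' \<in> sphere 0 1" using base(1) by (simp_all add: norm_mult)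
  then have "base * cis t = base * cis t'" using \<sigma>_once[OF assms(1,2)] assms(3,4) unfolding \<gamma>_def by blast
  then have "cis t = cis t'" using base(1) by auto
  then show ?thesis using cis_eq_imp assms(5-8) by blast
qed

lemma \<gamma>_surj:
  assumes "e \<in> edges G" "p \<in> inner_pts e"
  obtains t where "0 \<le> t" "t < 2 * pi" "\<gamma> t = Pt p"
proof -
  obtain s where s: "s \<in> sphere 0 1" "\<sigma> s = Pt p" using \<sigma>_once[OF assms] by blast
  have "norm (s / base) = 1" using s(1) base(1) by (simp add: norm_divide)
  then obtain t where t: "0 \<le> t" "t < 2 * pi" "s / base = Complex (cos t) (sin t)"
    using complex_unimodular_polar by blast
  then have "s / base = cis t" by (simp add: complex_eq_iff)
  moreover have "base \<noteq> 0" using base(1) by auto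
  ultimately have "s = base * cis t" by (metis nonzero_mult_div_cancel_left times_divide_eq_right)
  then show ?thesis using that t s(2) by (simp add: \<gamma>_def)
qed

lemma \<gamma>_0: "e \<in> edges G \<Longrightarrow> \<gamma> 0 \<noteq> Pt (midpoint e)"
proof
  assume e: "e \<in> edges G" and eq: "\<gamma> 0 = Pt (midpoint e)"
  obtain f p where f: "f \<in> edges G" "p \<in> inner_pts f" "p \<noteq> midpoint f" "\<sigma> base = Pt p" using base(2) by blast
  then have "p = midpoint e" using eq by (simp add: \<gamma>_def)
  moreover from this have "e = f" using inner_unique[OF midpoint_inner[OF graph e]] f(2) by simp
  ultimately show False using f(3) by simp
qed

text \<open>Since \<open>\<sigma>\<close> passes every inner point of \<open>e\<close> only once, the coordinate along \<open>e\<close> is an injective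
  continuous function of the parameter near \<open>z\<close>. It is therefore strictly monotone and passes
  from below one half to above one half or conversely.\<close>

lemma crossing:
  assumes e: "e \<in> cut (edges G) X" and fin: "finite (cut (edges G) X)"
    and z: "0 < z" "z < 2 * pi" "\<gamma> z = Pt (midpoint e)"
  shows "\<exists>\<delta>>0. \<forall>t t'. z - \<delta> < t \<and> t < z \<and> z < t' \<and> t' < z + \<delta> \<longrightarrow>
    (\<gamma> t \<in> side G X) \<noteq> (\<gamma> t' \<in> side G X)"
proof -
  have eG: "e \<in> edges G" using e by (simp add: cut_def)
  obtain x where x: "x \<in> e" "x \<in> X" using e by (auto simp: cut_def)
  obtain y where y: "x \<noteq> y" "e = {x, y}" using edge_otherE[OF graph eG x(1)] .
  have yX: "y \<notin> X" using e x y by (auto simp: cut_def)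
  have ye: "y \<in> e" using y by simp
  let ?O = "{t. \<gamma> t \<in> Pt ` {p \<in> inner_pts e. p x \<in> UNIV}}"
  have "open ({0<..<2 * pi} \<inter> ?O)"
    using open_\<gamma>[OF openin_ETOP'_edge[OF eG x(1) open_UNIV]] by (intro open_Int) auto
  moreover have "z \<in> {0<..<2 * pi} \<inter> ?O" using z midpoint_inner[OF graph eG] by simp
  ultimately obtain \<delta> where "\<delta> > 0" and ball: "ball z \<delta> \<subseteq> {0<..<2 * pi} \<inter> ?O" unfolding open_contains_ball by blast
  define c where "c t = (case \<gamma> t of Pt p \<Rightarrow> p x | End _ \<Rightarrow> 0)" for t
  have pt: "\<exists>p\<in>inner_pts e. \<gamma> t = Pt p \<and> c t = p x \<and> 0 < t \<and> t < 2 * pi" if "t \<in> ball z \<delta>" for t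
    using subsetD[OF ball that] by (auto simp: c_def)
  have cont: "continuous_on (ball z \<delta>) c"
    unfolding continuous_on_open_vimage[OF open_ball]
  proof (intro allI impI)
    fix B :: "real set" assume "open B"
    have "c -` B \<inter> ball z \<delta> = {t. \<gamma> t \<in> Pt ` {p \<in> inner_pts e. p x \<in> B}} \<inter> ball z \<delta>"
    proof (intro set_eqI)
      fix t
      show "t \<in> c -` B \<inter> ball z \<delta> \<longleftrightarrow> t \<in> {t. \<gamma> t \<in> Pt ` {p \<in> inner_pts e. p x \<in> B}} \<inter> ball z \<delta>"
      proof (cases "t \<in> ball z \<delta>")
        case True
        then obtain p where "p \<in> inner_pts e" "\<gamma> t = Pt p" "c t = p x" using pt by blast
        then show ?thesis using True by simp
      qed simp
    qed
    also have "open \<dots>" using open_\<gamma>[OF openin_ETOP'_edge[OF eG x(1) \<open>open B\<close>]] by (intro open_Int) auto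
    finally show "open (c -` B \<inter> ball z \<delta>)" .
  qed
  have eq: "p = q" if "p \<in> inner_pts e" "q \<in> inner_pts e" "p x = q x" for p q
  proof
    fix v
    have "p x + p y = 1" "q x + q y = 1" using inner_sum that(1,2) y by metis+
    then show "p v = q v" using that y by (cases "v = x"; cases "v = y") (auto simp: inner_pts_def)
  qed
  have inj: "inj_on c (ball z \<delta>)"
  proof (rule inj_onI)
    fix t t' assume t: "t \<in> ball z \<delta>" and t': "t' \<in> ball z \<delta>" and ct: "c t = c t'"
    obtain p where p: "p \<in> inner_pts e" "\<gamma> t = Pt p" "c t = p x" "0 < t" "t < 2 * pi" using pt[OF t] by blast
    obtain q where q: "q \<in> inner_pts e" "\<gamma> t' = Pt q" "c t' = q x" "0 < t'" "t' < 2 * pi" using pt[OF t'] by blast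
    have "p = q" using eq[OF p(1) q(1)] p(3) q(3) ct by simp
    then show "t = t'" using \<gamma>_inj[OF eG p(1), of t t'] p q by simp
  qed
  have cz: "c z = 1 / 2" using z(3) x(1) by (simp add: c_def midpoint_def)
  have sides: "\<gamma> t \<in> side G X \<longleftrightarrow> 1 / 2 < c t" if t: "t \<in> ball z \<delta>" "c t \<noteq> 1 / 2" for t
  proof -
    obtain p where p: "p \<in> inner_pts e" "\<gamma> t = Pt p" "c t = p x" using pt[OF t(1)] by blast
    have s: "p x + p y = 1" using inner_sum p(1) y by metis
    show ?thesis
    proof (cases "1 / 2 < p x")
      case True
      then show ?thesis using cut_edge_in_side[OF graph e x p(1) True] p by simp
    next
      case False
      then have "1 / 2 < p y" using s t(2) p(3) by linarith
      moreover have "e \<in> cut (edges G) (- X)" "y \<in> - X" using e yX by (simp_all add: cut_Compl)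
      ultimately have "Pt p \<in> side G (- X)" using cut_edge_in_side[OF graph _ ye _ p(1)] by blast
      then have "Pt p \<notin> side G X" using sides_disjoint[OF graph fin] by blast
      then show ?thesis using p False by simp
    qed
  qed
  have "(\<gamma> t \<in> side G X) \<noteq> (\<gamma> t' \<in> side G X)" if t: "z - \<delta> < t" "t < z" "z < t'" "t' < z + \<delta>" for t t'
  proof -
    have sub: "{t..t'} \<subseteq> ball z \<delta>" using t by (auto simp: dist_real_def)
    have "continuous_on {t..t'} c" "inj_on c {t..t'}"
      using continuous_on_subset[OF cont sub] inj_on_subset[OF inj sub] by simp_all
    from continuous_inj_imp_mono[OF t(2,3) this] have "c t < 1 / 2 \<and> 1 / 2 < c t' \<or> c t' < 1 / 2 \<and> 1 / 2 < c t"
      using cz by simp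
    moreover have "t \<in> ball z \<delta>" "t' \<in> ball z \<delta>" using t by (simp_all add: dist_real_def)
    ultimately show ?thesis using sides[of t] sides[of t'] by auto
  qed
  then show ?thesis using \<open>\<delta> > 0\<close> by (intro exI[of _ \<delta>]) simp
qed

lemma side_locally_constant:
  assumes fin: "finite (cut (edges G) X)" and t: "\<forall>e\<in>cut (edges G) X. \<gamma> t \<noteq> Pt (midpoint e)"
  shows "\<exists>\<delta>>0. \<forall>t'. \<bar>t' - t\<bar> < \<delta> \<longrightarrow> (\<gamma> t' \<in> side G X) = (\<gamma> t \<in> side G X)"
proof -
  have fin': "finite (cut (edges G) (- X))" using fin by (simp add: cut_Compl)
  have near: "\<exists>\<delta>>0. \<forall>t'. \<bar>t' - t\<bar> < \<delta> \<longrightarrow> \<gamma> t' \<in> side G Y" if "\<gamma> t \<in> side G Y" "finite (cut (edges G) Y)" for Y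
  proof -
    have "open {t. \<gamma> t \<in> side G Y}" by (rule open_\<gamma>[OF openin_side[OF graph that(2)]])
    then show ?thesis using that(1) unfolding open_dist dist_real_def by blast
  qed
  have "\<gamma> t \<in> topspace (ETOP' G)" using continuous_map_image_subset_topspace[OF \<gamma>_continuous] by auto
  from sides_cover[OF graph fin this] consider "\<gamma> t \<in> side G X" | "\<gamma> t \<in> side G (- X)" using t by blast
  then show ?thesis
  proof cases
    case 1
    then show ?thesis using near[OF _ fin] by simp
  next
    case 2
    then have "\<gamma> t \<notin> side G X" using sides_disjoint[OF graph fin] by blast
    moreover obtain \<delta> where "\<delta> > 0" "\<forall>t'. \<bar>t' - t\<bar> < \<delta> \<longrightarrow> \<gamma> t' \<in> side G (- X)" using near[OF 2 fin'] by blast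
    then have "\<delta> > 0" "\<forall>t'. \<bar>t' - t\<bar> < \<delta> \<longrightarrow> \<gamma> t' \<notin> side G X" using sides_disjoint[OF graph fin] by blast+
    ultimately show ?thesis by (intro exI[of _ \<delta>]) simp
  qed
qed

text \<open>The tour passes the midpoints of the cut edges at as many parameters as there are cut edges,
  changes sides exactly there, and ends where it started.\<close>

lemma even_finite_cut:
  assumes fin: "finite (cut (edges G) X)"
  shows "even (card (cut (edges G) X))"
proof -
  let ?S = "cut (edges G) X"
  have S: "e \<in> edges G" if "e \<in> ?S" for e using that by (simp add: cut_def)
  define \<tau> where "\<tau> e = (SOME t. 0 \<le> t \<and> t < 2 * pi \<and> \<gamma> t = Pt (midpoint e))" for e
  have \<tau>: "0 \<le> \<tau> e \<and> \<tau> e < 2 * pi \<and> \<gamma> (\<tau> e) = Pt (midpoint e)" if eS: "e \<in> ?S" for e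
  proof -
    obtain t where "0 \<le> t" "t < 2 * pi" "\<gamma> t = Pt (midpoint e)"
      using \<gamma>_surj[OF S[OF eS] midpoint_inner[OF graph S[OF eS]]] .
    then have "\<exists>t. 0 \<le> t \<and> t < 2 * pi \<and> \<gamma> t = Pt (midpoint e)" by blast
    from someI_ex[OF this] show ?thesis unfolding \<tau>_def .
  qed
  have \<tau>0: "0 < \<tau> e" if "e \<in> ?S" for e
    using \<tau>[OF that] \<gamma>_0[OF S[OF that]] by (cases "\<tau> e = 0") auto
  have "inj_on \<tau> ?S"
  proof (rule inj_onI)
    fix e f assume e: "e \<in> ?S" and f: "f \<in> ?S" and "\<tau> e = \<tau> f"
    then have "midpoint e = midpoint f" using \<tau>[OF e] \<tau>[OF f] by simp
    then show "e = f" using inner_unique[OF midpoint_inner[OF graph S[OF e]], of f] midpoint_inner[OF graph S[OF f]] by simp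
  qed
  then have card: "card (\<tau> ` ?S) = card ?S" by (rule card_image)
  have "(\<gamma> 0 \<in> side G X) = (\<gamma> (2 * pi) \<in> side G X) \<longleftrightarrow> even (card (\<tau> ` ?S))"
  proof (rule parity_of_crossings)
    show "finite (\<tau> ` ?S)" using fin by simp
    show "0 \<le> 2 * pi" by simp
    show "\<tau> ` ?S \<subseteq> {0<..<2 * pi}" using \<tau> \<tau>0 by auto
    fix t assume t: "t \<in> {0..2 * pi} - \<tau> ` ?S"
    have "\<gamma> t \<noteq> Pt (midpoint e)" if e: "e \<in> ?S" for e
    proof
      assume eq: "\<gamma> t = Pt (midpoint e)"
      have "t \<noteq> 2 * pi" using eq \<gamma>_closed \<gamma>_0[OF S[OF e]] by auto
      then have "t = \<tau> e"
        using \<gamma>_inj[OF S[OF e] midpoint_inner[OF graph S[OF e]] eq, of "\<tau> e"] \<tau>[OF e] t by simp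
      then show False using t e by simp
    qed
    then obtain \<delta> where "\<delta> > 0" "\<forall>t'. \<bar>t' - t\<bar> < \<delta> \<longrightarrow> (\<gamma> t' \<in> side G X) = (\<gamma> t \<in> side G X)"
      using side_locally_constant[OF fin] by blast
    then show "\<exists>\<delta>>0. \<forall>t'\<in>{0..2 * pi}. \<bar>t' - t\<bar> < \<delta> \<longrightarrow> (\<gamma> t' \<in> side G X) = (\<gamma> t \<in> side G X)" by blast
  next
    fix z assume "z \<in> \<tau> ` ?S"
    then obtain e where e: "e \<in> ?S" "z = \<tau> e" by blast
    show "\<exists>\<delta>>0. \<forall>t t'. z - \<delta> < t \<and> t < z \<and> z < t' \<and> t' < z + \<delta> \<longrightarrow> (\<gamma> t \<in> side G X) \<noteq> (\<gamma> t' \<in> side G X)"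
      using crossing[OF e(1) fin, of z] \<tau>[OF e(1)] \<tau>0[OF e(1)] e(2) by simp
  qed
  then show ?thesis using \<gamma>_closed card by simp
qed

text \<open>If no edge leaves \<open>X\<close>, the tour never changes sides.\<close>

lemma empty_cut_trivial:
  assumes X: "cut (edges G) X = {}" and e: "e \<in> edges G" "e \<subseteq> X" and f: "f \<in> edges G"
  shows "f \<subseteq> X"
proof (rule ccontr)
  assume "\<not> f \<subseteq> X"
  then have fX: "f \<subseteq> - X" using X f by (auto simp: cut_def)
  have fin: "finite (cut (edges G) X)" using X by simp
  obtain t where t: "\<gamma> t = Pt (midpoint e)" using \<gamma>_surj[OF e(1) midpoint_inner[OF graph e(1)]] by metis
  obtain u where u: "\<gamma> u = Pt (midpoint f)" using \<gamma>_surj[OF f midpoint_inner[OF graph f]] by metis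
  have tX: "\<gamma> t \<in> side G X" using inside_edge_in_side[OF graph e midpoint_inner[OF graph e(1)]] t by simp
  have "\<gamma> u \<in> side G (- X)" using inside_edge_in_side[OF graph f fX midpoint_inner[OF graph f]] u by simp
  then have uX: "\<gamma> u \<notin> side G X" using sides_disjoint[OF graph fin] by blast
  have "(\<gamma> (min t u) \<in> side G X) = (\<gamma> (max t u) \<in> side G X) \<longleftrightarrow> even (card ({} :: real set))"
  proof (rule parity_of_crossings)
    fix s assume "s \<in> {min t u..max t u} - {}"
    have "\<forall>e\<in>cut (edges G) X. \<gamma> s \<noteq> Pt (midpoint e)" using X by simp
    from side_locally_constant[OF fin this]
    show "\<exists>\<delta>>0. \<forall>t'\<in>{min t u..max t u}. \<bar>t' - s\<bar> < \<delta> \<longrightarrow> (\<gamma> t' \<in> side G X) = (\<gamma> s \<in> side G X)" by blast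
  qed simp_all
  then show False using tX uX by (cases "t \<le> u") (simp_all add: min_def max_def)
qed

end

section \<open>Closed trails in edge sets with even cuts\<close>

text \<open>Infinite cuts are not restricted; their cardinality would be 0 by convention.\<close>

definition even_cuts :: "'v set set \<Rightarrow> bool" where
  "even_cuts E \<longleftrightarrow> (\<forall>X. finite (cut E X) \<longrightarrow> even (card (cut E X)))"

definition pairs :: "'v set set \<Rightarrow> bool" where
  "pairs E \<longleftrightarrow> (\<forall>e\<in>E. \<exists>x y. x \<noteq> y \<and> e = {x, y})"

lemma pairsE:
  assumes "pairs E" "e \<in> E"
  obtains x y where "x \<noteq> y" "e = {x, y}"
proof -
  have "\<exists>x y. x \<noteq> y \<and> e = {x, y}" using assms unfolding pairs_def by (rule bspec)
  then show ?thesis using that by (elim exE conjE)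
qed

lemma pairs_otherE:
  assumes "pairs E" "e \<in> E" "x \<in> e"
  obtains y where "x \<noteq> y" "e = {x, y}"
proof -
  obtain a b where ab: "a \<noteq> b" "e = {a, b}" using pairsE[OF assms(1,2)] .
  then have "x = a \<or> x = b" using assms(3) by simp
  then show ?thesis using that[of a] that[of b] ab by (auto simp: insert_commute)
qed

lemma pairs_subset: "pairs E \<Longrightarrow> E' \<subseteq> E \<Longrightarrow> pairs E'"
  unfolding pairs_def by (rule ballI) (erule bspec, erule subsetD)

definition dart_edge :: "'v \<times> 'v \<Rightarrow> 'v set" where
  "dart_edge d = {fst d, snd d}"

fun walk :: "'v \<Rightarrow> ('v \<times> 'v) list \<Rightarrow> 'v \<Rightarrow> bool" where
  "walk x [] y \<longleftrightarrow> x = y"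
| "walk x (d # ds) y \<longleftrightarrow> fst d = x \<and> walk (snd d) ds y"

definition used :: "('v \<times> 'v) list \<Rightarrow> 'v set set" where
  "used ds = dart_edge ` set ds"

lemma used_simps [simp]:
  "used [] = {}" "used (d # ds) = insert (dart_edge d) (used ds)"
  "used (as @ bs) = used as \<union> used bs" "finite (used ds)"
  by (auto simp: used_def)

definition trail :: "'v set set \<Rightarrow> 'v \<Rightarrow> ('v \<times> 'v) list \<Rightarrow> 'v \<Rightarrow> bool" where
  "trail E x ds y \<longleftrightarrow>
     walk x ds y \<and> distinct (map dart_edge ds) \<and> used ds \<subseteq> E"

lemma walk_append: "walk x (as @ bs) z \<longleftrightarrow> (\<exists>y. walk x as y \<and> walk y bs z)"
  by (induction as arbitrary: x) auto

lemma trail_Nil [simp]: "trail E x [] y \<longleftrightarrow> x = y"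
  by (auto simp: trail_def)

lemma trail_Cons:
  "trail E x (d # ds) y \<longleftrightarrow>
     fst d = x \<and> dart_edge d \<in> E \<and> trail (E - {dart_edge d}) (snd d) ds y"
  by (auto simp: trail_def used_def)

lemma trail_append:
  "trail E x (as @ bs) z \<longleftrightarrow>
     (\<exists>y. trail E x as y \<and> trail (E - used as) y bs z)"
proof -
  have *: "A \<union> B \<subseteq> E \<and> A \<inter> B = {} \<longleftrightarrow> A \<subseteq> E \<and> B \<subseteq> E - A" for A B :: "'a set set"
    by blast
  show ?thesis
    unfolding trail_def walk_append map_append distinct_append used_simps set_map used_def[symmetric]
    using *[of "used as" "used bs"] by metis
qed

lemma trail_Diff:
  assumes "trail E x ds y" "used ds \<inter> A = {}"
  shows "trail (E - A) x ds y"
  using assms unfolding trail_def by blast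

lemma trail_mono: "trail E x ds y \<Longrightarrow> E \<subseteq> E' \<Longrightarrow> trail E' x ds y"
  by (auto simp: trail_def)

lemma walk_parity:
  assumes "walk x ds y"
  shows "even (length (filter (\<lambda>d. (fst d \<in> X) \<noteq> (snd d \<in> X)) ds)) \<longleftrightarrow> (x \<in> X \<longleftrightarrow> y \<in> X)"
  using assms by (induction ds arbitrary: x) auto

lemma even_cut_closed_trail:
  assumes "trail E x ds x"
  shows "even (card (cut (used ds) X))"
proof -
  let ?ds = "filter (\<lambda>d. (fst d \<in> X) \<noteq> (snd d \<in> X)) ds"
  have "cut (used ds) X = dart_edge ` set ?ds"
    by (auto simp: cut_def used_def dart_edge_def)
  also have "\<dots> = set (map dart_edge ?ds)" by simp
  finally have "card (cut (used ds) X) = length ?ds"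
    using assms by (simp add: trail_def distinct_card distinct_map_filter del: set_map)
  then show ?thesis
    using walk_parity[of x ds x X] assms by (simp add: trail_def)
qed

text \<open>A closed trail meets every cut evenly, and it meets a cut in finitely many edges, so that
  finite cuts of the remaining edges come from finite cuts of \<open>E\<close>.\<close>

lemma even_cuts_minus_closed_trail:
  assumes "even_cuts E" "trail E x ds x"
  shows "even_cuts (E - used ds)"
  unfolding even_cuts_def
proof (intro allI impI)
  fix X assume fin: "finite (cut (E - used ds) X)"
  let ?T = "used ds"
  have eq: "cut E X = cut (E - ?T) X \<union> cut ?T X" "cut (E - ?T) X \<inter> cut ?T X = {}"
    using assms(2) by (auto simp: cut_def trail_def)
  have finT: "finite (cut ?T X)" by (auto simp: cut_def)
  have "card (cut E X) = card (cut (E - ?T) X) + card (cut ?T X)"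
    using eq fin finT by (simp add: card_Un_disjoint)
  moreover have "even (card (cut E X))"
  proof -
    have "finite (cut E X)" using fin finT eq(1) by simp
    then show ?thesis using assms(1) by (simp add: even_cuts_def)
  qed
  ultimately show "even (card (cut (E - ?T) X))"
    using even_cut_closed_trail[OF assms(2), of X] by simp
qed

definition adj :: "'v set set \<Rightarrow> ('v \<times> 'v) set" where
  "adj E = {(x, y). {x, y} \<in> E}"

lemma walk_to_visited:
  assumes "walk x ds y" "z = x \<or> (\<exists>d\<in>set ds. z \<in> dart_edge d)"
  shows "\<exists>as bs. ds = as @ bs \<and> walk x as z \<and> walk z bs y"
  using assms
proof (induction ds arbitrary: x)
  case (Cons d ds)
  show ?case
  proof (cases "z = x")
    case True
    then show ?thesis using Cons.prems(1) by (intro exI[of _ "[]"] exI[of _ "d # ds"]) simp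
  next
    case False
    then have "z = snd d \<or> (\<exists>d\<in>set ds. z \<in> dart_edge d)" using Cons.prems by (auto simp: dart_edge_def)
    moreover have "walk (snd d) ds y" using Cons.prems(1) by simp
    ultimately have "\<exists>as bs. ds = as @ bs \<and> walk (snd d) as z \<and> walk z bs y"
      by (intro Cons.IH)
    then obtain as bs where "ds = as @ bs" "walk (snd d) as z" "walk z bs y" by blast
    then show ?thesis using Cons.prems(1)
      by (intro exI[of _ "d # as"] exI[of _ bs]) simp
  qed
qed auto

text \<open>The first visit to \<open>z\<close> splits the trail.\<close>

lemma trail_to_visited:
  assumes "trail E x ds y" "z = x \<or> (\<exists>d\<in>set ds. z \<in> dart_edge d)"
  shows "\<exists>as bs. ds = as @ bs \<and> trail E x as z \<and> trail (E - used as) z bs y"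
proof -
  obtain as bs where ab: "ds = as @ bs" "walk x as z" "walk z bs y"
    using walk_to_visited[OF _ assms(2)] assms(1) unfolding trail_def by metis
  have "trail E x as z" "trail (E - used as) z bs y"
    using ab assms(1) by (auto simp: trail_def used_def)
  then show ?thesis using ab(1) by blast
qed

text \<open>Extending a trail by an edge that it already uses is replaced by cutting it off at the new
  vertex, which it has visited.\<close>

lemma trail_if_reachable:
  assumes "(x, y) \<in> (adj E)\<^sup>*"
  shows "\<exists>ds. trail E x ds y"
  using assms
proof induction
  case base
  show ?case by (rule exI[of _ "[]"]) simp
next
  case (step y z)
  then obtain ds where ds: "trail E x ds y" by blast
  have yz: "{y, z} \<in> E" using step by (simp add: adj_def)
  show ?case
  proof (cases "{y, z} \<in> used ds")
    case True
    then have "\<exists>d\<in>set ds. z \<in> dart_edge d" by (force simp: used_def dart_edge_def)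
    then show ?thesis using trail_to_visited[OF ds] by blast
  next
    case False
    then have "trail (E - used ds) y [(y, z)] z"
      using yz by (simp add: trail_Cons dart_edge_def)
    then have "trail E x (ds @ [(y, z)]) z"
      using ds unfolding trail_append by blast
    then show ?thesis by blast
  qed
qed

text \<open>A set of edges with even cuts has no bridge: if \<open>u\<close> could not be reached from \<open>w\<close> without the
  edge \<open>{u, w}\<close>, then this edge alone would be the cut around the vertices reachable from \<open>w\<close>.\<close>

lemma closed_trail_through_edge:
  assumes E: "even_cuts E" and two: "pairs E" and uw: "{u, w} \<in> E"
  shows "\<exists>ds. trail E u ((u, w) # ds) u"
proof -
  let ?E = "E - {{u, w}}"
  define X where "X = {x. (w, x) \<in> (adj ?E)\<^sup>*}"
  have "u \<in> X"
  proof (rule ccontr)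
    assume u: "u \<notin> X"
    have w: "w \<in> X" by (simp add: X_def)
    have closed: "y \<in> X" if "x \<in> X" "{x, y} \<in> ?E" for x y
      using that by (auto simp: X_def adj_def intro: rtrancl_into_rtrancl)
    have "cut E X = {{u, w}}"
    proof (intro subset_antisym subsetI)
      fix e assume e: "e \<in> cut E X"
      then obtain x y where x: "x \<in> X" "x \<in> e" and y: "y \<notin> X" "y \<in> e" and "e \<in> E"
        unfolding cut_def by auto
      obtain y' where "x \<noteq> y'" "e = {x, y'}" using pairs_otherE[OF two \<open>e \<in> E\<close> x(2)] .
      with x y have xy: "e = {x, y}" "x \<in> X" "y \<notin> X" by auto
      show "e \<in> {{u, w}}"
        using closed[OF xy(2), of y] xy \<open>e \<in> E\<close> by auto
    qed (use u w uw in \<open>auto simp: cut_def\<close>)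
    then show False using E by (metis card_1_singleton_iff even_cuts_def finite.emptyI finite_insert is_singletonI odd_one One_nat_def)
  qed
  then have "(w, u) \<in> (adj ?E)\<^sup>*" by (simp add: X_def)
  from trail_if_reachable[OF this] obtain ds where "trail ?E w ds u" by blast
  then have "trail E u ((u, w) # ds) u" using uw by (simp add: trail_Cons dart_edge_def)
  then show ?thesis by blast
qed

lemma splice_closed_trail:
  assumes "trail E v ds v" "z = v \<or> (\<exists>d\<in>set ds. z \<in> dart_edge d)"
    and "trail (E - used ds) z cs z"
  shows "\<exists>ds'. trail E v ds' v \<and> set ds' = set ds \<union> set cs"
proof -
  obtain as bs where ab: "ds = as @ bs" "trail E v as z" "trail (E - used as) z bs v"
    using trail_to_visited[OF assms(1,2)] by auto
  have "trail (E - used as) z cs z"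
    by (rule trail_mono[OF assms(3)]) (use ab(1) in auto)
  moreover have "used bs \<inter> used cs = {}"
    using assms(3) ab(1) by (auto simp: trail_def)
  then have "trail (E - used as - used cs) z bs v"
    by (rule trail_Diff[OF ab(3)])
  ultimately have "trail E v (as @ cs @ bs) v"
    using ab(2) unfolding trail_append by blast
  moreover have "set (as @ cs @ bs) = set ds \<union> set cs" using ab by auto
  ultimately show ?thesis by blast
qed

text \<open>A closed trail that visits \<open>y\<close> is extended along an unused edge at \<open>y\<close> by splicing in, at \<open>y\<close>, a
  closed trail through this edge in the set of unused edges, which again has even cuts.\<close>

lemma closed_trail_visiting:
  assumes E: "even_cuts E" and two: "pairs E"
    and u: "(v, u) \<in> (adj E)\<^sup>*"
  shows "\<exists>ds. trail E v ds v \<and> (u = v \<or> (\<exists>d\<in>set ds. u \<in> dart_edge d))"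
  using u
proof induction
  case base
  show ?case by (rule exI[of _ "[]"]) simp
next
  case (step y z)
  then obtain ds where ds: "trail E v ds v" "y = v \<or> (\<exists>d\<in>set ds. y \<in> dart_edge d)" by blast
  have yz: "{y, z} \<in> E" using step by (simp add: adj_def)
  show ?case
  proof (cases "{y, z} \<in> used ds")
    case True
    then have "\<exists>d\<in>set ds. z \<in> dart_edge d" by (force simp: used_def dart_edge_def)
    then show ?thesis using ds(1) by blast
  next
    case False
    have "\<exists>cs. trail (E - used ds) y ((y, z) # cs) y"
      by (rule closed_trail_through_edge[OF even_cuts_minus_closed_trail[OF E ds(1)]])
        (use pairs_subset[OF two] False yz in auto)
    then obtain cs where "trail (E - used ds) y ((y, z) # cs) y" by blast
    from splice_closed_trail[OF ds this] obtain ds'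
      where "trail E v ds' v" "set ds' = set ds \<union> set ((y, z) # cs)" by blast
    moreover from this have "\<exists>d\<in>set ds'. z \<in> dart_edge d" by (auto simp: dart_edge_def)
    ultimately show ?thesis by blast
  qed
qed


section \<open>Inserting closed trails\<close>

text \<open>Connection of two edges by a chain of edges in \<open>E\<close>, each incident with the next; this is
  connectedness in the line graph.\<close>

definition link :: "'v set set \<Rightarrow> 'v set \<Rightarrow> 'v set \<Rightarrow> bool" where
  "link E e f \<longleftrightarrow> e \<in> E \<and> f \<in> E \<and> (e, f) \<in> {(e, f). e \<in> E \<and> f \<in> E \<and> e \<inter> f \<noteq> {}}\<^sup>*"

lemma link_refl: "e \<in> E \<Longrightarrow> link E e e"
  by (simp add: link_def)

lemma link_sym: "link E e f \<Longrightarrow> link E f e"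
proof -
  have "sym {(e, f). e \<in> E \<and> f \<in> E \<and> e \<inter> f \<noteq> {}}" by (auto simp: sym_def)
  then show "link E e f \<Longrightarrow> link E f e" unfolding link_def by (meson symE sym_rtrancl)
qed

lemma link_trans: "link E e f \<Longrightarrow> link E f g \<Longrightarrow> link E e g"
  by (auto simp: link_def)

lemma link_in: "link E e f \<Longrightarrow> e \<in> E" "link E e f \<Longrightarrow> f \<in> E"
  by (auto simp: link_def)

lemma link_touch: "e \<in> E \<Longrightarrow> f \<in> E \<Longrightarrow> x \<in> e \<Longrightarrow> x \<in> f \<Longrightarrow> link E e f"
  by (auto simp: link_def)

lemma link_induct [consumes 1, case_names refl step]:
  assumes "link E e f" "P e"
    and "\<And>f g x. link E e f \<Longrightarrow> P f \<Longrightarrow> g \<in> E \<Longrightarrow> x \<in> f \<Longrightarrow> x \<in> g \<Longrightarrow> P g"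
  shows "P f"
proof -
  have "(e, f) \<in> {(e, f). e \<in> E \<and> f \<in> E \<and> e \<inter> f \<noteq> {}}\<^sup>*" using assms(1) by (simp add: link_def)
  then show ?thesis
  proof induction
    case (step f g)
    then have "link E e f" using assms(1) by (simp add: link_def)
    with step assms(3) show ?case by blast
  qed (rule assms(2))
qed

lemma link_mono:
  assumes "link E e f" "E \<subseteq> E'"
  shows "link E' e f"
  using assms(1)
proof (induction rule: link_induct)
  case refl
  show ?case using assms by (intro link_refl) (auto dest: link_in)
next
  case (step f g x)
  have "link E' f g"
    using step assms(2) link_in(2)[OF step(1)] by (intro link_touch[of _ _ _ x]) auto
  with step show ?case by (blast intro: link_trans)
qed

lemma reachable_if_link:
  assumes "link E e f" "v \<in> e" and two: "pairs E" and "x \<in> f"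
  shows "(v, x) \<in> (adj E)\<^sup>*"
proof -
  have edge: "(a, b) \<in> (adj E)\<^sup>*" if g: "g \<in> E" "a \<in> g" "b \<in> g" for a b g
  proof (cases "a = b")
    case False
    obtain y where "g = {a, y}" using pairs_otherE[OF two g(1,2)] .
    then have "g = {a, b}" using g(3) False by auto
    then have "(a, b) \<in> adj E" using g(1) by (simp add: adj_def)
    then show ?thesis by (rule r_into_rtrancl)
  qed simp
  from assms(1) have "\<forall>x\<in>f. (v, x) \<in> (adj E)\<^sup>*"
  proof (induction rule: link_induct)
    case refl
    show ?case using edge[OF link_in(1)[OF assms(1)] assms(2)] by simp
  next
    case (step f g y)
    then show ?case using edge[of g y] by (meson rtrancl_trans)
  qed
  then show ?thesis using assms(4) by blast
qed

lemma closed_trail_containing: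
  assumes E: "even_cuts E" and two: "pairs E"
    and "link E f e" "v \<in> f"
  shows "\<exists>ds. trail E v ds v \<and> e \<in> used ds"
proof -
  obtain u w where uw: "e = {u, w}" using pairsE[OF two link_in(2)[OF assms(3)]] .
  have "(v, u) \<in> (adj E)\<^sup>*" by (rule reachable_if_link[OF assms(3,4) two]) (simp add: uw)
  from closed_trail_visiting[OF E two this] obtain ds
    where ds: "trail E v ds v" "u = v \<or> (\<exists>d\<in>set ds. u \<in> dart_edge d)" by blast
  show ?thesis
  proof (cases "e \<in> used ds")
    case True
    then show ?thesis using ds by blast
  next
    case False
    have "\<exists>cs. trail (E - used ds) u ((u, w) # cs) u"
      by (rule closed_trail_through_edge[OF even_cuts_minus_closed_trail[OF E ds(1)]])
        (use pairs_subset[OF two] False uw link_in(2)[OF assms(3)] in auto)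
    then obtain cs where "trail (E - used ds) u ((u, w) # cs) u" by blast
    from splice_closed_trail[OF ds this] obtain ds'
      where "trail E v ds' v" "set ds' = set ds \<union> set ((u, w) # cs)" by blast
    moreover from this have "e \<in> used ds'" by (auto simp: used_def dart_edge_def uw)
    ultimately show ?thesis by blast
  qed
qed

lemma trail_linked:
  assumes "trail E v ds y" "v \<in> f" "f \<in> E" "d \<in> set ds"
  shows "link E f (dart_edge d)"
  using assms
proof (induction ds arbitrary: v f)
  case (Cons c ds)
  have c: "dart_edge c \<in> E" "fst c = v" "trail E (snd c) ds y"
    using Cons.prems(1) trail_mono[of "E - {dart_edge c}"] by (auto simp: trail_Cons)
  have fc: "link E f (dart_edge c)"
    using c Cons.prems by (intro link_touch[of _ _ _ v]) (auto simp: dart_edge_def)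
  show ?case
  proof (cases "d = c")
    case False
    then have "link E (dart_edge c) (dart_edge d)"
      using Cons.prems c by (intro Cons.IH[OF c(3)]) (auto simp: dart_edge_def)
    then show ?thesis using fc link_trans by blast
  qed (use fc in simp)
qed simp

lemma walk_vertex_cases:
  assumes "walk v ds y" "d \<in> set ds" "x \<in> dart_edge d"
  shows "x = v \<or> x = y \<or> x \<in> snd ` set (butlast ds)"
  using assms
proof (induction ds arbitrary: v)
  case (Cons c ds)
  show ?case
  proof (cases "d = c")
    case True
    then show ?thesis using Cons.prems by (cases ds) (auto simp: dart_edge_def)
  next
    case False
    then have "d \<in> set ds" using Cons.prems by simp
    moreover from this have "ds \<noteq> []" by auto
    moreover have "walk (snd c) ds y" using Cons.prems(1) by simp
    ultimately have "x = snd c \<or> x = y \<or> x \<in> snd ` set (butlast ds)"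
      using Cons.IH Cons.prems(3) by simp
    then show ?thesis using \<open>ds \<noteq> []\<close> by (elim disjE) simp_all
  qed
qed simp

text \<open>A chain from \<open>u\<close> to a member of \<open>T\<close> avoids \<open>T\<close> up to its first contact with it.\<close>

lemma link_to_first_contact:
  assumes "link E u e" "e \<in> T" "u \<notin> T"
  shows "\<exists>f t. link (E - T) u f \<and> t \<in> T \<and> f \<inter> t \<noteq> {}"
proof -
  from assms(1) have "link (E - T) u e \<or> (\<exists>f t. link (E - T) u f \<and> t \<in> T \<and> f \<inter> t \<noteq> {})"
  proof (induction rule: link_induct)
    case refl
    have "u \<in> E - T" using assms(3) link_in(1)[OF assms(1)] by simp
    then show ?case by (blast intro: link_refl)
  next
    case (step f g x)
    show ?case
    proof (cases "link (E - T) u f \<and> g \<notin> T")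
      case True
      then have "link (E - T) f g"
        using step link_in(2)[of "E - T" u f] by (intro link_touch[of _ _ _ x]) auto
      then show ?thesis using True link_trans by blast
    next
      case False
      then show ?thesis using step by blast
    qed
  qed
  then show ?thesis using assms(2) link_in(2)[of "E - T" u e] by blast
qed

text \<open>A component of the remaining edges touches the closed trail \<open>T\<close> at some vertex; the point is that
  it touches it at an inner vertex. Only the vertex \<open>v\<close> where \<open>T\<close> begins and ends can fail to be
  inner. If there is an unused edge at \<open>v\<close>, another closed trail through that edge is appended, which makes \<open>v\<close>
  inner; otherwise no remaining component touches \<open>T\<close> at \<open>v\<close>.\<close>

lemma closed_trail_with_inner_contacts:
  assumes E: "even_cuts E" and two: "pairs E"
    and fe: "link E f e" and v: "v \<in> f"
  shows "\<exists>T. trail E v T v \<and> e \<in> used T \<and>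
    (\<forall>u \<in> E - used T. link E f u \<longrightarrow>
       (\<exists>d\<in>set (butlast T). \<exists>h. link (E - used T) u h \<and> snd d \<in> h))"
proof -
  obtain T0 where T0: "trail E v T0 v" "e \<in> used T0"
    using closed_trail_containing[OF assms] by (elim exE conjE)
  have "\<exists>T. trail E v T v \<and> set T0 \<subseteq> set T \<and>
    (v \<in> snd ` set (butlast T) \<or> (\<forall>h\<in>E - used T. v \<notin> h))"
  proof (cases "\<forall>h\<in>E - used T0. v \<notin> h")
    case True
    then show ?thesis using T0 by blast
  next
    case False
    then obtain w where w: "{v, w} \<in> E - used T0"
      by (metis DiffD1 pairs_otherE[OF two])
    have "\<exists>cs. trail (E - used T0) v ((v, w) # cs) v"
      by (rule closed_trail_through_edge[OF even_cuts_minus_closed_trail[OF E T0(1)]])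
        (use pairs_subset[OF two] w in auto)
    then obtain cs where cs: "trail (E - used T0) v ((v, w) # cs) v" by blast
    have "trail E v (T0 @ (v, w) # cs) v"
      using T0(1) cs unfolding trail_append by blast
    moreover have ne: "T0 \<noteq> []" using T0(2) by auto
    have "snd (last T0) = v"
    proof -
      have "walk x ds y \<Longrightarrow> ds \<noteq> [] \<Longrightarrow> snd (last ds) = y" for x y :: 'a and ds
        by (induction ds arbitrary: x) auto
      then show ?thesis using T0(1) ne by (auto simp: trail_def)
    qed
    then have "v \<in> snd ` set (butlast (T0 @ (v, w) # cs))"
      using ne by (auto simp: butlast_append intro!: image_eqI[of _ _ "last T0"])
    ultimately show ?thesis by (metis Un_upper1 set_append)
  qed
  then obtain T where T: "trail E v T v" "set T0 \<subseteq> set T"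
    "v \<in> snd ` set (butlast T) \<or> (\<forall>h\<in>E - used T. v \<notin> h)" by blast
  have eT: "e \<in> used T" using T(2) T0(2) by (auto simp: used_def)
  have "\<exists>d\<in>set (butlast T). \<exists>h. link (E - used T) u h \<and> snd d \<in> h"
    if u: "u \<in> E - used T" "link E f u" for u
  proof -
    have "link E u e" using fe u(2) link_sym link_trans by blast
    from link_to_first_contact[OF this eT] u(1) obtain h t x
      where h: "link (E - used T) u h" "t \<in> used T" "x \<in> h" "x \<in> t"
      by blast
    have "x = v \<or> x \<in> snd ` set (butlast T)"
      using walk_vertex_cases[of v T v] T(1) h(2,4) by (auto simp: trail_def used_def)
    then have "x \<in> snd ` set (butlast T)"
      using T(3) h link_in(2) by metis
    then show ?thesis using h by blast
  qed
  with T(1) eT show ?thesis by (intro exI[of _ T]) simp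
qed

text \<open>Two components that touch \<open>T\<close> at the same vertex coincide. So choosing for each component a dart of
  \<open>T\<close> that ends at a contact vertex assigns different darts to different components.\<close>

lemma closed_trail_with_gaps:
  assumes E: "even_cuts E" and two: "pairs E"
    and fe: "link E f e" and v: "v \<in> f"
  shows "\<exists>T g. trail E v T v \<and> e \<in> used T \<and>
    (\<forall>u \<in> E - used T. link E f u \<longrightarrow> g u \<in> set (butlast T) \<and>
       (\<exists>h. link (E - used T) u h \<and> snd (g u) \<in> h)) \<and>
    (\<forall>u \<in> E - used T. \<forall>w \<in> E - used T. link E f u \<longrightarrow> link E f w \<longrightarrow>
       (g u = g w \<longleftrightarrow> link (E - used T) u w))"
proof -
  from closed_trail_with_inner_contacts[OF assms] obtain T
    where T: "trail E v T v \<and> e \<in> used T \<and>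
      (\<forall>u \<in> E - used T. link E f u \<longrightarrow>
        (\<exists>d\<in>set (butlast T). \<exists>h. link (E - used T) u h \<and> snd d \<in> h))" ..
  define R where "R = E - used T"
  \<comment> \<open>The condition depends only on the component of \<open>u\<close>, hence so does the choice.\<close>
  define g where "g u = (SOME d. d \<in> set (butlast T) \<and> (\<exists>h. link R u h \<and> snd d \<in> h))" for u
  have g: "g u \<in> set (butlast T) \<and> (\<exists>h. link R u h \<and> snd (g u) \<in> h)"
    if "u \<in> R" "link E f u" for u
  proof -
    have "\<exists>d\<in>set (butlast T). \<exists>h. link R u h \<and> snd d \<in> h"
      using T[THEN conjunct2, THEN conjunct2] that unfolding R_def by (elim ballE impE) auto
    then have "\<exists>d. d \<in> set (butlast T) \<and> (\<exists>h. link R u h \<and> snd d \<in> h)" by (simp only: Bex_def)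
    then show ?thesis unfolding g_def by (rule someI_ex)
  qed
  have "g u = g w \<longleftrightarrow> link R u w" if uw: "u \<in> R" "w \<in> R" "link E f u" "link E f w" for u w
  proof
    assume "g u = g w"
    then obtain h k where "link R u h" "link R w k" "snd (g u) \<in> h" "snd (g u) \<in> k"
      using g uw by metis
    moreover from this have "link R h k" by (meson link_in(2) link_touch)
    ultimately show "link R u w" by (meson link_sym link_trans)
  next
    assume "link R u w"
    then have "link R u h \<longleftrightarrow> link R w h" for h by (meson link_sym link_trans)
    then show "g u = g w" unfolding g_def by simp
  qed
  with T g show ?thesis unfolding R_def by (intro exI[of _ T] exI[of _ g]) simp
qed

text \<open>The closed trail \<open>D\<close> is the part of the tour built so far. The map \<open>g\<close> sends an unused edge to the
  dart after which its component has to be inserted. As the value is a dart and not an index, it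
  stays valid when other closed trails are inserted. It is never the last dart, so the
  first and the last edge of the trail remain the same throughout.\<close>

definition tour_state :: "'v set set \<Rightarrow> 'v \<Rightarrow> ('v \<times> 'v) list \<Rightarrow> ('v set \<Rightarrow> 'v \<times> 'v) \<Rightarrow> bool" where
  "tour_state E v D g \<longleftrightarrow> trail E v D v \<and> D \<noteq> [] \<and>
     (\<forall>u \<in> E - used D. g u \<in> set (butlast D) \<and>
        (\<exists>h. link (E - used D) u h \<and> snd (g u) \<in> h)) \<and>
     (\<forall>u \<in> E - used D. \<forall>w \<in> E - used D.
        g u = g w \<longleftrightarrow> link (E - used D) u w)"

lemma tour_state_initial:
  assumes "even_cuts E" "pairs E"
    and conn: "\<forall>e\<in>E. \<forall>f\<in>E. link E e f" and "e \<in> E"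
  shows "\<exists>v D g. tour_state E v D g"
proof -
  obtain v where "v \<in> e" using pairsE[OF assms(2,4)] by blast
  from closed_trail_with_gaps[OF assms(1,2) link_refl[OF assms(4)] this]
  obtain T g where T: "trail E v T v \<and> e \<in> used T \<and>
    (\<forall>u \<in> E - used T. link E e u \<longrightarrow> g u \<in> set (butlast T) \<and>
       (\<exists>h. link (E - used T) u h \<and> snd (g u) \<in> h)) \<and>
    (\<forall>u \<in> E - used T. \<forall>w \<in> E - used T. link E e u \<longrightarrow> link E e w \<longrightarrow>
       (g u = g w \<longleftrightarrow> link (E - used T) u w))" by (elim exE)
  moreover have "link E e u" if "u \<in> E - used T" for u
    using conn assms(4) that by simp
  ultimately have "tour_state E v T g" unfolding tour_state_def by auto
  then show ?thesis by blast
qed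

text \<open>Deleting edges of one component does not affect the others.\<close>

lemma link_Diff_other:
  assumes "link E u w" "\<not> link E f u" "\<forall>t\<in>T. link E f t"
  shows "link (E - T) u w"
  using assms(1)
proof (induction rule: link_induct)
  case refl
  then show ?case using assms by (intro link_refl) (auto dest: link_in)
next
  case (step h g x)
  then have "link E u g" by (meson link_in(2) link_touch link_trans)
  then have "g \<notin> T" using assms(2,3) by (meson link_sym link_trans)
  then show ?case using step by (meson DiffI link_in(2) link_touch link_trans)
qed

text \<open>The component of \<open>u0\<close> is broken up by a closed trail \<open>T\<close> through \<open>u0\<close>, inserted after its dart. The
  pieces get darts of \<open>T\<close> other than the last one, and other components keep theirs. So no component
  is assigned to \<open>g u0\<close> or to the last dart of \<open>T\<close> any more.\<close>

lemma tour_state_step: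
  assumes st: "tour_state E v D g" and E: "even_cuts E"
    and two: "pairs E"
    and u0: "u0 \<in> E - used D"
  shows "\<exists>D1 D2 T g'. D = D1 @ g u0 # D2 \<and> D2 \<noteq> [] \<and> tour_state E v (D1 @ g u0 # T @ D2) g' \<and>
    u0 \<in> used T \<and>
    used T \<subseteq> {u \<in> E - used D. g u = g u0} \<and>
    (\<forall>u \<in> E - used D. g u \<noteq> g u0 \<longrightarrow> g' u = g u) \<and>
    (\<forall>u \<in> E - used D - used T. g u = g u0 \<longrightarrow> g' u \<in> set (butlast T))"
proof -
  define d where "d = g u0"
  define E' where "E' = E - used D"
  have trD: "trail E v D v" and gE': "\<And>u. u \<in> E' \<Longrightarrow> g u \<in> set (butlast D)"
    "\<And>u. u \<in> E' \<Longrightarrow> \<exists>h. link E' u h \<and> snd (g u) \<in> h"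
    and glink: "\<And>u w. u \<in> E' \<Longrightarrow> w \<in> E' \<Longrightarrow> g u = g w \<longleftrightarrow> link E' u w"
    using st unfolding tour_state_def E'_def by blast+
  have u0': "u0 \<in> E'" using u0 by (simp add: E'_def)
  obtain D1 D2' where "butlast D = D1 @ d # D2'"
    using split_list gE'(1)[OF u0'] unfolding d_def by metis
  moreover have "D \<noteq> []" using st by (simp add: tour_state_def)
  ultimately have D: "D = D1 @ d # (D2' @ [last D])"
    by (metis append_Cons append_assoc append_butlast_last_id)
  define D2 where "D2 = D2' @ [last D]"
  note D = D[folded D2_def]
  have D2: "D2 \<noteq> []" by (simp add: D2_def)
  obtain f where f: "link E' u0 f" "snd d \<in> f" using gE'(2)[OF u0'] unfolding d_def by blast
  have E': "even_cuts E'" unfolding E'_def by (rule even_cuts_minus_closed_trail[OF E trD])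
  have two': "pairs E'" using pairs_subset[OF two] by (auto simp: E'_def)
  obtain T h where T: "trail E' (snd d) T (snd d)" "u0 \<in> used T"
    and h: "\<And>u. u \<in> E' - used T \<Longrightarrow> link E' f u \<Longrightarrow> h u \<in> set (butlast T) \<and>
       (\<exists>k. link (E' - used T) u k \<and> snd (h u) \<in> k)"
    and hl: "\<And>u w. u \<in> E' - used T \<Longrightarrow> w \<in> E' - used T \<Longrightarrow>
       link E' f u \<Longrightarrow> link E' f w \<Longrightarrow> h u = h w \<longleftrightarrow> link (E' - used T) u w"
    using closed_trail_with_gaps[OF E' two' link_sym[OF f(1)] f(2)] by metis
  define R where "R = E' - used T"
  define g' where "g' u = (if g u = d then h u else g u)" for u
  have K: "g u = d \<longleftrightarrow> link E' f u" if "u \<in> E'" for u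
    using glink[OF that u0'] f(1) link_sym link_trans unfolding d_def by metis
  have TK: "link E' f t" if "t \<in> used T" for t
    using trail_linked[OF T(1) f(2)] link_in(2)[OF f(1)] that by (auto simp: used_def)
  have TE': "used T \<subseteq> E'" using T(1) by (auto simp: trail_def)
  define D' where "D' = D1 @ d # T @ D2"
  have R: "R = E - used D'" by (auto simp: R_def E'_def D'_def D)
  have trD': "trail E v D' v"
  proof -
    have "trail E v ((D1 @ [d]) @ D2) v" using trD unfolding D by simp
    then obtain y where y: "trail E v (D1 @ [d]) y" "trail (E - used (D1 @ [d])) y D2 v"
      unfolding trail_append[of E v "D1 @ [d]"] by (elim exE conjE)
    from y(1) have "y = snd d" by (auto simp: trail_append trail_Cons)
    note a = y[unfolded this]
    have "trail (E - used (D1 @ [d])) (snd d) T (snd d)"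
      by (rule trail_mono[OF T(1)]) (auto simp: E'_def D)
    moreover have "trail (E - used (D1 @ [d]) - used T) (snd d) D2 v"
      by (rule trail_Diff[OF a(2)]) (use TE' in \<open>auto simp: E'_def D\<close>)
    ultimately have "trail E v ((D1 @ [d]) @ T @ D2) v" using a(1) unfolding trail_append by blast
    then show ?thesis by (simp add: D'_def)
  qed
  have bl: "butlast D' = D1 @ d # T @ butlast D2" "butlast D = D1 @ d # butlast D2"
    using D2 by (simp_all add: D'_def D butlast_append)
  have noT: "g u \<notin> set T" if "u \<in> E'" for u
  proof
    assume "g u \<in> set T"
    then have "dart_edge (g u) \<in> used T" by (simp add: used_def)
    moreover have "dart_edge (g u) \<in> used D"
      using gE'(1)[OF that] by (auto simp: used_def dest: in_set_butlastD)
    ultimately show False using TE' by (auto simp: E'_def)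
  qed
  have RE': "u \<in> E'" if "u \<in> R" for u using that by (simp add: R_def)
  have Kf: "link E' f u" if "u \<in> R" "g u = d" for u using K[OF RE'[OF that(1)]] that(2) by simp
  have hR: "h u \<in> set (butlast T) \<and> (\<exists>k. link R u k \<and> snd (h u) \<in> k)" if "u \<in> R" "g u = d" for u
    using h[of u, folded R_def, OF that(1) Kf[OF that]] .
  have hT: "h u \<in> set T" if "u \<in> R" "g u = d" for u
    using hR[OF that] by (simp add: in_set_butlastD)
  have g'1: "g' u \<in> set (butlast D') \<and> (\<exists>k. link R u k \<and> snd (g' u) \<in> k)" if u: "u \<in> R" for u
  proof (cases "g u = d")
    case True
    then show ?thesis using hR[OF u True] hT[OF u True] by (simp add: g'_def bl)
  next
    case False
    have u': "u \<in> E'" using u by (simp add: R_def)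
    obtain k where k: "link E' u k" "snd (g u) \<in> k" using gE'(2)[OF u'] by (elim exE conjE)
    have "\<not> link E' f u" using K[OF u'] False by simp
    from link_Diff_other[OF k(1) this] TK have "link R u k" by (simp add: R_def)
    moreover have "g u \<in> set D1 \<union> set (butlast D2)" using gE'(1)[OF u'] False by (auto simp: bl)
    ultimately show ?thesis using k(2) False by (auto simp: g'_def bl)
  qed
  have g'2: "g' u = g' w \<longleftrightarrow> link R u w" if u: "u \<in> R" and w: "w \<in> R" for u w
  proof -
    have u': "u \<in> E'" and w': "w \<in> E'" using u w by (simp_all add: R_def)
    have sub: "link E' u w" if "link R u w"
      by (rule link_mono[OF that]) (auto simp: R_def)
    consider "g u = d" "g w = d" | "g u = d" "g w \<noteq> d" | "g u \<noteq> d" "g w = d" | "g u \<noteq> d" "g w \<noteq> d"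
      by blast
    then show ?thesis
    proof cases
      case 1
      then show ?thesis
        using hl[of u w, folded R_def, OF u w Kf[OF u 1(1)] Kf[OF w 1(2)]] by (simp add: g'_def)
    next
      case 2
      then have "g' u \<noteq> g' w" using hT[OF u] noT[OF w'] by (auto simp: g'_def)
      moreover have "\<not> link R u w" using sub glink[OF u' w'] 2 by auto
      ultimately show ?thesis by simp
    next
      case 3
      then have "g' u \<noteq> g' w" using hT[OF w] noT[OF u'] by (auto simp: g'_def)
      moreover have "\<not> link R u w" using sub glink[OF u' w'] 3 by auto
      ultimately show ?thesis by simp
    next
      case 4
      have "link R u w" if "link E' u w"
      proof -
        have "\<not> link E' f u" using K[OF u'] 4(1) by simp
        from link_Diff_other[OF that this] TK show ?thesis by (simp add: R_def)
      qed
      then show ?thesis using 4 sub glink[OF u' w'] by (auto simp: g'_def)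
    qed
  qed
  have "tour_state E v D' g'"
    unfolding tour_state_def R[symmetric] using trD' g'1 g'2 by (auto simp: D'_def)
  moreover have "used T \<subseteq> {u \<in> E'. g u = d}"
  proof
    fix t assume t: "t \<in> used T"
    then have "t \<in> E'" using TE' by blast
    then show "t \<in> {u \<in> E'. g u = d}" using K[of t] TK[OF t] by simp
  qed
  moreover have "\<forall>u \<in> E'. g u \<noteq> d \<longrightarrow> g' u = g u" by (simp add: g'_def)
  moreover have "\<forall>u \<in> E' - used T. g u = d \<longrightarrow> g' u \<in> set (butlast T)"
    using hR by (simp add: g'_def R_def)
  ultimately show ?thesis
    using D D2 T(2) unfolding d_def[symmetric] E'_def[symmetric] D'_def
    by (intro exI[of _ D1] exI[of _ D2] exI[of _ T] exI[of _ g'] conjI)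
qed

section \<open>The limit of the closed trails\<close>

text \<open>A linear order of the vertices, closed up by the edge between its last and first element, in
  which neighbours exist and are adjacent in \<open>H\<close>. The last assumption says that the components
  of \<open>H - F n\<close> correspond to the gaps that \<open>F n\<close> leaves in the order. It makes the ends of \<open>H\<close>
  correspond to the cuts of the order without adjacent elements, so that a circle running
  through the vertices in this order meets each end once. A third vertex is needed
  because a circle has no room for two vertices joined by a single edge.\<close>

locale circular_layout =
  fixes H :: "'a graph" and less :: "'a \<Rightarrow> 'a \<Rightarrow> bool" (infix "\<lhd>" 50)
    and bot top :: 'a and F :: "nat \<Rightarrow> 'a set"
  assumes graph: "simple_graph H"
    and countable: "countable (verts H)"
    and irrefl: "\<not> x \<lhd> x"
    and trans: "x \<lhd> y \<Longrightarrow> y \<lhd> z \<Longrightarrow> x \<lhd> z"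
    and total: "x \<in> verts H \<Longrightarrow> y \<in> verts H \<Longrightarrow> x \<noteq> y \<Longrightarrow> x \<lhd> y \<or> y \<lhd> x"
    and bot_in: "bot \<in> verts H" and bot_less: "x \<in> verts H \<Longrightarrow> x \<noteq> bot \<Longrightarrow> bot \<lhd> x"
    and top_in: "top \<in> verts H" and less_top: "x \<in> verts H \<Longrightarrow> x \<noteq> top \<Longrightarrow> x \<lhd> top"
    and successor: "x \<in> verts H \<Longrightarrow> x \<noteq> top \<Longrightarrow>
      \<exists>y\<in>verts H. x \<lhd> y \<and> (\<forall>z\<in>verts H. x \<lhd> z \<longrightarrow> y = z \<or> y \<lhd> z) \<and> {x, y} \<in> edges H"
    and predecessor: "x \<in> verts H \<Longrightarrow> x \<noteq> bot \<Longrightarrow>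
      \<exists>y\<in>verts H. y \<lhd> x \<and> (\<forall>z\<in>verts H. y \<lhd> z \<longrightarrow> x = z \<or> x \<lhd> z)"
    and closing: "{top, bot} \<in> edges H"
    and third: "\<exists>x\<in>verts H. x \<noteq> bot \<and> x \<noteq> top"
    and F_finite: "finite (F n)" and F_mono: "F n \<subseteq> F (Suc n)" and F_exhausts: "(\<Union>n. F n) = verts H"
    and gaps: "u \<in> verts H - F n \<Longrightarrow> w \<in> verts H - F n \<Longrightarrow>
      (u, w) \<in> linked (del_verts H (F n)) \<longleftrightarrow> (\<forall>x\<in>F n. x \<lhd> u \<longleftrightarrow> x \<lhd> w)"

fun precedes :: "'a list \<Rightarrow> 'a \<Rightarrow> 'a \<Rightarrow> bool" where
  "precedes [] x y \<longleftrightarrow> False"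
| "precedes (a # xs) x y \<longleftrightarrow> x = a \<and> y \<in> set xs \<or> precedes xs x y"

lemma precedes_append [simp]:
  "precedes (xs @ ys) x y \<longleftrightarrow> precedes xs x y \<or> precedes ys x y \<or> x \<in> set xs \<and> y \<in> set ys"
  by (induction xs) auto

lemma precedes_in: "precedes xs x y \<Longrightarrow> x \<in> set xs \<and> y \<in> set xs"
  by (induction xs) auto

lemma precedes_irrefl: "distinct xs \<Longrightarrow> \<not> precedes xs x x"
  by (induction xs) auto

lemma precedes_trans: "distinct xs \<Longrightarrow> precedes xs x y \<Longrightarrow> precedes xs y z \<Longrightarrow> precedes xs x z"
  by (induction xs) (auto dest: precedes_in)

lemma precedes_total: "x \<in> set xs \<Longrightarrow> y \<in> set xs \<Longrightarrow> x \<noteq> y \<Longrightarrow> precedes xs x y \<or> precedes xs y x"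
  by (induction xs) auto

lemma precedes_insert_other:
  "x \<notin> set ys \<Longrightarrow> y \<notin> set ys \<Longrightarrow> precedes (xs @ ys @ zs) x y \<longleftrightarrow> precedes (xs @ zs) x y"
  using precedes_in[of ys x y] by auto

lemma precedes_insert_new:
  assumes "distinct (xs @ a # ys @ zs)" "x \<in> set xs \<or> x = a \<or> x \<in> set zs" "y \<in> set ys"
  shows "precedes (xs @ a # ys @ zs) x y \<longleftrightarrow> x = a \<or> precedes (xs @ a # zs) x a"
proof -
  have "precedes (xs @ a # ys @ zs) x y \<longleftrightarrow> x = a \<or> x \<in> set xs"
    using assms precedes_in[of xs x y] precedes_in[of ys x y] precedes_in[of zs x y] by auto
  moreover have "precedes (xs @ a # zs) x a \<longleftrightarrow> x \<in> set xs"
    using assms precedes_in[of xs x a] precedes_in[of zs x a] by auto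
  ultimately show ?thesis by simp
qed

text \<open>The second case records what \<open>tour_state_step\<close> provides for an unused edge \<open>e\<close>.\<close>

definition tour_step ::
  "'v set set \<Rightarrow> 'v set \<Rightarrow> ('v \<times> 'v) list \<Rightarrow> ('v set \<Rightarrow> 'v \<times> 'v) \<Rightarrow>
    ('v \<times> 'v) list \<Rightarrow> ('v set \<Rightarrow> 'v \<times> 'v) \<Rightarrow> bool" where
  "tour_step E e D g D' g' \<longleftrightarrow> e \<in> used D \<and> D' = D \<and> g' = g \<or>
     (\<exists>D1 d D2 T. D = D1 @ d # D2 \<and> D2 \<noteq> [] \<and> D' = D1 @ d # T @ D2 \<and> e \<in> used T \<and>
        used T \<subseteq> {u \<in> E - used D. g u = d} \<and>
        (\<forall>u \<in> E - used D. g u \<noteq> d \<longrightarrow> g' u = g u) \<and>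
        (\<forall>u \<in> E - used D - used T. g u = d \<longrightarrow> g' u \<in> set (butlast T)))"

lemma dart_edge_in_used: "d \<in> set ds \<Longrightarrow> dart_edge d \<in> used ds"
  by (simp add: used_def)

text \<open>The enumeration \<open>e\<close> ensures that every edge is eventually used.\<close>

locale tour_sequence =
  fixes E :: "'v set set" and v :: 'v and e :: "nat \<Rightarrow> 'v set"
    and D :: "nat \<Rightarrow> ('v \<times> 'v) list" and g :: "nat \<Rightarrow> 'v set \<Rightarrow> 'v \<times> 'v"
  assumes pairs: "pairs E" and enum: "range e = E"
    and state: "tour_state E v (D n) (g n)"
    and step: "tour_step E (e n) (D n) (g n) (D (Suc n)) (g (Suc n))"
begin

abbreviation F where "F n \<equiv> used (D n)"
abbreviation W where "W n \<equiv> map dart_edge (D n)"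

definition leq where "leq n x y \<longleftrightarrow> x = y \<and> x \<in> F n \<or> precedes (W n) x y"

text \<open>The place of \<open>u\<close> at stage \<open>n\<close>: its own position if it is used already, and otherwise the position
  of the edge after which it will be inserted.\<close>

definition place where "place n u = (if u \<in> F n then u else dart_edge (g n u))"

definition less (infix "\<lhd>" 50) where "x \<lhd> y \<longleftrightarrow> (\<exists>n. precedes (W n) x y)"

lemma set_W [simp]: "dart_edge ` set (D n) = F n"
  by (simp add: used_def)

lemma trail_D: "trail E v (D n) v" and D_ne: "D n \<noteq> []"
  using state[of n] by (simp_all add: tour_state_def)

lemma distinct_W: "distinct (W n)" and F_sub: "F n \<subseteq> E"
  using trail_D[of n] by (simp_all add: trail_def)

lemma g_in: "u \<in> E - F n \<Longrightarrow> g n u \<in> set (butlast (D n))"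
  using state[of n] unfolding tour_state_def by simp

lemma g_eq: "u \<in> E - F n \<Longrightarrow> w \<in> E - F n \<Longrightarrow> g n u = g n w \<longleftrightarrow> link (E - F n) u w"
  using state[of n] unfolding tour_state_def by simp

lemma inj_D: "inj_on dart_edge (set (D n))"
  using distinct_W by (simp add: distinct_map)

lemma place_in: "u \<in> E \<Longrightarrow> place n u \<in> F n"
  using g_in[of u n] by (simp add: place_def dart_edge_in_used in_set_butlastD)

lemma F_Suc: "F n \<subseteq> F (Suc n)" and e_in: "e n \<in> F (Suc n)"
  using step[of n] by (auto simp: tour_step_def)

lemma F_mono: "n \<le> m \<Longrightarrow> F n \<subseteq> F m"
  using F_Suc by (rule lift_Suc_mono_le)

lemma exhausts: "(\<Union>n. F n) = E"
  using e_in F_sub enum by blast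

lemma in_F: assumes "u \<in> E" obtains n where "u \<in> F n"
  using assms exhausts by blast

lemma in_F_both: assumes "u \<in> E" "w \<in> E" obtains n where "u \<in> F n" "w \<in> F n"
proof -
  obtain a b where "u \<in> F a" "w \<in> F b" using in_F assms by metis
  then show ?thesis using that[of "max a b"] F_mono[of a "max a b"] F_mono[of b "max a b"] by auto
qed

text \<open>Invariance of the place: an edge that is inserted, or assigned to a new gap, gets a place
  inside the closed trail inserted immediately after its old place.\<close>

lemma leq_step:
  assumes x: "x \<in> F n" and u: "u \<in> E"
  shows "leq (Suc n) x (place (Suc n) u) \<longleftrightarrow> leq n x (place n u)"
proof -
  consider "D (Suc n) = D n" "g (Suc n) = g n"
    | D1 d D2 T where "D n = D1 @ d # D2" "D2 \<noteq> []" "D (Suc n) = D1 @ d # T @ D2"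
      "used T \<subseteq> {u \<in> E - F n. g n u = d}"
      "\<forall>u \<in> E - F n. g n u \<noteq> d \<longrightarrow> g (Suc n) u = g n u"
      "\<forall>u \<in> E - F n - used T. g n u = d \<longrightarrow> g (Suc n) u \<in> set (butlast T)"
    using step[of n] unfolding tour_step_def by auto
  then show ?thesis
  proof cases
    case 1
    then show ?thesis by (simp add: leq_def place_def)
  next
    case 2
    define a where "a = dart_edge d"
    define A T' B where "A = map dart_edge D1" and "T' = map dart_edge T" and "B = map dart_edge D2"
    have Wn: "W n = A @ a # B" and WS: "W (Suc n) = A @ a # T' @ B"
      using 2(1,3) by (simp_all add: a_def A_def T'_def B_def)
    have Fn: "F n = insert a (used D1 \<union> used D2)" and FS: "F (Suc n) = insert a (used D1 \<union> used T \<union> used D2)"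
      using 2(1,3) by (auto simp: a_def)
    have sets: "used D1 = set A" "used T = set T'" "used D2 = set B"
      by (simp_all add: used_def A_def T'_def B_def)
    have dist: "distinct (A @ a # T' @ B)" using distinct_W[of "Suc n"] WS by simp
    have disj: "y \<notin> set T'" if "y \<in> F n" for y
      using that dist unfolding Fn sets by auto
    have old: "leq (Suc n) x y \<longleftrightarrow> leq n x y" if "y \<in> F n" for y
    proof -
      have "precedes (W (Suc n)) x y \<longleftrightarrow> precedes (W n) x y"
        using precedes_insert_other[OF disj[OF x] disj[OF that], of "A @ [a]" B] by (simp add: Wn WS)
      then show ?thesis using x F_Suc by (auto simp: leq_def)
    qed
    have new: "leq (Suc n) x y \<longleftrightarrow> leq n x a" if "y \<in> used T" for y
    proof -
      have "x \<in> set A \<or> x = a \<or> x \<in> set B" using x unfolding Fn sets by auto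
      moreover have "y \<in> set T'" using that sets by simp
      ultimately have "precedes (W (Suc n)) x y \<longleftrightarrow> x = a \<or> precedes (W n) x a"
        unfolding Wn WS by (rule precedes_insert_new[OF dist])
      moreover have "x \<noteq> y" using disj[OF x] \<open>y \<in> set T'\<close> by auto
      ultimately show ?thesis using x by (simp add: leq_def)
    qed
    consider "u \<in> F n" | "u \<in> E - F n" "g n u \<noteq> d" | "u \<in> E - F n" "g n u = d" using u by blast
    then show ?thesis
    proof cases
      case 1
      then have "u \<in> F (Suc n)" using F_Suc by blast
      with \<open>u \<in> F n\<close> show ?thesis using old[of u] by (simp add: place_def)
    next
      case old_gap: 2
      then have "u \<notin> used T" "g (Suc n) u = g n u" using 2 by blast+
      then have "place (Suc n) u = place n u" using old_gap FS Fn by (simp add: place_def)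
      then show ?thesis using old[OF place_in[OF u]] by simp
    next
      case 3
      then have "place n u = a" by (simp add: place_def a_def)
      moreover have "place (Suc n) u \<in> used T"
      proof (cases "u \<in> used T")
        case True
        then show ?thesis using FS by (simp add: place_def)
      next
        case False
        then have "g (Suc n) u \<in> set T" using 2(6) 3 by (simp add: in_set_butlastD)
        moreover have "u \<notin> F (Suc n)" using False 3 FS Fn by simp
        ultimately show ?thesis by (simp add: place_def dart_edge_in_used)
      qed
      ultimately show ?thesis using new by simp
    qed
  qed
qed

lemma leq_later:
  assumes "x \<in> F n" "u \<in> E" "n \<le> m"
  shows "leq m x (place m u) \<longleftrightarrow> leq n x (place n u)"
  using assms(3)
proof (induction m rule: dec_induct)
  case (step k)
  then show ?case using leq_step[of x k u] F_mono[of n k] assms(1,2) by blast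
qed simp

lemma less_iff:
  assumes "x \<in> F n" "y \<in> F n"
  shows "x \<lhd> y \<longleftrightarrow> precedes (W n) x y"
proof
  assume "x \<lhd> y"
  then obtain m where m: "precedes (W m) x y" by (auto simp: less_def)
  then have xy: "x \<in> F m" "y \<in> F m" "x \<noteq> y"
    using precedes_in[OF m] precedes_irrefl[OF distinct_W[of m]] by auto
  have "leq m x (place m y)" using m xy by (simp add: leq_def place_def)
  then have "leq n x (place n y)"
    using leq_later[of x m y n] leq_later[of x n y m] xy assms F_sub[of m] by (metis nle_le subsetD)
  then show "precedes (W n) x y" using xy assms by (simp add: leq_def place_def)
qed (auto simp: less_def)

text \<open>The place of an edge at any stage already decides its final position relative to the edges
  used at that stage.\<close>

lemma less_place:
  assumes "x \<in> F n" "u \<in> E"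
  shows "x = u \<or> x \<lhd> u \<longleftrightarrow> leq n x (place n u)"
proof -
  obtain m where "u \<in> F m" using in_F[OF assms(2)] .
  then have k: "u \<in> F (max m n)" "x \<in> F (max m n)"
    using F_mono[of m "max m n"] F_mono[of n "max m n"] assms(1) by auto
  have "leq n x (place n u) \<longleftrightarrow> leq (max m n) x u"
    using leq_later[OF assms, of "max m n"] k by (simp add: place_def)
  then show ?thesis using k less_iff[OF k(2,1)] by (auto simp: leq_def)
qed

lemma less_in: "x \<lhd> y \<Longrightarrow> x \<in> E \<and> y \<in> E"
  using precedes_in F_sub unfolding less_def by (metis list.set_map set_W subsetD)

lemma less_irrefl: "\<not> x \<lhd> x"
  using precedes_irrefl[OF distinct_W] by (simp add: less_def)

lemma less_trans: assumes "x \<lhd> y" "y \<lhd> z" shows "x \<lhd> z"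
proof -
  obtain n where n: "x \<in> F n" "y \<in> F n" using in_F_both less_in[OF assms(1)] by metis
  obtain k where k: "z \<in> F k" using in_F less_in[OF assms(2)] by metis
  have m: "x \<in> F (max n k)" "y \<in> F (max n k)" "z \<in> F (max n k)"
    using n k F_mono[of n "max n k"] F_mono[of k "max n k"] by auto
  then show ?thesis
    using assms precedes_trans[OF distinct_W[of "max n k"]] by (simp add: less_iff)
qed

lemma less_total: assumes "x \<in> E" "y \<in> E" "x \<noteq> y" shows "x \<lhd> y \<or> y \<lhd> x"
proof -
  obtain n where n: "x \<in> F n" "y \<in> F n" using in_F_both assms by metis
  then have "precedes (W n) x y \<or> precedes (W n) y x"
    using assms(3) by (intro precedes_total) simp_all
  then show ?thesis by (auto simp: less_def)
qed

text \<open>Edges of the same component have the same place, edges of different components have different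
  places, and places can be told apart by the used edges up to them.\<close>

lemma gaps:
  assumes u: "u \<in> E - F n" and w: "w \<in> E - F n"
  shows "link (E - F n) u w \<longleftrightarrow> (\<forall>x\<in>F n. x \<lhd> u \<longleftrightarrow> x \<lhd> w)"
proof -
  have lp: "x \<lhd> y \<longleftrightarrow> leq n x (place n y)" if "x \<in> F n" "y \<in> E - F n" for x y
    using less_place[of x n y] that by auto
  have "link (E - F n) u w \<longleftrightarrow> g n u = g n w" using g_eq[OF u w] by simp
  also have "\<dots> \<longleftrightarrow> place n u = place n w"
  proof -
    have "g n u \<in> set (D n)" "g n w \<in> set (D n)" using g_in u w by (auto dest: in_set_butlastD)
    then show ?thesis using u w inj_on_eq_iff[OF inj_D[of n]] by (simp add: place_def)
  qed
  also have "\<dots> \<longleftrightarrow> (\<forall>x\<in>F n. x \<lhd> u \<longleftrightarrow> x \<lhd> w)"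
  proof
    assume R: "\<forall>x\<in>F n. x \<lhd> u \<longleftrightarrow> x \<lhd> w"
    have "leq n (place n u) (place n w)"
      using R lp[of "place n u" u] lp[of "place n u" w] place_in u w by (auto simp: leq_def)
    moreover have "leq n (place n w) (place n u)"
      using R lp[of "place n w" u] lp[of "place n w" w] place_in u w by (auto simp: leq_def)
    ultimately show "place n u = place n w"
      using precedes_trans[OF distinct_W[of n]] precedes_irrefl[OF distinct_W[of n]]
      unfolding leq_def by blast
  qed (use lp u w in auto)
  finally show ?thesis .
qed

text \<open>Nothing will ever be inserted after a dead dart.\<close>

definition dead where "dead n d \<longleftrightarrow> (\<forall>u \<in> E - F n. g n u \<noteq> d)"

lemma pair_survives_insertion:
  assumes "D1 @ d0 # D2 = P @ d # c # Q" "d0 \<noteq> d"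
  shows "\<exists>P' Q'. D1 @ d0 # T @ D2 = P' @ d # c # Q'"
proof -
  have "(D1 @ [d0]) @ D2 = (P @ [d]) @ c # Q" using assms(1) by simp
  then obtain us where "D1 @ [d0] = (P @ [d]) @ us \<and> us @ D2 = c # Q \<or>
      (D1 @ [d0]) @ us = P @ [d] \<and> D2 = us @ c # Q"
    unfolding append_eq_append_conv2 by blast
  then show ?thesis
  proof (elim disjE conjE)
    assume us: "D1 @ [d0] = (P @ [d]) @ us" "us @ D2 = c # Q"
    then have "us \<noteq> []" using assms(2) by auto
    then obtain us' where "us = c # us'" using us(2) by (cases us) auto
    have "D1 @ d0 # T @ D2 = (D1 @ [d0]) @ T @ D2" by simp
    also have "\<dots> = ((P @ [d]) @ us) @ T @ D2" using us(1) by (simp only:)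
    also have "\<dots> = P @ d # c # (us' @ T @ D2)" using \<open>us = c # us'\<close> by simp
    finally show ?thesis by blast
  next
    assume us: "(D1 @ [d0]) @ us = P @ [d]" "D2 = us @ c # Q"
    then have "us \<noteq> []" using assms(2) by auto
    moreover have "last us = d" using arg_cong[OF us(1), of last] \<open>us \<noteq> []\<close> by simp
    ultimately have us': "us = butlast us @ [d]" using append_butlast_last_id[of us] by simp
    have "D1 @ d0 # T @ D2 = D1 @ d0 # T @ us @ c # Q" using us(2) by simp
    also have "\<dots> = D1 @ d0 # T @ (butlast us @ [d]) @ c # Q" using us' by (rule arg_cong)
    also have "\<dots> = (D1 @ d0 # T @ butlast us) @ d # c # Q" by simp
    finally show ?thesis by blast
  qed
qed

text \<open>Two consecutive darts stay consecutive until a closed trail \<open>T\<close> is inserted between them. Then \<open>d\<close>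
  and the last dart of \<open>T\<close>, which precedes \<open>c\<close>, are dead, since only the other darts of \<open>T\<close> are
  assigned to components.\<close>

lemma pair_eventually_dead_aux:
  assumes "u \<in> F (n + k)" "u \<in> E - F n" "g n u = d" "D n = P @ d # c # Q"
  shows "\<exists>m. (\<exists>c' P Q. D m = P @ d # c' # Q \<and> dead m d) \<and> (\<exists>d' P Q. D m = P @ d' # c # Q \<and> dead m d')"
  using assms
proof (induction k arbitrary: n P Q)
  case (Suc k)
  consider "D (Suc n) = D n" "g (Suc n) = g n"
    | D1 d0 D2 T where "D n = D1 @ d0 # D2" "D2 \<noteq> []" "D (Suc n) = D1 @ d0 # T @ D2"
      "e n \<in> used T" "used T \<subseteq> {u \<in> E - F n. g n u = d0}"
      "\<forall>u \<in> E - F n. g n u \<noteq> d0 \<longrightarrow> g (Suc n) u = g n u"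
      "\<forall>u \<in> E - F n - used T. g n u = d0 \<longrightarrow> g (Suc n) u \<in> set (butlast T)"
    using step[of n] unfolding tour_step_def by auto
  then show ?case
  proof cases
    case 1
    then show ?thesis using Suc.IH[of "Suc n" P Q] Suc.prems by simp
  next
    case 2
    show ?thesis
    proof (cases "d0 = d")
      case False
      obtain P' Q' where "D (Suc n) = P' @ d # c # Q'"
        using pair_survives_insertion[of D1 d0 D2 P d c Q T] 2(1,3) Suc.prems(4) False by auto
      moreover have "g (Suc n) u = d" using 2(6) Suc.prems(2,3) False by auto
      moreover have "u \<notin> used T" using 2(5) Suc.prems(3) False by auto
      then have "u \<in> E - F (Suc n)" using Suc.prems(2) 2(1,3) by auto
      ultimately show ?thesis using Suc.IH[of "Suc n" P' Q'] Suc.prems(1) by simp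
    next
      case True
      have dist: "distinct (D1 @ d # T @ D2)"
        using distinct_W[of "Suc n"] 2(3) True by (metis distinct_map)
      have "D1 @ d # D2 = P @ d # c # Q" "d \<notin> set D1" "d \<notin> set D2"
        using 2(1) Suc.prems(4) True dist by auto
      then have eq: "D1 = P" "D2 = c # Q"
        using append_Cons_eq_iff[of d D1 D2 P "c # Q"] by auto
      have T: "T \<noteq> []" using 2(4) by auto
      then have Ts: "T = hd T # tl T" "T = butlast T @ [last T]" by simp_all
      have dead: "dead (Suc n) x" if x: "x = d \<or> x = last T" for x
        unfolding dead_def
      proof
        fix w assume w: "w \<in> E - F (Suc n)"
        then have w': "w \<in> E - F n" "w \<notin> used T" using 2(1,3) by auto
        show "g (Suc n) w \<noteq> x"
        proof (cases "g n w = d")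
          case True
          then have "g (Suc n) w \<in> set (butlast T)" using 2(7) w' \<open>d0 = d\<close> by auto
          moreover have "d \<notin> set (butlast T)" using dist by (auto dest: in_set_butlastD)
          moreover have "last T \<notin> set (butlast T)"
          proof -
            have "distinct (butlast T @ [last T])" using dist Ts(2) by simp
            then show ?thesis by simp
          qed
          ultimately show ?thesis using x by auto
        next
          case False
          then have "g (Suc n) w = g n w" using 2(6) w' \<open>d0 = d\<close> by auto
          moreover have "g n w \<in> set (D n)" using g_in[OF w'(1)] by (rule in_set_butlastD)
          moreover have "set T \<inter> set (D n) = {}" using dist 2(1) \<open>d0 = d\<close> by auto
          then have "last T \<notin> set (D n)" using last_in_set[OF T] by blast
          ultimately show ?thesis using x False by auto
        qed
      qed
      have "D (Suc n) = P @ d # hd T # (tl T @ D2)" using 2(3) True eq(1) Ts(1) by simp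
      moreover have "D (Suc n) = (P @ d # butlast T) @ last T # c # Q"
        using 2(3) True eq Ts(2) by (metis append.assoc append_Cons append_Nil)
      ultimately show ?thesis using dead by blast
    qed
  qed
qed simp

lemma pair_eventually_dead:
  assumes "D n = P @ d # c # Q"
  shows "\<exists>m. (\<exists>c' P Q. D m = P @ d # c' # Q \<and> dead m d) \<and> (\<exists>d' P Q. D m = P @ d' # c # Q \<and> dead m d')"
proof (cases "dead n d")
  case True
  then show ?thesis using assms by blast
next
  case False
  then obtain u where u: "u \<in> E - F n" "g n u = d" by (auto simp: dead_def)
  then obtain k where "u \<in> F k" using in_F by blast
  then have "u \<in> F (n + k)" using F_mono[of k "n + k"] by auto
  from pair_eventually_dead_aux[OF this u assms] show ?thesis .
qed

lemma dead_gap_is_empty: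
  assumes D: "D m = P @ d # c # Q" "dead m d" and z: "dart_edge d \<lhd> z"
  shows "dart_edge c = z \<or> dart_edge c \<lhd> z"
proof -
  have zE: "z \<in> E" using less_in[OF z] by simp
  have in_m: "dart_edge d \<in> F m" "dart_edge c \<in> F m" using D(1) by auto
  have "place m z \<noteq> dart_edge d"
  proof (cases "z \<in> F m")
    case True
    then show ?thesis using z less_irrefl by (auto simp: place_def)
  next
    case False
    then have "g m z \<noteq> d" using D(2) zE by (simp add: dead_def)
    moreover have "g m z \<in> set (D m)" using g_in[of z m] zE False by (simp add: in_set_butlastD)
    moreover have "d \<in> set (D m)" using D(1) by simp
    ultimately show ?thesis using False inj_on_eq_iff[OF inj_D[of m]] by (simp add: place_def)
  qed
  moreover have "leq m (dart_edge d) (place m z)" using less_place[OF in_m(1) zE] z by simp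
  ultimately have "precedes (W m) (dart_edge d) (place m z)" by (auto simp: leq_def)
  then have "leq m (dart_edge c) (place m z)"
    using distinct_W[of m] in_m unfolding leq_def D(1) by (auto dest: precedes_in)
  then show ?thesis using less_place[OF in_m(2) zE] by simp
qed

lemma consecutive:
  assumes "D m = P @ d # c # Q"
  shows "dart_edge d \<lhd> dart_edge c" "{dart_edge d, dart_edge c} \<in> edges (line_graph (V, E))"
proof -
  show 1: "dart_edge d \<lhd> dart_edge c" unfolding less_def
    by (rule exI[of _ m]) (simp add: assms)
  have "walk v (P @ d # c # Q) v" using trail_D[of m] assms by (simp add: trail_def)
  then have "snd d = fst c" by (auto simp: walk_append)
  then have "snd d \<in> dart_edge d \<inter> dart_edge c" by (simp add: dart_edge_def)
  moreover have "dart_edge d \<noteq> dart_edge c" using 1 less_irrefl by metis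
  moreover have "dart_edge d \<in> E" "dart_edge c \<in> E" using less_in[OF 1] by simp_all
  ultimately show "{dart_edge d, dart_edge c} \<in> edges (line_graph (V, E))"
    by (auto simp: line_graph_def)
qed

end

lemma linked_line_graph_del_verts: "(e, f) \<in> linked (del_verts (line_graph G) S) \<longleftrightarrow> link (edges G - S) e f"
proof -
  let ?A = "edges G - S"
  let ?R = "{(u, v). {u, v} \<in> edges (del_verts (line_graph G) S)}"
  let ?T = "{(e, f). e \<in> ?A \<and> f \<in> ?A \<and> e \<inter> f \<noteq> {}}"
  have R: "(u, w) \<in> ?R \<longleftrightarrow> u \<in> ?A \<and> w \<in> ?A \<and> u \<noteq> w \<and> u \<inter> w \<noteq> {}" for u w
    by (auto simp: del_verts_def line_graph_def doubleton_eq_iff)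
  have "?R \<subseteq> ?T"
  proof
    fix p assume "p \<in> ?R"
    then show "p \<in> ?T" using R[of "fst p" "snd p"] by (cases p) simp
  qed
  moreover have "?T \<subseteq> ?R\<^sup>*"
  proof
    fix p assume "p \<in> ?T"
    then have "p \<in> ?R \<or> fst p = snd p" using R[of "fst p" "snd p"] by (cases p) simp
    then show "p \<in> ?R\<^sup>*" by (cases p) (metis fst_conv r_into_rtrancl rtrancl.rtrancl_refl snd_conv)
  qed
  ultimately have "?T\<^sup>* = ?R\<^sup>*" by (rule rtrancl_subset)
  moreover have "verts (del_verts (line_graph G) S) = ?A"
    by (simp add: del_verts_def line_graph_def)
  ultimately show ?thesis by (simp add: linked_def link_def)
qed

lemma pairs_edges: "simple_graph G \<Longrightarrow> pairs (edges G)"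
  unfolding simple_graph_def pairs_def Bex_def by (intro ballI) (drule bspec, assumption, elim exE conjE, intro exI conjI)

lemma simple_line_graph: "simple_graph (line_graph G)"
  unfolding simple_graph_def
proof
  fix a assume "a \<in> edges (line_graph G)"
  then obtain e f where "a = {e, f}" "e \<in> edges G" "f \<in> edges G" "e \<noteq> f"
    unfolding line_graph_def by auto
  then show "\<exists>e\<in>verts (line_graph G). \<exists>f\<in>verts (line_graph G). e \<noteq> f \<and> a = {e, f}"
    unfolding line_graph_def fst_conv by (intro bexI conjI)
qed

lemma countable_edges:
  assumes "simple_graph G" "countable (verts G)"
  shows "countable (edges G)"
proof -
  have "edges G \<subseteq> (\<lambda>(x, y). {x, y}) ` (verts G \<times> verts G)"
    using assms(1) by (force simp: simple_graph_def)
  moreover have "countable \<dots>" using assms(2) by simp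
  ultimately show ?thesis by (rule countable_subset)
qed

lemma tour_sequence_exists:
  assumes "pairs E" "even_cuts E" "\<forall>e\<in>E. \<forall>f\<in>E. link E e f" "E \<noteq> {}" "countable E"
  shows "\<exists>v e D g. tour_sequence E v e D g"
proof -
  define e where "e = from_nat_into E"
  have enum: "range e = E" unfolding e_def by (rule range_from_nat_into) (use assms in auto)
  obtain e0 where "e0 \<in> E" using assms(4) by blast
  from tour_state_initial[OF assms(2,1,3) this] obtain v D0 g0 where init: "tour_state E v D0 g0" by blast
  have "\<exists>s. \<forall>n. tour_state E v (fst (s n)) (snd (s n)) \<and>
    (tour_step E (e n) (fst (s n)) (snd (s n)) (fst (s (Suc n))) (snd (s (Suc n))))"
  proof (rule dependent_nat_choice)
    show "\<exists>x. tour_state E v (fst x) (snd x)" using init by auto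
  next
    fix s :: "('a \<times> 'a) list \<times> ('a set \<Rightarrow> 'a \<times> 'a)" and n
    obtain D g where s: "s = (D, g)" by (cases s)
    assume "tour_state E v (fst s) (snd s)"
    then have st: "tour_state E v D g" by (simp add: s)
    show "\<exists>s'. tour_state E v (fst s') (snd s') \<and> tour_step E (e n) (fst s) (snd s) (fst s') (snd s')"
    proof (cases "e n \<in> used D")
      case True
      then show ?thesis using st by (intro exI[of _ "(D, g)"]) (simp add: tour_step_def s)
    next
      case False
      then have "e n \<in> E - used D" using enum by blast
      from tour_state_step[OF st assms(2,1) this]
      obtain D1 D2 T g' where "D = D1 @ g (e n) # D2" "D2 \<noteq> []"
        and st': "tour_state E v (D1 @ g (e n) # T @ D2) g'"
        and "e n \<in> used T" "used T \<subseteq> {u \<in> E - used D. g u = g (e n)}"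
        "\<forall>u \<in> E - used D. g u \<noteq> g (e n) \<longrightarrow> g' u = g u"
        "\<forall>u \<in> E - used D - used T. g u = g (e n) \<longrightarrow> g' u \<in> set (butlast T)"
        by (elim exE conjE)
      then have "tour_step E (e n) D g (D1 @ g (e n) # T @ D2) g'"
        unfolding tour_step_def
        by (intro disjI2 exI[of _ D1] exI[of _ "g (e n)"] exI[of _ D2] exI[of _ T] conjI refl)
      then show ?thesis using st' by (intro exI[of _ "(D1 @ g (e n) # T @ D2, g')"]) (simp add: s)
    qed
  qed
  then obtain s where "\<forall>n. tour_state E v (fst (s n)) (snd (s n)) \<and>
    tour_step E (e n) (fst (s n)) (snd (s n)) (fst (s (Suc n))) (snd (s (Suc n)))" by (elim exE)
  then have "tour_sequence E v e (\<lambda>n. fst (s n)) (\<lambda>n. snd (s n))"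
    using assms(1) enum by (simp add: tour_sequence_def)
  then show ?thesis by (intro exI)
qed

context tour_sequence
begin

lemma ends_constant: "hd (D n) = hd (D 0)" "last (D n) = last (D 0)"
proof (induction n)
  case (Suc n)
  have "hd (D (Suc n)) = hd (D n) \<and> last (D (Suc n)) = last (D n)"
    using step[of n] by (auto simp: tour_step_def hd_append)
  with Suc show "hd (D (Suc n)) = hd (D 0)" "last (D (Suc n)) = last (D 0)" by simp_all
qed simp_all

lemma closed_trail_length: "\<exists>a b c Q. D n = a # b # c # Q"
proof -
  have tr: "trail E v (D n) v" using trail_D .
  have loop: "{x} \<notin> E" for x using pairsE[OF pairs, of "{x}"] by blast
  show ?thesis
  proof (cases "D n")
    case (Cons a D')
    show ?thesis
    proof (cases D')
      case Nil
      then show ?thesis using tr Cons loop[of "snd a"] by (auto simp: trail_Cons dart_edge_def)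
    next
      case (Cons b D'')
      then show ?thesis
        using tr \<open>D n = a # D'\<close> by (cases D'') (auto simp: trail_Cons dart_edge_def insert_commute)
    qed
  qed (use D_ne in simp)
qed

lemma circular_layout:
  assumes "E = edges G" "simple_graph G" "countable E"
  shows "circular_layout (line_graph G) less (dart_edge (hd (D 0))) (dart_edge (last (D 0))) F"
proof -
  let ?bot = "dart_edge (hd (D 0))" and ?top = "dart_edge (last (D 0))"
  have V: "verts (line_graph G) = E" using assms(1) by (simp add: line_graph_def)
  have H: "line_graph (verts G, E) = line_graph G" using assms(1) by simp
  note consec = consecutive(1) consecutive(2)[where V = "verts G", unfolded H]
  obtain a b c Q where D0: "D 0 = a # b # c # Q" using closed_trail_length by blast
  have W0: "distinct (W 0)" using distinct_W .
  have bt: "?bot \<in> F 0" "?top \<in> F 0" "?bot \<noteq> ?top"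
    using W0 dart_edge_in_used[of "last (D 0)" "D 0"] unfolding D0 by auto
  have ends: "D n \<noteq> [] \<and> hd (W n) = ?bot \<and> last (W n) = ?top" for n
    using ends_constant[of n] D_ne[of n] by (simp add: hd_map last_map)
  show ?thesis
  proof
    show "simple_graph (line_graph G)" by (rule simple_line_graph)
    show "countable (verts (line_graph G))" using assms(3) V by simp
    show "\<not> x \<lhd> x" for x by (rule less_irrefl)
    show "x \<lhd> y \<Longrightarrow> y \<lhd> z \<Longrightarrow> x \<lhd> z" for x y z by (rule less_trans)
    show "x \<lhd> y \<or> y \<lhd> x" if "x \<in> verts (line_graph G)" "y \<in> verts (line_graph G)" "x \<noteq> y" for x y
      using less_total that V by simp
    show "?bot \<in> verts (line_graph G)" "?top \<in> verts (line_graph G)"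
      using bt F_sub[of 0] V by auto
    show "?bot \<lhd> x" if x: "x \<in> verts (line_graph G)" "x \<noteq> ?bot" for x
    proof -
      obtain n where n: "x \<in> F n" using in_F x(1) V by metis
      have "precedes (?bot # xs) ?bot x" if "x \<in> set xs" for xs using that by simp
      moreover have "W n = ?bot # tl (W n)" using ends[of n] by (metis list.collapse map_is_Nil_conv)
      moreover from this n x(2) have "x \<in> set (tl (W n))" by (metis set_ConsD set_W set_map)
      ultimately show ?thesis unfolding less_def by metis
    qed
    show "x \<lhd> ?top" if x: "x \<in> verts (line_graph G)" "x \<noteq> ?top" for x
    proof -
      obtain n where n: "x \<in> F n" using in_F x(1) V by metis
      have "precedes (xs @ [?top]) x ?top" if "x \<in> set xs" for xs using that by simp
      moreover have W: "W n = butlast (W n) @ [?top]"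
        using ends[of n] by (metis append_butlast_last_id map_is_Nil_conv)
      moreover have "x \<in> set (butlast (W n))"
      proof -
        have "x \<in> set (butlast (W n) @ [?top])" using n W by (metis set_W set_map)
        then show ?thesis using x(2) by simp
      qed
      ultimately show ?thesis unfolding less_def by metis
    qed
    show "\<exists>y\<in>verts (line_graph G). x \<lhd> y \<and> (\<forall>z\<in>verts (line_graph G). x \<lhd> z \<longrightarrow> y = z \<or> y \<lhd> z) \<and>
        {x, y} \<in> edges (line_graph G)"
      if x: "x \<in> verts (line_graph G)" "x \<noteq> ?top" for x
    proof -
      obtain n where n: "x \<in> F n" using in_F x(1) V by metis
      then obtain d where d: "d \<in> set (D n)" "x = dart_edge d" unfolding used_def by blast
      then obtain P R where PR: "D n = P @ d # R" using split_list by metis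
      have "last (D n) \<noteq> d" using ends_constant[of n] d x(2) by auto
      then have "R \<noteq> []" using PR by auto
      then obtain c R' where "D n = P @ d # c # R'" using PR by (cases R) auto
      from pair_eventually_dead[OF this] obtain m c' P' Q'
        where m: "D m = P' @ d # c' # Q'" "dead m d" by blast
      have "x \<lhd> dart_edge c'" "{x, dart_edge c'} \<in> edges (line_graph G)"
        using consec(1)[OF m(1)] consec(2)[OF m(1)] d(2) by simp_all
      moreover have "\<forall>z\<in>verts (line_graph G). x \<lhd> z \<longrightarrow> dart_edge c' = z \<or> dart_edge c' \<lhd> z"
        using dead_gap_is_empty[OF m] d(2) by simp
      moreover have "dart_edge c' \<in> verts (line_graph G)" using less_in \<open>x \<lhd> dart_edge c'\<close> V by simp
      ultimately show ?thesis by blast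
    qed
    show "\<exists>y\<in>verts (line_graph G). y \<lhd> x \<and> (\<forall>z\<in>verts (line_graph G). y \<lhd> z \<longrightarrow> x = z \<or> x \<lhd> z)"
      if x: "x \<in> verts (line_graph G)" "x \<noteq> ?bot" for x
    proof -
      obtain n where n: "x \<in> F n" using in_F x(1) V by metis
      then obtain d where d: "d \<in> set (D n)" "x = dart_edge d" unfolding used_def by blast
      then obtain P R where PR: "D n = P @ d # R" using split_list by metis
      have "hd (D n) \<noteq> d" using ends_constant[of n] d x(2) by auto
      then have "P \<noteq> []" using PR by auto
      then have "D n = butlast P @ last P # d # R" using PR by simp
      from pair_eventually_dead[OF this] obtain m d' P' Q'
        where m: "D m = P' @ d' # d # Q'" "dead m d'" by blast
      have "dart_edge d' \<lhd> x"
        using consec(1)[OF m(1)] d(2) by simp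
      moreover have "\<forall>z\<in>verts (line_graph G). dart_edge d' \<lhd> z \<longrightarrow> x = z \<or> x \<lhd> z"
        using dead_gap_is_empty[OF m] d(2) by simp
      moreover have "dart_edge d' \<in> verts (line_graph G)" using less_in \<open>dart_edge d' \<lhd> x\<close> V by simp
      ultimately show ?thesis by blast
    qed
    show "{?top, ?bot} \<in> edges (line_graph G)"
    proof -
      have w: "walk v (D 0) v" using trail_D[of 0] by (simp add: trail_def)
      have "walk x ds y \<Longrightarrow> ds \<noteq> [] \<Longrightarrow> snd (last ds) = y" for x y :: 'v and ds
        by (induction ds arbitrary: x) auto
      then have "snd (last (D 0)) = v" using w D_ne by blast
      moreover have "fst (hd (D 0)) = v" using w D0 by simp
      ultimately have "v \<in> ?top \<inter> ?bot" by (simp add: dart_edge_def)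
      moreover have "?bot \<in> E" "?top \<in> E" using bt F_sub[of 0] by auto
      ultimately show ?thesis using bt(3) assms(1) by (auto simp: line_graph_def)
    qed
    show "\<exists>x\<in>verts (line_graph G). x \<noteq> ?bot \<and> x \<noteq> ?top"
    proof
      show "dart_edge b \<in> verts (line_graph G)" using F_sub[of 0] V D0 by auto
      have "last (D 0) = last (c # Q)" by (simp add: D0)
      moreover have "last (c # Q) \<in> set (c # Q)" by (rule last_in_set) simp
      ultimately show "dart_edge b \<noteq> ?bot \<and> dart_edge b \<noteq> ?top"
        using W0 unfolding D0 by (auto simp del: last.simps)
    qed
    show "finite (F n)" "F n \<subseteq> F (Suc n)" "(\<Union>n. F n) = verts (line_graph G)" for n
      using F_Suc exhausts V by simp_all
    show "(u, w) \<in> linked (del_verts (line_graph G) (F n)) \<longleftrightarrow> (\<forall>x\<in>F n. x \<lhd> u \<longleftrightarrow> x \<lhd> w)"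
      if "u \<in> verts (line_graph G) - F n" "w \<in> verts (line_graph G) - F n" for u w n
      using gaps[of u n w] that linked_line_graph_del_verts[of u w G "F n"] V assms(1) by simp
  qed
qed

end

theorem line_graph_circular_layout:
  assumes "simple_graph G" "countable (verts G)" "edges G \<noteq> {}" "even_cuts (edges G)"
    and "\<forall>e\<in>edges G. \<forall>f\<in>edges G. link (edges G) e f"
  shows "\<exists>less bot top F. circular_layout (line_graph G) less bot top F"
proof -
  have c: "countable (edges G)" by (rule countable_edges[OF assms(1,2)])
  from tour_sequence_exists[OF pairs_edges[OF assms(1)] assms(4,5,3) c]
  obtain v e D g where "tour_sequence (edges G) v e D g" by (elim exE)
  from tour_sequence.circular_layout[OF this refl assms(1) c] show ?thesis by (intro exI)
qed

section \<open>The circle of a circular layout\<close>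

context circular_layout
begin

abbreviation V where "V \<equiv> verts H"

lemma asym: "x \<lhd> y \<Longrightarrow> \<not> y \<lhd> x"
  using trans irrefl by blast

text \<open>The cyclic successor.\<close>

definition nxt where
  "nxt x = (if x = top then bot else
     SOME y. y \<in> V \<and> x \<lhd> y \<and> (\<forall>z\<in>V. x \<lhd> z \<longrightarrow> y = z \<or> y \<lhd> z) \<and> {x, y} \<in> edges H)"

lemma nxt_props:
  assumes "x \<in> V" "x \<noteq> top"
  shows "nxt x \<in> V \<and> x \<lhd> nxt x \<and> (\<forall>z\<in>V. x \<lhd> z \<longrightarrow> nxt x = z \<or> nxt x \<lhd> z) \<and> {x, nxt x} \<in> edges H"
proof -
  have "\<exists>y. y \<in> V \<and> x \<lhd> y \<and> (\<forall>z\<in>V. x \<lhd> z \<longrightarrow> y = z \<or> y \<lhd> z) \<and> {x, y} \<in> edges H"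
    using successor[OF assms] unfolding Bex_def .
  from someI_ex[OF this] show ?thesis unfolding nxt_def using assms(2) by simp
qed

lemma less_nxt: "x \<in> V \<Longrightarrow> x \<noteq> top \<Longrightarrow> x \<lhd> nxt x"
  using nxt_props by simp

lemma nxt_least: "x \<in> V \<Longrightarrow> x \<noteq> top \<Longrightarrow> z \<in> V \<Longrightarrow> x \<lhd> z \<Longrightarrow> nxt x = z \<or> nxt x \<lhd> z"
  using nxt_props by simp

lemma nxt_top: "nxt top = bot"
  by (simp add: nxt_def)

lemma nxt_in: "x \<in> V \<Longrightarrow> nxt x \<in> V"
  using nxt_props[of x] bot_in by (cases "x = top") (simp_all add: nxt_top)

lemma nxt_edge: "x \<in> V \<Longrightarrow> {x, nxt x} \<in> edges H"
  using nxt_props[of x] closing by (cases "x = top") (simp_all add: nxt_top)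

lemma top_greatest: "x \<in> V \<Longrightarrow> \<not> top \<lhd> x"
  using less_top[of x] asym irrefl by (cases "x = top") auto

lemma bot_least: "x \<in> V \<Longrightarrow> \<not> x \<lhd> bot"
  using bot_less[of x] asym irrefl by (cases "x = bot") auto

lemma nxt_nxt_ne: assumes x: "x \<in> V" shows "nxt (nxt x) \<noteq> x"
proof -
  have bt: "bot \<noteq> top" "nxt bot \<noteq> top"
  proof -
    obtain z where z: "z \<in> V" "z \<noteq> bot" "z \<noteq> top" using third by blast
    show ne: "bot \<noteq> top"
    proof
      assume "bot = top"
      then show False using bot_less[OF z(1,2)] top_greatest[OF z(1)] by simp
    qed
    show "nxt bot \<noteq> top"
    proof
      assume "nxt bot = top"
      then have "top = z \<or> top \<lhd> z"
        using nxt_least[OF bot_in ne z(1) bot_less[OF z(1,2)]] by simp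
      then show False using z top_greatest by simp
    qed
  qed
  show ?thesis
  proof (cases "x = top")
    case True
    then show ?thesis using bt by (simp add: nxt_top)
  next
    case False
    show ?thesis
    proof (cases "nxt x = top")
      case True
      then show ?thesis using bt(2) by (metis nxt_top)
    next
      case nt: False
      have "x \<lhd> nxt (nxt x)" using trans[OF less_nxt[OF x False] less_nxt[OF nxt_in[OF x] nt]] .
      then show ?thesis using irrefl by metis
    qed
  qed
qed

lemma nxt_ne: "x \<in> V \<Longrightarrow> nxt x \<noteq> x"
  using nxt_nxt_ne[of x] by metis

lemma prev:
  assumes "x \<in> V" "x \<noteq> bot"
  obtains w where "w \<in> V" "w \<noteq> top" "nxt w = x"
proof -
  obtain y where y: "y \<in> V" "y \<lhd> x" "\<forall>z\<in>V. y \<lhd> z \<longrightarrow> x = z \<or> x \<lhd> z"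
    using predecessor[OF assms] by (elim bexE conjE)
  have yt: "y \<noteq> top" using top_greatest[OF assms(1)] y(2) by auto
  have "x = nxt y \<or> x \<lhd> nxt y" using y(3) nxt_in[OF y(1)] less_nxt[OF y(1) yt] by simp
  moreover have "nxt y = x \<or> nxt y \<lhd> x" using nxt_least[OF y(1) yt assms(1) y(2)] .
  ultimately have "nxt y = x" using asym by blast
  then show ?thesis using that y(1) yt by blast
qed


subsection \<open>Placing the vertices on an interval\<close>

text \<open>Any positive summable weights would serve; they are the lengths of the segments below.\<close>

definition weight :: "'a \<Rightarrow> real" where
  "weight x = (1 / 2) ^ to_nat_on V x"

definition total_weight :: "'a set \<Rightarrow> real" where
  "total_weight A = infsum weight A"

text \<open>The vertex \<open>x\<close> is followed by a segment of length \<open>weight x\<close>, and these segments leave no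
  intervals uncovered. So the interval has just one point for every cut of the order without
  adjacent elements.\<close>

definition pos :: "'a \<Rightarrow> real" where
  "pos x = total_weight {y \<in> V. y \<lhd> x}"

definition len :: real where
  "len = total_weight V"

lemma weight_pos: "0 < weight x"
  by (simp add: weight_def)

lemma weight_summable: "A \<subseteq> V \<Longrightarrow> weight summable_on A"
proof -
  have "(\<lambda>n. (1 / 2 :: real) ^ n) summable_on UNIV"
    by (rule norm_summable_imp_summable_on) (simp add: summable_geometric)
  then have "(\<lambda>n. (1 / 2 :: real) ^ n) summable_on (to_nat_on V ` V)"
    by (rule summable_on_subset_banach) simp
  moreover have "inj_on (to_nat_on V) V" using countable by (rule inj_on_to_nat_on)
  ultimately have "((\<lambda>n. (1 / 2 :: real) ^ n) \<circ> to_nat_on V) summable_on V"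
    using summable_on_reindex by blast
  then have "weight summable_on V" by (simp add: comp_def weight_def[abs_def])
  then show "A \<subseteq> V \<Longrightarrow> weight summable_on A" by (rule summable_on_subset_banach)
qed

lemma total_weight_Un:
  assumes "A \<subseteq> V" "B \<subseteq> V" "A \<inter> B = {}"
  shows "total_weight (A \<union> B) = total_weight A + total_weight B"
  unfolding total_weight_def
  by (rule infsum_Un_disjoint[OF weight_summable[OF assms(1)] weight_summable[OF assms(2)] assms(3)])

lemma total_weight_nonneg: "0 \<le> total_weight A"
  unfolding total_weight_def by (rule infsum_nonneg) (simp add: weight_def)

lemma total_weight_mono:
  assumes "A \<subseteq> B" "B \<subseteq> V"
  shows "total_weight A \<le> total_weight B"
proof -
  have "total_weight (A \<union> (B - A)) = total_weight A + total_weight (B - A)"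
    using assms by (intro total_weight_Un) auto
  moreover have "A \<union> (B - A) = B" using assms(1) by auto
  ultimately show ?thesis using total_weight_nonneg[of "B - A"] by simp
qed

lemma total_weight_insert:
  assumes "x \<in> V" "A \<subseteq> V" "x \<notin> A"
  shows "total_weight (insert x A) = total_weight A + weight x"
  using total_weight_Un[of A "{x}"] assms by (simp add: total_weight_def)

text \<open>Summability in the form that is used: all but finitely many vertices have a small total weight.\<close>

lemma total_weight_tail:
  assumes "0 < \<epsilon>"
  obtains \<Phi> where "finite \<Phi>" "\<Phi> \<subseteq> V" "total_weight (V - \<Phi>) < \<epsilon>"
proof -
  obtain \<Phi> where \<Phi>: "finite \<Phi>" "\<Phi> \<subseteq> V" "dist (sum weight \<Phi>) (infsum weight V) \<le> \<epsilon> / 2"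
    using infsum_finite_approximation[OF weight_summable[OF order_refl], of "\<epsilon> / 2"] assms by auto
  have "total_weight (\<Phi> \<union> (V - \<Phi>)) = total_weight \<Phi> + total_weight (V - \<Phi>)"
    using \<Phi>(2) by (intro total_weight_Un) auto
  moreover have "\<Phi> \<union> (V - \<Phi>) = V" using \<Phi>(2) by auto
  ultimately have "infsum weight V = sum weight \<Phi> + total_weight (V - \<Phi>)"
    using \<Phi>(1) by (simp add: total_weight_def)
  then have "total_weight (V - \<Phi>) < \<epsilon>"
    using \<Phi>(3) assms total_weight_nonneg[of "V - \<Phi>"] by (simp add: dist_real_def)
  then show ?thesis using that \<Phi>(1,2) by blast
qed

lemma pos_add_weight: "x \<in> V \<Longrightarrow> pos x + weight x = total_weight (insert x {y \<in> V. y \<lhd> x})"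
  unfolding pos_def using irrefl by (subst total_weight_insert) auto

lemma pos_step:
  assumes "x \<in> V" "y \<in> V" "x \<lhd> y"
  shows "pos x + weight x \<le> pos y"
proof -
  have "insert x {z \<in> V. z \<lhd> x} \<subseteq> {z \<in> V. z \<lhd> y}" using assms trans by auto
  then have "total_weight (insert x {z \<in> V. z \<lhd> x}) \<le> total_weight {z \<in> V. z \<lhd> y}"
    by (rule total_weight_mono) auto
  then show ?thesis using pos_add_weight[OF assms(1)] pos_def[of y] by simp
qed

lemma pos_less: "x \<in> V \<Longrightarrow> y \<in> V \<Longrightarrow> x \<lhd> y \<Longrightarrow> pos x < pos y"
  using pos_step[of x y] weight_pos[of x] by simp

lemma pos_le_iff: "x \<in> V \<Longrightarrow> y \<in> V \<Longrightarrow> pos x \<le> pos y \<longleftrightarrow> x = y \<or> x \<lhd> y"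
  using pos_less[of x y] pos_less[of y x] total[of x y] by fastforce

lemma pos_nxt:
  assumes "x \<in> V" "x \<noteq> top"
  shows "pos (nxt x) = pos x + weight x"
proof -
  have "{y \<in> V. y \<lhd> nxt x} = insert x {y \<in> V. y \<lhd> x}"
  proof (intro set_eqI iffI)
    fix y assume "y \<in> {y \<in> V. y \<lhd> nxt x}"
    then have y: "y \<in> V" "y \<lhd> nxt x" by simp_all
    then have "\<not> x \<lhd> y" using nxt_least[OF assms y(1)] asym irrefl by metis
    then show "y \<in> insert x {y \<in> V. y \<lhd> x}" using total[OF y(1) assms(1)] y(1) by auto
  next
    fix y assume "y \<in> insert x {y \<in> V. y \<lhd> x}"
    then show "y \<in> {y \<in> V. y \<lhd> nxt x}" using less_nxt[OF assms] trans[of y x] assms(1) by auto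
  qed
  then show ?thesis unfolding pos_add_weight[OF assms(1)] by (simp add: pos_def)
qed

lemma pos_bot: "pos bot = 0"
proof -
  have "{y \<in> V. y \<lhd> bot} = {}" using bot_least by auto
  then show ?thesis unfolding pos_def total_weight_def by (simp only: infsum_empty)
qed

lemma pos_top: "pos top + weight top = len"
proof -
  have "insert top {y \<in> V. y \<lhd> top} = V" using less_top top_in by auto
  then show ?thesis unfolding pos_add_weight[OF top_in] len_def by simp
qed

lemma pos_nonneg: "0 \<le> pos x"
  by (simp add: pos_def total_weight_nonneg)

lemma pos_add_weight_le: "x \<in> V \<Longrightarrow> pos x + weight x \<le> len"
  unfolding pos_add_weight len_def by (rule total_weight_mono) auto

lemma len_pos: "0 < len"
  using pos_top pos_nonneg[of top] weight_pos[of top] by simp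

definition seg :: "'a \<Rightarrow> real set" where
  "seg x = {pos x..pos x + weight x}"

lemma seg_sub: "x \<in> V \<Longrightarrow> seg x \<subseteq> {0..len}"
  using pos_nonneg[of x] pos_add_weight_le[of x] by (auto simp: seg_def)

lemma seg_common:
  assumes "x \<in> V" "y \<in> V" "x \<lhd> y" "s \<in> seg x" "s \<in> seg y"
  shows "nxt x = y" "s = pos y" "s = pos x + weight x"
proof -
  show s: "s = pos y" "s = pos x + weight x" using pos_step[OF assms(1-3)] assms(4,5) by (auto simp: seg_def)
  have xt: "x \<noteq> top" using top_greatest[OF assms(2)] assms(3) by auto
  have "pos (nxt x) = pos y" using pos_nxt[OF assms(1) xt] s by simp
  then show "nxt x = y" using nxt_least[OF assms(1) xt assms(2,3)] pos_less[OF nxt_in[OF assms(1)] assms(2)] by auto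
qed

definition limit_pt :: "real \<Rightarrow> bool" where
  "limit_pt s \<longleftrightarrow> s \<in> {0..len} \<and> (\<forall>x\<in>V. s \<notin> seg x)"

lemma limit_pt_below:
  assumes s: "limit_pt s" and x: "x \<in> V" "pos x \<le> s"
  shows "pos x + weight x < s" "nxt x \<in> V" "x \<lhd> nxt x" "pos (nxt x) \<le> s"
proof -
  show 1: "pos x + weight x < s" using s x by (auto simp: limit_pt_def seg_def)
  have "x \<noteq> top" using 1 pos_top s by (auto simp: limit_pt_def)
  then show "nxt x \<in> V" "x \<lhd> nxt x" "pos (nxt x) \<le> s"
    using nxt_in less_nxt pos_nxt x 1 by simp_all
qed

lemma limit_pt_above:
  assumes s: "limit_pt s" and x: "x \<in> V" "s < pos x"
  obtains w where "w \<in> V" "w \<lhd> x" "s < pos w"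
proof -
  have "x \<noteq> bot" using x(2) pos_bot s by (auto simp: limit_pt_def)
  then obtain w where w: "w \<in> V" "w \<noteq> top" "nxt w = x" using prev[OF x(1)] by blast
  have "\<not> pos w \<le> s"
    using limit_pt_below(1)[OF s w(1)] pos_nxt[OF w(1,2)] w(3) x(2) by auto
  then show ?thesis using that[OF w(1)] less_nxt[OF w(1,2)] w(3) by simp
qed

text \<open>There is no last vertex before a limit point, as the successor of such a vertex would come
  before the limit point too.\<close>

lemma limit_pt_approx_below:
  assumes s: "limit_pt s" and "finite \<Phi>" "\<Phi> \<subseteq> V" "\<forall>x\<in>\<Phi>. pos x \<le> s"
  shows "\<exists>a\<in>V. pos a < s \<and> (\<forall>x\<in>\<Phi>. x \<lhd> a)"
  using assms(2-4)
proof (induction \<Phi> rule: finite_induct)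
  case empty
  have "pos bot \<le> s" using s pos_bot by (simp add: limit_pt_def)
  then have "pos bot < s" using limit_pt_below(1)[OF s bot_in] weight_pos[of bot] by simp
  then show ?case using bot_in by blast
next
  case (insert x \<Phi>)
  then obtain a where a: "a \<in> V" "pos a < s" "\<forall>x\<in>\<Phi>. x \<lhd> a" by auto
  have x: "x \<in> V" "pos x \<le> s" using insert.prems by simp_all
  \<comment> \<open>If \<open>a\<close> does not come after \<open>x\<close>, the successor of \<open>x\<close> comes after both.\<close>
  define b where "b = (if x \<lhd> a then a else nxt x)"
  have "b \<in> V \<and> pos b < s \<and> (\<forall>y\<in>insert x \<Phi>. y \<lhd> b)"
  proof (cases "x \<lhd> a")
    case False
    note n = limit_pt_below[OF s x]
    have "pos (nxt x) < s" using limit_pt_below(1)[OF s n(2,4)] weight_pos[of "nxt x"] by simp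
    moreover have "a \<lhd> nxt x" using False n(3) total[OF a(1) x(1)] trans[of a x "nxt x"] by auto
    ultimately show ?thesis using a n False trans by (auto simp: b_def)
  qed (use a in \<open>simp add: b_def\<close>)
  then show ?case by blast
qed

lemma limit_pt_approx_above:
  assumes s: "limit_pt s" and "finite \<Phi>" "\<Phi> \<subseteq> V" "\<forall>x\<in>\<Phi>. s < pos x"
  shows "\<exists>b\<in>V. s < pos b \<and> (\<forall>x\<in>\<Phi>. b \<lhd> x)"
  using assms(2-4)
proof (induction \<Phi> rule: finite_induct)
  case empty
  have "pos top > s"
  proof (rule ccontr)
    assume "\<not> pos top > s"
    then have "pos top + weight top < s" using limit_pt_below(1)[OF s top_in] by simp
    then show False using pos_top s by (simp add: limit_pt_def)
  qed
  then show ?case using top_in by blast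
next
  case (insert x \<Phi>)
  then obtain b where b: "b \<in> V" "s < pos b" "\<forall>x\<in>\<Phi>. b \<lhd> x" by auto
  have x: "x \<in> V" "s < pos x" using insert.prems by simp_all
  obtain w where w: "w \<in> V" "w \<lhd> x" "s < pos w" using limit_pt_above[OF s x] .
  define c where "c = (if b \<lhd> x then b else w)"
  have "c \<in> V \<and> s < pos c \<and> (\<forall>y\<in>insert x \<Phi>. c \<lhd> y)"
  proof (cases "b \<lhd> x")
    case False
    then have "w \<lhd> b" using w total[OF b(1) x(1)] trans[of w x b] by auto
    then show ?thesis using b w False trans by (auto simp: c_def)
  qed (use b in \<open>simp add: c_def\<close>)
  then show ?case by blast
qed

text \<open>If no vertex lay between the limit points \<open>s\<close> and \<open>s'\<close>, then \<open>s' - s\<close> would be at most the weight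
  of the vertices between two vertices chosen close to \<open>s\<close> and \<open>s'\<close>. They can be
  chosen so that the latter avoid a given finite set, and then their weight is arbitrarily small.\<close>

lemma limit_pt_unique:
  assumes s: "limit_pt s" and s': "limit_pt s'" and eq: "\<forall>x\<in>V. pos x \<le> s \<longleftrightarrow> pos x \<le> s'"
  shows "\<not> s < s'"
proof
  assume "s < s'"
  then obtain \<Phi> where \<Phi>: "finite \<Phi>" "\<Phi> \<subseteq> V" "total_weight (V - \<Phi>) < s' - s"
    using total_weight_tail[of "s' - s"] by auto
  obtain a where a: "a \<in> V" "pos a < s" "\<forall>x\<in>{x\<in>\<Phi>. pos x \<le> s}. x \<lhd> a"
  proof -
    have "finite {x\<in>\<Phi>. pos x \<le> s}" "{x\<in>\<Phi>. pos x \<le> s} \<subseteq> V" "\<forall>x\<in>{x\<in>\<Phi>. pos x \<le> s}. pos x \<le> s"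
      using \<Phi> by auto
    from limit_pt_approx_below[OF s this] show ?thesis using that by (elim bexE conjE)
  qed
  obtain b where b: "b \<in> V" "s' < pos b" "\<forall>x\<in>{x\<in>\<Phi>. s' < pos x}. b \<lhd> x"
  proof -
    have "finite {x\<in>\<Phi>. s' < pos x}" "{x\<in>\<Phi>. s' < pos x} \<subseteq> V" "\<forall>x\<in>{x\<in>\<Phi>. s' < pos x}. s' < pos x"
      using \<Phi> by auto
    from limit_pt_approx_above[OF s' this] show ?thesis using that by (elim bexE conjE)
  qed
  have ab: "a \<lhd> b" using a b \<open>s < s'\<close> pos_le_iff[OF b(1) a(1)] total[OF a(1) b(1)] by force
  let ?A = "{z \<in> V. z \<lhd> a}" and ?B = "{z \<in> V. \<not> z \<lhd> a \<and> z \<lhd> b}"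
  have "{z \<in> V. z \<lhd> b} = ?A \<union> ?B" using ab trans by auto
  moreover have "total_weight (?A \<union> ?B) = total_weight ?A + total_weight ?B"
    by (rule total_weight_Un) auto
  ultimately have "pos b = pos a + total_weight ?B" by (simp add: pos_def)
  moreover have "?B \<subseteq> V - \<Phi>"
  proof
    fix z assume z: "z \<in> ?B"
    have "z \<notin> \<Phi>"
    proof
      assume "z \<in> \<Phi>"
      show False
      proof (cases "pos z \<le> s")
        case True
        then show ?thesis using a(3) z \<open>z \<in> \<Phi>\<close> by auto
      next
        case False
        then have "\<not> pos z \<le> s'" using eq z by auto
        then have "b \<lhd> z" using b(3) \<open>z \<in> \<Phi>\<close> by auto
        then show ?thesis using z asym by auto
      qed
    qed
    then show "z \<in> V - \<Phi>" using z by simp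
  qed
  then have "total_weight ?B \<le> total_weight (V - \<Phi>)" by (rule total_weight_mono) auto
  ultimately show False using a(2) b(2) \<Phi>(3) by simp
qed

end

context circular_layout
begin

subsection \<open>The end at a limit point\<close>

text \<open>The vertices that lie in the same gap of \<open>F n\<close> as \<open>s\<close>.\<close>

definition gap_at :: "nat \<Rightarrow> real \<Rightarrow> 'a set" where
  "gap_at n s = {u \<in> V - F n. \<forall>x\<in>F n. x \<lhd> u \<longleftrightarrow> pos x \<le> s}"

lemma F_le: "n \<le> m \<Longrightarrow> F n \<subseteq> F m"
  using F_mono by (rule lift_Suc_mono_le)

lemma F_sub: "F n \<subseteq> V"
  using F_exhausts by auto

lemma finite_sub_F:
  assumes "finite S" "S \<subseteq> V"
  obtains n where "S \<subseteq> F n"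
proof -
  have "\<exists>n. S \<subseteq> F n" using assms
  proof (induction S rule: finite_induct)
    case (insert x S)
    then obtain n where n: "S \<subseteq> F n" by auto
    have "x \<in> (\<Union>n. F n)" using insert.prems F_exhausts by simp
    then obtain m where m: "x \<in> F m" by blast
    have "insert x S \<subseteq> F (max n m)"
      using n m F_le[of n "max n m"] F_le[of m "max n m"] by auto
    then show ?case by blast
  qed simp
  then show ?thesis using that by blast
qed

lemma gap_at_dec: "gap_at (Suc n) s \<subseteq> gap_at n s"
  using F_mono[of n] by (auto simp: gap_at_def)

text \<open>A gap that is not empty is a component of \<open>H - F n\<close>.\<close>

lemma gap_at_linked:
  assumes "u \<in> gap_at n s"
  shows "w \<in> gap_at n s \<longleftrightarrow> (u, w) \<in> linked (del_verts H (F n))"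
proof
  assume "w \<in> gap_at n s"
  then show "(u, w) \<in> linked (del_verts H (F n))"
    using gaps[of u n w] assms by (simp add: gap_at_def)
next
  assume l: "(u, w) \<in> linked (del_verts H (F n))"
  then have w: "w \<in> V - F n" by (auto simp: linked_def del_verts_def)
  then show "w \<in> gap_at n s" using gaps[of u n w] assms l by (simp add: gap_at_def)
qed

lemma gap_at_convex:
  assumes "a \<in> gap_at n s" "b \<in> gap_at n s" "x \<in> V" "a = x \<or> a \<lhd> x" "x = b \<or> x \<lhd> b"
  shows "x \<in> gap_at n s"
proof -
  have "y \<lhd> x \<longleftrightarrow> pos y \<le> s" if "y \<in> F n" for y
  proof -
    have "y \<lhd> a \<longleftrightarrow> pos y \<le> s" "y \<lhd> b \<longleftrightarrow> pos y \<le> s" using assms(1,2) that by (simp_all add: gap_at_def)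
    then show ?thesis using assms(4,5) trans by blast
  qed
  moreover have "x \<notin> F n"
  proof
    assume x: "x \<in> F n"
    then have "a \<noteq> x" "x \<noteq> b" "x \<lhd> a \<longleftrightarrow> x \<lhd> b" using assms(1,2) by (auto simp: gap_at_def)
    then show False using assms(4,5) asym by blast
  qed
  ultimately show ?thesis using assms(3) by (simp add: gap_at_def)
qed

lemma gap_at_sides:
  assumes s: "limit_pt s"
  shows "\<exists>a\<in>gap_at n s. pos a < s" "\<exists>b\<in>gap_at n s. s < pos b"
proof -
  have "finite {x\<in>F n. pos x \<le> s}" "{x\<in>F n. pos x \<le> s} \<subseteq> V" "\<forall>x\<in>{x\<in>F n. pos x \<le> s}. pos x \<le> s"
    using F_finite F_sub by auto
  from limit_pt_approx_below[OF s this] obtain a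
    where a: "a \<in> V" "pos a < s" "\<forall>x\<in>{x\<in>F n. pos x \<le> s}. x \<lhd> a" by (elim bexE conjE)
  have "x \<lhd> a \<longleftrightarrow> pos x \<le> s" if "x \<in> F n" for x
    using a that pos_less[of x a] F_sub[of n] by force
  moreover have "a \<notin> F n" using a irrefl[of a] by auto
  ultimately have "a \<in> gap_at n s" using a(1) by (simp add: gap_at_def)
  then show "\<exists>a\<in>gap_at n s. pos a < s" using a(2) by blast
  have "finite {x\<in>F n. s < pos x}" "{x\<in>F n. s < pos x} \<subseteq> V" "\<forall>x\<in>{x\<in>F n. s < pos x}. s < pos x"
    using F_finite F_sub by auto
  from limit_pt_approx_above[OF s this] obtain b
    where b: "b \<in> V" "s < pos b" "\<forall>x\<in>{x\<in>F n. s < pos x}. b \<lhd> x" by (elim bexE conjE)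
  have "b \<notin> F n" using b irrefl[of b] by auto
  have "x \<lhd> b \<longleftrightarrow> pos x \<le> s" if x: "x \<in> F n" for x
  proof (cases "pos x \<le> s")
    case True
    then have "pos x < pos b" using b(2) by simp
    then have "x \<lhd> b" using pos_le_iff[OF b(1), of x] total[OF b(1), of x] x F_sub[of n] by force
    then show ?thesis using True by simp
  next
    case False
    then have "b \<lhd> x" using b(3) x by auto
    then show ?thesis using False asym by blast
  qed
  with \<open>b \<notin> F n\<close> have "b \<in> gap_at n s" using b(1) by (simp add: gap_at_def)
  then show "\<exists>b\<in>gap_at n s. s < pos b" using b(2) by blast
qed

lemma ray_at_limit_pt:
  assumes s: "limit_pt s"
  shows "\<exists>r. ray H r \<and> (\<forall>n. \<exists>i. \<forall>j\<ge>i. r j \<in> gap_at n s)"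
proof (rule ray_through_nested_sets)
  show "gap_at n s \<noteq> {}" for n using gap_at_sides(1)[OF s] by blast
  show "(\<Inter>n. gap_at n s) = {}"
  proof -
    have "u \<notin> (\<Inter>n. gap_at n s)" for u
    proof
      assume u: "u \<in> (\<Inter>n. gap_at n s)"
      then have "u \<in> V" by (auto simp: gap_at_def)
      then obtain n where "u \<in> F n" using F_exhausts by blast
      moreover have "u \<in> gap_at n s" using u by blast
      ultimately show False by (simp add: gap_at_def)
    qed
    then show ?thesis by blast
  qed
  show "gap_at 0 s \<subseteq> verts H" by (auto simp: gap_at_def)
  fix n x y assume x: "x \<in> gap_at n s" and y: "y \<in> gap_at n s"
  let ?R = "{(x, y). x \<in> gap_at n s \<and> y \<in> gap_at n s \<and> {x, y} \<in> edges H}"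
  have "(x, y) \<in> linked (del_verts H (F n))" using gap_at_linked[OF x] y by simp
  then have "(x, y) \<in> {(u, v). {u, v} \<in> edges (del_verts H (F n))}\<^sup>*" by (simp add: linked_def)
  then have "(x, y) \<in> ?R\<^sup>* \<and> y \<in> gap_at n s"
  proof (induction rule: rtrancl_induct)
    case (step u v)
    then have e: "{u, v} \<in> edges H" "v \<notin> F n" by (auto simp: del_verts_def)
    obtain a b where "a \<in> V" "b \<in> V" "{u, v} = {a, b}" using edgeE[OF graph e(1)] by metis
    then have "v \<in> V" by auto
    then have "(u, v) \<in> linked (del_verts H (F n))"
      using step e by (auto simp: linked_def del_verts_def gap_at_def)
    then have v: "v \<in> gap_at n s" using gap_at_linked step.IH by blast
    then have "(u, v) \<in> ?R" using step.IH e(1) by simp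
    then show ?case using step.IH v by (meson rtrancl_into_rtrancl)
  qed (use x in simp)
  then show "(x, y) \<in> ?R\<^sup>*" by simp
qed (rule gap_at_dec)

text \<open>There is only one such end: every finite set of vertices lies in some \<open>F n\<close>, so it does not
  separate two rays that both run into all the gaps.\<close>

definition end_at :: "real \<Rightarrow> (nat \<Rightarrow> 'a) set" where
  "end_at s = (SOME \<omega>. \<omega> \<in> vertex_ends H \<and> (\<exists>r\<in>\<omega>. \<forall>n. \<exists>i. \<forall>j\<ge>i. r j \<in> gap_at n s))"

lemma end_at:
  assumes "limit_pt s"
  shows "end_at s \<in> vertex_ends H" "\<exists>r\<in>end_at s. \<forall>n. \<exists>i. \<forall>j\<ge>i. r j \<in> gap_at n s"
proof -
  obtain r where r: "ray H r" "\<forall>n. \<exists>i. \<forall>j\<ge>i. r j \<in> gap_at n s" using ray_at_limit_pt[OF assms] by blast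
  obtain \<omega> where "\<omega> \<in> vertex_ends H" "r \<in> \<omega>" using vertex_end_of_ray[OF r(1)] .
  with r(2) have "\<exists>\<omega>. \<omega> \<in> vertex_ends H \<and> (\<exists>r\<in>\<omega>. \<forall>n. \<exists>i. \<forall>j\<ge>i. r j \<in> gap_at n s)" by blast
  from someI_ex[OF this] show "end_at s \<in> vertex_ends H" "\<exists>r\<in>end_at s. \<forall>n. \<exists>i. \<forall>j\<ge>i. r j \<in> gap_at n s"
    unfolding end_at_def by blast+
qed

text \<open>Every finite \<open>S\<close> is contained in some \<open>F n\<close>, and then the gap, being connected in \<open>H - F n\<close>, lies
  in a single component of \<open>H - S\<close>.\<close>

lemma gap_at_in_component:
  assumes S: "finite S" "S \<subseteq> F n" and s: "limit_pt s"
    and C: "C \<in> components (del_verts H S)"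
    and u: "u \<in> gap_at n s" "u \<in> verts C"
  shows "gap_at n s \<subseteq> verts C"
    and "\<And>r i. ray H r \<Longrightarrow> \<forall>j\<ge>i. r j \<in> gap_at n s \<Longrightarrow> ray C (\<lambda>k. r (k + i))"
proof -
  show sub: "gap_at n s \<subseteq> verts C"
  proof
    fix w assume "w \<in> gap_at n s"
    then have l: "(u, w) \<in> linked (del_verts H (F n))" using gap_at_linked[OF u(1)] by simp
    have "{(u, v). {u, v} \<in> edges (del_verts H (F n))}\<^sup>* \<subseteq> {(u, v). {u, v} \<in> edges (del_verts H S)}\<^sup>*"
      by (rule rtrancl_mono) (use S(2) in \<open>auto simp: del_verts_def\<close>)
    then have "(u, w) \<in> linked (del_verts H S)"
      using l S(2) by (auto simp: linked_def del_verts_def)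
    then show "w \<in> verts C" using component_linked[OF C u(2)] by simp
  qed
  fix r :: "nat \<Rightarrow> 'a" and i assume r: "ray H r" "\<forall>j\<ge>i. r j \<in> gap_at n s"
  show "ray C (\<lambda>k. r (k + i))"
  proof (rule ray_tail_in_component[OF C])
    show "inj r" using r(1) by (simp add: ray_def)
    show "r j \<in> verts C" if "i \<le> j" for j using r(2) sub that by blast
    show "{r j, r (Suc j)} \<in> edges (del_verts H S)" if "i \<le> j" for j
    proof -
      have "r j \<notin> S" "r (Suc j) \<notin> S" using r(2) that S(2) by (auto simp: gap_at_def)
      then show ?thesis using r(1) by (simp add: ray_def del_verts_def)
    qed
  qed
qed

text \<open>Different limit points are separated by a vertex, hence by some \<open>F n\<close>, whose gaps around them are
  different components.\<close>

lemma end_at_inj: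
  assumes s: "limit_pt s" and s': "limit_pt s'" and eq: "end_at s = end_at s'"
  shows "s = s'"
proof -
  obtain r where r: "r \<in> end_at s" "\<forall>n. \<exists>i. \<forall>j\<ge>i. r j \<in> gap_at n s" using end_at[OF s] by blast
  obtain r' where r': "r' \<in> end_at s" "\<forall>n. \<exists>i. \<forall>j\<ge>i. r' j \<in> gap_at n s'" using end_at[OF s'] eq by auto
  have "vertex_equivalent H r r'"
    using vertex_ends_eq_iff[OF end_at(1)[OF s] end_at(1)[OF s] r(1) r'(1)] by simp
  have "\<forall>x\<in>F n. pos x \<le> s \<longleftrightarrow> pos x \<le> s'" for n
  proof -
    obtain C where C: "C \<in> components (del_verts H (F n))" "tail_in C r" "tail_in C r'"
      using \<open>vertex_equivalent H r r'\<close> F_finite[of n] F_sub[of n] unfolding vertex_equivalent_def by blast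
    obtain i where i: "\<forall>j\<ge>i. r j \<in> verts C" using tail_in_eventually[OF C(2)] by (elim exE)
    obtain i' where i': "\<forall>j\<ge>i'. r' j \<in> verts C" using tail_in_eventually[OF C(3)] by (elim exE)
    obtain k where k: "\<forall>j\<ge>k. r j \<in> gap_at n s" using r(2) by blast
    obtain k' where k': "\<forall>j\<ge>k'. r' j \<in> gap_at n s'" using r'(2) by blast
    define u w where "u = r (max i k)" and "w = r' (max i' k')"
    have u: "u \<in> verts C" "u \<in> gap_at n s" and w: "w \<in> verts C" "w \<in> gap_at n s'"
      using i k i' k' by (simp_all add: u_def w_def)
    have "(u, w) \<in> linked (del_verts H (F n))" using component_linked[OF C(1) u(1)] w(1) by simp
    then have "\<forall>x\<in>F n. x \<lhd> u \<longleftrightarrow> x \<lhd> w" using gaps[of u n w] u w by (simp add: gap_at_def)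
    then show ?thesis using u(2) w(2) by (simp add: gap_at_def)
  qed
  then have "\<forall>x\<in>V. pos x \<le> s \<longleftrightarrow> pos x \<le> s'" using F_exhausts by blast
  then show ?thesis using limit_pt_unique[OF s s'] limit_pt_unique[OF s' s] by force
qed


subsection \<open>The curve\<close>

definition seg_pt :: "'a \<Rightarrow> real \<Rightarrow> 'a space_pt" where
  "seg_pt x s = Pt (edge_pt x (nxt x) ((s - pos x) / weight x))"

text \<open>A point that lies in two segments is their common endpoint, where both descriptions give the
  same vertex; see \<open>seg_pt_unique\<close>.\<close>

definition curve :: "real \<Rightarrow> 'a space_pt" where
  "curve s = (if limit_pt s then End (end_at s) else seg_pt (SOME x. x \<in> V \<and> s \<in> seg x) s)"

lemma seg_pt_start: "seg_pt x (pos x) = Pt (vertex_pt x)"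
  by (simp add: seg_pt_def edge_pt_0)

lemma seg_pt_finish: "x \<in> V \<Longrightarrow> seg_pt x (pos x + weight x) = Pt (vertex_pt (nxt x))"
  using weight_pos[of x] nxt_ne[of x] edge_pt_1[of x "nxt x"] by (simp add: seg_pt_def)

lemma seg_pt_unique:
  assumes "x \<in> V" "y \<in> V" "s \<in> seg x" "s \<in> seg y"
  shows "seg_pt x s = seg_pt y s"
proof -
  have *: "seg_pt x s = seg_pt y s" if xy: "x \<in> V" "y \<in> V" "x \<lhd> y" "s \<in> seg x" "s \<in> seg y" for x y
  proof -
    note c = seg_common[OF xy]
    have "seg_pt x s = Pt (vertex_pt y)" using seg_pt_finish[OF xy(1)] c(1,3) by simp
    moreover have "seg_pt y s = Pt (vertex_pt y)" using seg_pt_start[of y] c(2) by simp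
    ultimately show ?thesis by simp
  qed
  show ?thesis using *[of x y] *[of y x] total[of x y] assms by metis
qed

lemma curve_seg:
  assumes "x \<in> V" "s \<in> seg x"
  shows "curve s = seg_pt x s"
proof -
  have "\<not> limit_pt s" using assms by (auto simp: limit_pt_def)
  moreover have "\<exists>x. x \<in> V \<and> s \<in> seg x" using assms by blast
  from someI_ex[OF this] have "seg_pt (SOME x. x \<in> V \<and> s \<in> seg x) s = seg_pt x s"
    using seg_pt_unique assms by blast
  ultimately show ?thesis by (simp add: curve_def)
qed

lemma curve_limit: "limit_pt s \<Longrightarrow> curve s = End (end_at s)"
  by (simp add: curve_def)

lemma pos_in_seg: "pos x \<in> seg x"
  using weight_pos[of x] by (simp add: seg_def)

lemma curve_pos: "x \<in> V \<Longrightarrow> curve (pos x) = Pt (vertex_pt x)"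
  using curve_seg[OF _ pos_in_seg] seg_pt_start by simp

lemma curve_closed: "curve 0 = curve len"
proof -
  have "len \<in> seg top" using pos_top weight_pos[of top] by (simp add: seg_def)
  then have "curve len = Pt (vertex_pt bot)"
    using curve_seg[OF top_in] seg_pt_finish[OF top_in] pos_top nxt_top by simp
  then show ?thesis using curve_pos[OF bot_in] pos_bot by simp
qed

lemma continuous_seg:
  assumes "x \<in> V"
  shows "continuous_map (top_of_set (seg x)) (MTOP H) curve"
proof -
  let ?h = "\<lambda>s. (s - pos x) / weight x"
  have w: "0 < weight x" by (rule weight_pos)
  have "continuous_on (seg x) ?h" by (intro continuous_intros) (use w in auto)
  moreover have "?h ` seg x \<subseteq> {0..1}" using w by (auto simp: seg_def field_simps)
  ultimately have h: "continuous_map (top_of_set (seg x)) (top_of_set {0..1}) ?h"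
    by (auto simp: continuous_map_in_subtopology)
  have "continuous_map (top_of_set (seg x)) (MTOP H) ((\<lambda>\<tau>. Pt (edge_pt x (nxt x) \<tau>)) \<circ> ?h)"
    by (rule continuous_map_compose[OF h continuous_edge_path[OF graph nxt_edge[OF assms]]])
  then show ?thesis
    by (rule continuous_map_eq) (use curve_seg[OF assms] in \<open>simp add: seg_pt_def\<close>)
qed

lemma curve_near_on_seg:
  assumes x: "x \<in> V" "s \<in> seg x" and U: "openin (MTOP H) U" "curve s \<in> U"
  shows "\<exists>\<delta>>0. \<forall>t\<in>seg x. \<bar>t - s\<bar> < \<delta> \<longrightarrow> curve t \<in> U"
proof -
  have "openin (top_of_set (seg x)) {t \<in> topspace (top_of_set (seg x)). curve t \<in> U}"
    using openin_continuous_map_preimage[OF continuous_seg[OF x(1)] U(1)] .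
  then have "openin (top_of_set (seg x)) {t \<in> seg x. curve t \<in> U}" by simp
  then obtain \<delta> where "\<delta> > 0" "\<forall>t\<in>seg x. dist t s < \<delta> \<longrightarrow> t \<in> {t \<in> seg x. curve t \<in> U}"
    unfolding openin_euclidean_subtopology_iff using x(2) U(2) by blast
  then show ?thesis by (auto simp: dist_real_def)
qed

text \<open>At an endpoint of a segment the neighbouring segment covers the other side, except at the two
  ends of the whole interval.\<close>

lemma seg_neighbourhood:
  assumes x: "x \<in> V" "s \<in> seg x"
  shows "\<exists>y\<in>V. \<exists>z\<in>V. s \<in> seg y \<and> s \<in> seg z \<and>
    (\<exists>\<delta>>0. \<forall>t\<in>{0..len}. \<bar>t - s\<bar> < \<delta> \<longrightarrow> t \<in> seg y \<union> seg z)"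
proof -
  have w: "0 < weight u" for u by (rule weight_pos)
  have l: "\<exists>y\<in>V. s \<in> seg y \<and> (\<exists>\<delta>>0. \<forall>t\<in>{0..len}. t \<le> s \<and> \<bar>t - s\<bar> < \<delta> \<longrightarrow> t \<in> seg y)"
  proof (cases "s = pos x")
    case False
    then have "0 < s - pos x" using x(2) by (simp add: seg_def)
    moreover have "\<forall>t\<in>{0..len}. t \<le> s \<and> \<bar>t - s\<bar> < s - pos x \<longrightarrow> t \<in> seg x"
      using x(2) by (auto simp: seg_def)
    ultimately show ?thesis using x by blast
  next
    case s: True
    show ?thesis
    proof (cases "x = bot")
      case True
      then have "\<forall>t\<in>{0..len}. t \<le> s \<and> \<bar>t - s\<bar> < 1 \<longrightarrow> t \<in> seg x"
        using s pos_bot x(2) by (auto simp: seg_def)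
      then show ?thesis using x zero_less_one by blast
    next
      case False
      then obtain u where u: "u \<in> V" "u \<noteq> top" "nxt u = x" using prev[OF x(1)] by blast
      then have su: "s = pos u + weight u" using pos_nxt[OF u(1,2)] s by simp
      then have "s \<in> seg u" "\<forall>t\<in>{0..len}. t \<le> s \<and> \<bar>t - s\<bar> < weight u \<longrightarrow> t \<in> seg u"
        using w[of u] by (auto simp: seg_def)
      then show ?thesis using u(1) w[of u] by blast
    qed
  qed
  have r: "\<exists>z\<in>V. s \<in> seg z \<and> (\<exists>\<delta>>0. \<forall>t\<in>{0..len}. s \<le> t \<and> \<bar>t - s\<bar> < \<delta> \<longrightarrow> t \<in> seg z)"
  proof (cases "s = pos x + weight x")
    case False
    then have "0 < pos x + weight x - s" using x(2) by (simp add: seg_def)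
    moreover have "\<forall>t\<in>{0..len}. s \<le> t \<and> \<bar>t - s\<bar> < pos x + weight x - s \<longrightarrow> t \<in> seg x"
      using x(2) by (auto simp: seg_def)
    ultimately show ?thesis using x by blast
  next
    case s: True
    show ?thesis
    proof (cases "x = top")
      case True
      then have "\<forall>t\<in>{0..len}. s \<le> t \<and> \<bar>t - s\<bar> < 1 \<longrightarrow> t \<in> seg x"
        using s pos_top x(2) by (auto simp: seg_def)
      then show ?thesis using x zero_less_one by blast
    next
      case False
      have su: "s = pos (nxt x)" using pos_nxt[OF x(1) False] s by simp
      have "\<forall>t\<in>{0..len}. s \<le> t \<and> \<bar>t - s\<bar> < weight (nxt x) \<longrightarrow> t \<in> seg (nxt x)"
        unfolding su by (auto simp: seg_def)
      then show ?thesis using nxt_in[OF x(1)] pos_in_seg[of "nxt x"] su w[of "nxt x"] by blast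
    qed
  qed
  obtain y \<delta>1 where y: "y \<in> V" "s \<in> seg y" "\<delta>1 > 0" "\<forall>t\<in>{0..len}. t \<le> s \<and> \<bar>t - s\<bar> < \<delta>1 \<longrightarrow> t \<in> seg y"
    using l by (elim bexE exE conjE)
  obtain z \<delta>2 where z: "z \<in> V" "s \<in> seg z" "\<delta>2 > 0" "\<forall>t\<in>{0..len}. s \<le> t \<and> \<bar>t - s\<bar> < \<delta>2 \<longrightarrow> t \<in> seg z"
    using r by (elim bexE exE conjE)
  have "t \<in> seg y \<union> seg z" if t: "t \<in> {0..len}" "\<bar>t - s\<bar> < min \<delta>1 \<delta>2" for t
    using y(4) z(4) t by (cases "t \<le> s") auto
  then have "\<exists>\<delta>>0. \<forall>t\<in>{0..len}. \<bar>t - s\<bar> < \<delta> \<longrightarrow> t \<in> seg y \<union> seg z"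
    using y(3) z(3) by (intro exI[of _ "min \<delta>1 \<delta>2"]) simp
  then show ?thesis using y(1,2) z(1,2) by blast
qed

lemma curve_near_seg:
  assumes x: "x \<in> V" "s \<in> seg x" and U: "openin (MTOP H) U" "curve s \<in> U"
  shows "\<exists>\<delta>>0. \<forall>t\<in>{0..len}. \<bar>t - s\<bar> < \<delta> \<longrightarrow> curve t \<in> U"
proof -
  obtain y z \<delta> where yz: "y \<in> V" "z \<in> V" "s \<in> seg y" "s \<in> seg z"
    and \<delta>: "\<delta> > 0" "\<forall>t\<in>{0..len}. \<bar>t - s\<bar> < \<delta> \<longrightarrow> t \<in> seg y \<union> seg z"
    using seg_neighbourhood[OF x] by (elim bexE exE conjE)
  obtain \<delta>1 where d1: "\<delta>1 > 0" "\<forall>t\<in>seg y. \<bar>t - s\<bar> < \<delta>1 \<longrightarrow> curve t \<in> U"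
    using curve_near_on_seg[OF yz(1,3) U] by (elim exE conjE)
  obtain \<delta>2 where d2: "\<delta>2 > 0" "\<forall>t\<in>seg z. \<bar>t - s\<bar> < \<delta>2 \<longrightarrow> curve t \<in> U"
    using curve_near_on_seg[OF yz(2,4) U] by (elim exE conjE)
  have "curve t \<in> U" if t: "t \<in> {0..len}" "\<bar>t - s\<bar> < min \<delta> (min \<delta>1 \<delta>2)" for t
    using \<delta>(2) d1(2) d2(2) t by fastforce
  then show ?thesis using \<delta>(1) d1(1) d2(1) by (intro exI[of _ "min \<delta> (min \<delta>1 \<delta>2)"]) simp
qed

text \<open>Between two vertices of the gap the curve meets only vertices of the gap, edges between them,
  and ends whose own gap at stage \<open>n\<close> is the same.\<close>

lemma curve_between:
  assumes s: "limit_pt s" and ab: "a \<in> gap_at n s" "b \<in> gap_at n s"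
    and S: "finite S" "S \<subseteq> F n" and C: "C \<in> components (del_verts H S)" and KC: "gap_at n s \<subseteq> verts C"
    and t: "t \<in> {0..len}" "pos a < t" "t < pos b"
  shows "curve t \<in> end_nbhd H S C \<epsilon>"
proof -
  have aV: "a \<in> V" and bV: "b \<in> V" using ab by (auto simp: gap_at_def)
  show ?thesis
  proof (cases "limit_pt t")
    case False
    then obtain x where x: "x \<in> V" "t \<in> seg x" using t(1) by (auto simp: limit_pt_def)
    have ax: "a = x \<or> a \<lhd> x"
    proof (rule ccontr)
      assume "\<not> (a = x \<or> a \<lhd> x)"
      then have "pos x + weight x \<le> pos a" using total[OF aV x(1)] pos_step[OF x(1) aV] by blast
      then show False using x(2) t(2) by (simp add: seg_def)
    qed
    have xb: "x \<lhd> b"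
    proof (rule ccontr)
      assume "\<not> x \<lhd> b"
      then have "pos b \<le> pos x" using total[OF x(1) bV] pos_le_iff[OF bV x(1)] by blast
      then show False using x(2) t(3) by (simp add: seg_def)
    qed
    have xt: "x \<noteq> top" using top_greatest[OF bV] xb by auto
    have "nxt x = b \<or> nxt x \<lhd> b" by (rule nxt_least[OF x(1) xt bV xb])
    moreover have "a \<lhd> nxt x" using ax less_nxt[OF x(1) xt] trans by blast
    ultimately have "x \<in> verts C" "nxt x \<in> verts C"
      using gap_at_convex[OF ab x(1) ax] gap_at_convex[OF ab nxt_in[OF x(1)]] xb KC by blast+
    define \<tau> where "\<tau> = (t - pos x) / weight x"
    have w: "0 < weight x" by (rule weight_pos)
    have "\<tau> \<in> {0..1}" using x(2) w by (auto simp: \<tau>_def seg_def field_simps)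
    moreover have "curve t = Pt (edge_pt x (nxt x) \<tau>)" using curve_seg[OF x] by (simp add: seg_pt_def \<tau>_def)
    moreover have "edge_pt x (nxt x) \<tau> \<in> complex_pts C"
      using \<open>\<tau> \<in> {0..1}\<close>
    proof (cases rule: unit_interval_cases)
      case 1
      then show ?thesis using \<open>x \<in> verts C\<close> by (simp add: edge_pt_0 complex_pts_def)
    next
      case 2
      then show ?thesis using \<open>nxt x \<in> verts C\<close> nxt_ne[OF x(1)] edge_pt_1[of x "nxt x"] by (simp add: complex_pts_def)
    next
      case 3
      have "edge_pt x (nxt x) \<tau> \<in> inner_pts {x, nxt x}" using edge_pt_inner[OF _ 3] nxt_ne[OF x(1)] by metis
      moreover have "{x, nxt x} \<in> edges C"
        using edges_component_del_verts(1)[OF C] nxt_edge[OF x(1)] \<open>x \<in> verts C\<close> \<open>nxt x \<in> verts C\<close> by simp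
      ultimately show ?thesis unfolding complex_pts_def by blast
    qed
    ultimately show ?thesis by (simp add: end_nbhd_def)
  next
    case True
    have "pos x \<le> t \<longleftrightarrow> pos x \<le> s" if x: "x \<in> F n" for x
    proof (cases "pos x \<le> s")
      case True
      then have "x \<lhd> a" using ab(1) x by (simp add: gap_at_def)
      then show ?thesis using True pos_less[of x a] x F_sub[of n] aV t(2) by auto
    next
      case False
      then have "\<not> x \<lhd> b" "x \<noteq> b" using ab(2) x by (auto simp: gap_at_def)
      then have "b \<lhd> x" using total[OF bV, of x] x F_sub[of n] by auto
      then show ?thesis using False pos_less[of b x] x F_sub[of n] bV t(3) by auto
    qed
    then have K: "gap_at n t = gap_at n s" by (simp add: gap_at_def)
    obtain r where r: "r \<in> end_at t" "\<forall>n. \<exists>i. \<forall>j\<ge>i. r j \<in> gap_at n t" using end_at[OF True] by blast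
    then obtain i where i: "\<forall>j\<ge>i. r j \<in> gap_at n s" using K by metis
    have "ray C (\<lambda>k. r (k + i))"
      using gap_at_in_component(2)[OF S s C ab(1) subsetD[OF KC ab(1)] vertex_end_ray[OF end_at(1)[OF True] r(1)] i] .
    moreover have "(\<lambda>k. r (k + i)) \<in> end_at t" using vertex_end_tail[OF end_at(1)[OF True] r(1)] .
    ultimately show ?thesis using end_at(1)[OF True] curve_limit[OF True] unfolding end_nbhd_def by auto
  qed
qed

text \<open>For large \<open>n\<close> the gap at \<open>s\<close> lies inside \<open>C\<close>, and it contains vertices on both sides of \<open>s\<close>.\<close>

lemma curve_near_limit:
  assumes s: "limit_pt s" and S: "finite S" "S \<subseteq> V" and C: "C \<in> components (del_verts H S)"
    and U: "curve s \<in> end_nbhd H S C \<epsilon>"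
  shows "\<exists>\<delta>>0. \<forall>t\<in>{0..len}. \<bar>t - s\<bar> < \<delta> \<longrightarrow> curve t \<in> end_nbhd H S C \<epsilon>"
proof -
  obtain n where n: "S \<subseteq> F n" using finite_sub_F[OF S] .
  obtain r where r: "r \<in> end_at s" "\<forall>n. \<exists>i. \<forall>j\<ge>i. r j \<in> gap_at n s" using end_at[OF s] by blast
  obtain i where i: "\<forall>j\<ge>i. r j \<in> gap_at n s" using r(2) by blast
  obtain r' where r': "r' \<in> end_at s" "ray C r'" using U curve_limit[OF s] by (auto simp: end_nbhd_def)
  have u: "r i \<in> gap_at n s" using i by simp
  then have "r i \<in> verts (del_verts H S)" using n by (auto simp: gap_at_def del_verts_def)
  from in_component[OF this] obtain C' where C': "C' \<in> components (del_verts H S)" "r i \<in> verts C'" .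
  note K = gap_at_in_component[OF S(1) n s C'(1) u C'(2)]
  have "ray C' (\<lambda>k. r (k + i))" by (rule K(2)[OF vertex_end_ray[OF end_at(1)[OF s] r(1)] i])
  then have "tail_in C' r" unfolding tail_in_def by (rule exI)
  then have "C' = C"
    by (rule vertex_end_component_unique[OF end_at(1)[OF s] S C'(1) C r(1) _ r'(1) ray_tail_in[OF r'(2)]])
  then have KC: "gap_at n s \<subseteq> verts C" using K(1) by simp
  obtain a where a: "a \<in> gap_at n s" "pos a < s" using gap_at_sides(1)[OF s] by blast
  obtain b where b: "b \<in> gap_at n s" "s < pos b" using gap_at_sides(2)[OF s] by blast
  have "curve t \<in> end_nbhd H S C \<epsilon>" if t: "t \<in> {0..len}" "\<bar>t - s\<bar> < min (s - pos a) (pos b - s)" for t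
  proof -
    have "pos a < t" "t < pos b" using t(2) by linarith+
    from curve_between[OF s a(1) b(1) S(1) n C KC t(1) this] show ?thesis .
  qed
  then show ?thesis using a(2) b(2) by (intro exI[of _ "min (s - pos a) (pos b - s)"]) simp
qed

lemma curve_in_topspace:
  assumes "s \<in> {0..len}"
  shows "curve s \<in> topspace (MTOP H)"
proof (cases "limit_pt s")
  case True
  obtain C where C: "C \<in> components (del_verts H {})" "\<exists>r\<in>end_at s. ray C r"
    using vertex_end_component[OF end_at(1)[OF True], of "{}"] by auto
  have "openin (MTOP H) (end_nbhd H {} C 1)"
    using openin_MTOP_end[OF _ _ end_at(1)[OF True] C] by simp
  moreover have "curve s \<in> end_nbhd H {} C 1"
    using end_at(1)[OF True] C(2) curve_limit[OF True] by (simp add: end_nbhd_def)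
  ultimately show ?thesis using openin_subset by blast
next
  case False
  then obtain x where x: "x \<in> V" "s \<in> seg x" using assms by (auto simp: limit_pt_def)
  then show ?thesis using continuous_map_image_subset_topspace[OF continuous_seg[OF x(1)]] by auto
qed

lemma continuous_curve: "continuous_map (top_of_set {0..len}) (MTOP H) curve"
  unfolding MTOP_def
proof (rule continuous_on_generated_topo)
  fix U assume U: "U \<in> {Pt ` W | e W. e \<in> edges H \<and> open_in_edge e W}
      \<union> {Pt ` open_star H v \<epsilon> | v \<epsilon>. v \<in> V \<and> 0 < \<epsilon> \<and> \<epsilon> < 1} \<union> MTOP_end_nbhds H"
  have op: "openin (MTOP H) U" unfolding MTOP_def by (rule topology_generated_by_Basis[OF U])
  have "\<exists>\<delta>>0. \<forall>t\<in>{0..len}. \<bar>t - s\<bar> < \<delta> \<longrightarrow> curve t \<in> U" if s: "s \<in> {0..len}" "curve s \<in> U" for s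
  proof (cases "limit_pt s")
    case False
    then obtain x where "x \<in> V" "s \<in> seg x" using s(1) by (auto simp: limit_pt_def)
    from curve_near_seg[OF this op s(2)] show ?thesis .
  next
    case lim: True
    from U show ?thesis
    proof (cases rule: MTOP_subbasis_cases)
      case (nbhd S C \<epsilon>)
      from curve_near_limit[OF lim nbhd(1-3), of \<epsilon>] s(2) show ?thesis unfolding nbhd(5) .
    qed (use s(2) curve_limit[OF lim] in auto)
  qed
  then have "openin (top_of_set {0..len}) {t \<in> {0..len}. curve t \<in> U}"
    unfolding openin_euclidean_subtopology_iff by (fastforce simp: dist_real_def)
  then show "openin (top_of_set {0..len}) (curve -` U \<inter> topspace (top_of_set {0..len}))"
    by (simp add: vimage_def Int_def conj_commute)
next
  show "curve ` topspace (top_of_set {0..len}) \<subseteq> \<Union> ({Pt ` W | e W. e \<in> edges H \<and> open_in_edge e W}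
      \<union> {Pt ` open_star H v \<epsilon> | v \<epsilon>. v \<in> V \<and> 0 < \<epsilon> \<and> \<epsilon> < 1} \<union> MTOP_end_nbhds H)"
    unfolding topology_generated_by_topspace[symmetric] MTOP_def[symmetric]
    using curve_in_topspace by auto
qed

text \<open>With half-open segments every point other than a limit point has unique coordinates.\<close>

lemma half_open_seg:
  assumes s: "s \<in> {0..<len}" "\<not> limit_pt s"
  obtains x \<tau> where "x \<in> V" "0 \<le> \<tau>" "\<tau> < 1" "s = pos x + \<tau> * weight x" "curve s = Pt (edge_pt x (nxt x) \<tau>)"
proof -
  have "s \<in> {0..len}" using s(1) by simp
  then obtain y where y: "y \<in> V" "s \<in> seg y" using s(2) unfolding limit_pt_def by blast
  define x where "x = (if s = pos y + weight y then nxt y else y)"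
  have x: "x \<in> V \<and> s \<in> seg x \<and> s < pos x + weight x"
  proof (cases "s = pos y + weight y")
    case True
    then have "y \<noteq> top" using s(1) pos_top by auto
    then have "s = pos (nxt y)" using pos_nxt[OF y(1)] True by simp
    then show ?thesis using True nxt_in[OF y(1)] pos_in_seg[of "nxt y"] weight_pos[of "nxt y"] by (simp add: x_def)
  next
    case False
    then show ?thesis using y by (auto simp: x_def seg_def)
  qed
  have w: "0 < weight x" by (rule weight_pos)
  define \<tau> where "\<tau> = (s - pos x) / weight x"
  have "0 \<le> \<tau>" "\<tau> < 1" "s = pos x + \<tau> * weight x" using x w by (auto simp: \<tau>_def seg_def field_simps)
  moreover have "curve s = Pt (edge_pt x (nxt x) \<tau>)" using curve_seg[of x s] x by (simp add: seg_pt_def \<tau>_def)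
  ultimately show ?thesis using that x by blast
qed

text \<open>The set of non-zero coordinates of the point is \<open>{x}\<close> or \<open>{x, nxt x}\<close>, and different vertices span
  different edges since there are at least three vertices.\<close>

lemma edge_pt_nxt_inj:
  assumes "x \<in> V" "y \<in> V" "0 \<le> \<tau>" "\<tau> < 1" "0 \<le> \<sigma>" "\<sigma> < 1"
    and eq: "edge_pt x (nxt x) \<tau> = edge_pt y (nxt y) \<sigma>"
  shows "x = y \<and> \<tau> = \<sigma>"
proof -
  have ne: "x \<noteq> nxt x" "y \<noteq> nxt y" using nxt_ne assms(1,2) by metis+
  have at: "edge_pt u (nxt u) \<rho> u = 1 - \<rho>" for u \<rho> by (simp add: edge_pt_def)
  have supp: "{v. edge_pt u (nxt u) \<rho> v \<noteq> 0} = (if \<rho> = 0 then {u} else {u, nxt u})"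
    if "u \<noteq> nxt u" "\<rho> < 1" for u \<rho>
    using that by (auto simp: edge_pt_def)
  have "(if \<tau> = 0 then {x} else {x, nxt x}) = (if \<sigma> = 0 then {y} else {y, nxt y})"
    using supp[OF ne(1) assms(4)] supp[OF ne(2) assms(6)] eq by simp
  moreover have "\<not> (x = nxt y \<and> nxt x = y)" using nxt_nxt_ne[OF assms(2)] by auto
  ultimately have "x = y" using ne by (auto simp: doubleton_eq_iff split: if_splits)
  then show ?thesis using eq at[of x \<tau>] at[of x \<sigma>] by simp
qed

lemma curve_inj: "inj_on curve {0..<len}"
proof (rule inj_onI)
  fix s t assume s: "s \<in> {0..<len}" and t: "t \<in> {0..<len}" and eq: "curve s = curve t"
  show "s = t"
  proof (cases "limit_pt s")
    case True
    have "limit_pt t"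
    proof (rule ccontr)
      assume "\<not> limit_pt t"
      then show False using half_open_seg[OF t] eq curve_limit[OF True] by (metis space_pt.distinct(1))
    qed
    then show ?thesis using end_at_inj[OF True] eq curve_limit True by simp
  next
    case False
    obtain x \<tau> where x: "x \<in> V" "0 \<le> \<tau>" "\<tau> < 1" "s = pos x + \<tau> * weight x" "curve s = Pt (edge_pt x (nxt x) \<tau>)"
      using half_open_seg[OF s False] .
    have "\<not> limit_pt t" using x(5) eq curve_limit[of t] by auto
    then obtain y \<sigma> where y: "y \<in> V" "0 \<le> \<sigma>" "\<sigma> < 1" "t = pos y + \<sigma> * weight y" "curve t = Pt (edge_pt y (nxt y) \<sigma>)"
      using half_open_seg[OF t] by blast
    have "edge_pt x (nxt x) \<tau> = edge_pt y (nxt y) \<sigma>" using x(5) y(5) eq by simp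
    from edge_pt_nxt_inj[OF x(1) y(1) x(2,3) y(2,3) this] show ?thesis using x(4) y(4) by simp
  qed
qed

theorem hamilton_circle_exists: "\<exists>K. hamilton_circle H K"
proof
  have "Pt (vertex_pt v) \<in> curve ` {0..len}" if "v \<in> V" for v
    using curve_pos[OF that] seg_sub[OF that] pos_in_seg[of v] by (metis image_eqI subsetD)
  moreover have "curve ` {0..len} \<subseteq> topspace (MTOP H)" using curve_in_topspace by blast
  ultimately show "hamilton_circle H (curve ` {0..len})"
    unfolding hamilton_circle_def
    using homeomorphic_circle_of_closed_curve[OF len_pos Hausdorff_MTOP[OF graph] continuous_curve curve_closed curve_inj]
    by simp
qed

end

section \<open>From Euler tours to Hamilton circles\<close>

text \<open>No edge leaves the set of vertices that are incident with an edge linked to \<open>e\<close>.\<close>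

lemma edges_linked_if_no_empty_cut:
  assumes G: "simple_graph G"
    and trivial: "\<And>X. cut (edges G) X = {} \<Longrightarrow> e \<subseteq> X \<Longrightarrow> f \<subseteq> X"
    and e: "e \<in> edges G" and f: "f \<in> edges G"
  shows "link (edges G) e f"
proof -
  define X where "X = \<Union> {g. link (edges G) e g}"
  have touch: "link (edges G) e h" if h: "h \<in> edges G" "x \<in> h" "x \<in> X" for h x
  proof -
    obtain g where g: "link (edges G) e g" "x \<in> g" using h(3) unfolding X_def by blast
    have "link (edges G) g h" using link_in(2)[OF g(1)] h(1) g(2) h(2) by (rule link_touch)
    with g(1) show ?thesis by (rule link_trans)
  qed
  have "h \<subseteq> X" if "h \<in> edges G" "x \<in> h" "x \<in> X" for h x
    unfolding X_def using touch[OF that] by (intro Union_upper) simp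
  then have "cut (edges G) X = {}" unfolding cut_def by blast
  moreover have "e \<subseteq> X" unfolding X_def using link_refl[OF e] by (intro Union_upper) simp
  ultimately have "f \<subseteq> X" by (rule trivial)
  moreover obtain x y where "f = {x, y}" using edgeE[OF G f] .
  ultimately show ?thesis using touch[OF f, of x] by simp
qed

theorem theorem1p4:
  fixes G :: "'v graph"
  assumes "simple_graph G"
    and "countable (verts G)"
    and "edges G \<noteq> {}"
    and "\<exists>\<sigma>. euler_tour G \<sigma>"
  shows "\<exists>K. hamilton_circle (line_graph G) K"
proof -
  obtain \<sigma> where \<sigma>: "euler_tour G \<sigma>" using assms(4) by (elim exE)
  interpret tour G \<sigma> by (rule tour.intro[OF assms(1) \<sigma> assms(3)])
  have even: "even_cuts (edges G)" using even_finite_cut by (simp add: even_cuts_def)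
  have conn: "\<forall>e\<in>edges G. \<forall>f\<in>edges G. link (edges G) e f"
  proof (intro ballI)
    fix e f assume e: "e \<in> edges G" and f: "f \<in> edges G"
    show "link (edges G) e f"
      by (rule edges_linked_if_no_empty_cut[OF assms(1) empty_cut_trivial[OF _ e _ f] e f])
  qed
  from line_graph_circular_layout[OF assms(1-3) even conn] obtain less bot top F
    where "circular_layout (line_graph G) less bot top F" by (elim exE)
  then show ?thesis by (rule circular_layout.hamilton_circle_exists)
qed

end
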